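(* Let $X$ be one of the classes $W^r_{r-1}(M)$, $W^r_{r-2}(M)$, $W^r_{r-1,r-2}(M,N)$, let $n\in\mathbb N$, and let $u^*=\left(0,\frac{\pi}{n},\frac{2\pi}{n},\dots,\frac{(2n-1)\pi}{n}\right)$. Then $$E(X,\|\cdot\|_\infty)=E(X,u^*,\|\cdot\|_\infty),$$ that is, for the uniform metric the uniform partition of $[0,2\pi]$ is a best information set of $2n$ points.
   Context: All functions are real-valued and $2\pi$-periodic on $\mathbb R$. $L^r_\infty$ is the set of $2\pi$-periodic functions $f$ such that $f^{(r-1)}$ is (locally) absolutely continuous and $f^{(r)}\in L_\infty$; $\|\cdot\|_\infty$ is the (essential) sup norm; $C$ is the space of continuous $2\pi$-periodic functions. $M,N>0$ are fixed. Classes: for $r\ge 2$, $W^r_{r-1}(M)=\{x\in L^r_\infty:\|x^{(r)}\|_\infty\le 1,\ \|x^{(r-1)}\|_\infty\le M\}$; for $r\ge 3$, $W^r_{r-2}(M)=\{x\in L^r_\infty:\|x^{(r)}\|_\infty\le 1,\ \|x^{(r-2)}\|_\infty\le M\}$ and $W^r_{r-1,r-2}(M,N)=\{x\in L^r_\infty:\|x^{(r)}\|_\infty\le1,\ \|x^{(r-1)}\|_\infty\le N,\ \|x^{(r-2)}\|_\infty\le M\}$. Recovery problem. For $u=(u_1,\dots,u_{2n})$ with $0\le u_1<\dots<u_{2n}<2\pi$, a recovery method is an arbitrary function $\Psi:\mathbb R^{2n}\to C$; its error is $e(X,u,\Psi,\|\cdot\|)=\sup_{x\in X}\|x-\Psi(x(u_1),\dots,x(u_{2n}))\|$;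 the best error is $E(X,u,\|\cdot\|)=\inf_\Psi e(X,u,\Psi,\|\cdot\|)$; and $E(X,\|\cdot\|)=\inf_u E(X,u,\|\cdot\|)$, the infimum over all such vectors $u$ of $2n$ points. *)

theory Defs
  imports "HOL-Probability.Essential_Supremum" "HOL-Library.Periodic_Fun"
begin

definition absolutely_continuous_on :: "real set \<Rightarrow> (real \<Rightarrow> real) \<Rightarrow> bool" where
  "absolutely_continuous_on S f \<longleftrightarrow>
     (\<forall>\<epsilon>>0. \<exists>\<delta>>0. \<forall>P :: (real \<times> real) set.
        finite P \<longrightarrow>
        (\<forall>(s, t)\<in>P. s \<le> t \<and> {s..t} \<subseteq> S) \<longrightarrow>
        pairwise (\<lambda>p q. {fst p<..<snd p} \<inter> {fst q<..<snd q} = {}) P \<longrightarrow>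
        (\<Sum>(s, t)\<in>P. t - s) < \<delta> \<longrightarrow>
        (\<Sum>(s, t)\<in>P. \<bar>f t - f s\<bar>) < \<epsilon>)"

definition locally_absolutely_continuous :: "(real \<Rightarrow> real) \<Rightarrow> bool" where
  "locally_absolutely_continuous f \<longleftrightarrow> (\<forall>a b. absolutely_continuous_on {a..b} f)"

text \<open>Essential supremum norm; the value is \<open>\<infinity>\<close> if \<open>\<lambda>x. \<bar>f x\<bar>\<close> is not Lebesgue measurable.\<close>
definition Linf_norm :: "(real \<Rightarrow> real) \<Rightarrow> ennreal" where
  "Linf_norm f = esssup lebesgue (\<lambda>x. ennreal \<bar>f x\<bar>)"

definition Linf :: "(real \<Rightarrow> real) set" where
  "Linf = {f. f \<in> borel_measurable lebesgue \<and> Linf_norm f < \<infinity>}"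

text \<open>
  The top derivative \<open>(deriv ^^ r) f\<close> exists only almost everywhere; at the remaining points
  \<^const>\<open>deriv\<close> returns an unspecified value, which neither \<open>Linf\<close> nor \<open>Linf_norm\<close> sees.
\<close>
definition L_space :: "nat \<Rightarrow> (real \<Rightarrow> real) set" where
  "L_space r = {f. periodic_fun_simple f (2 * pi) \<and>
     (\<forall>k. k < r - 1 \<longrightarrow> (\<forall>t. (deriv ^^ k) f field_differentiable at t)) \<and>
     locally_absolutely_continuous ((deriv ^^ (r - 1)) f) \<and>
     (deriv ^^ r) f \<in> Linf}"

definition C_periodic :: "(real \<Rightarrow> real) set" where
  "C_periodic = {f. periodic_fun_simple f (2 * pi) \<and> continuous_on UNIV f}"

definition W_1 :: "nat \<Rightarrow> real \<Rightarrow> (real \<Rightarrow> real) set" where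
  "W_1 r M = {x \<in> L_space r.
     Linf_norm ((deriv ^^ r) x) \<le> 1 \<and> Linf_norm ((deriv ^^ (r - 1)) x) \<le> ennreal M}"

definition W_2 :: "nat \<Rightarrow> real \<Rightarrow> (real \<Rightarrow> real) set" where
  "W_2 r M = {x \<in> L_space r.
     Linf_norm ((deriv ^^ r) x) \<le> 1 \<and> Linf_norm ((deriv ^^ (r - 2)) x) \<le> ennreal M}"

definition W_12 :: "nat \<Rightarrow> real \<Rightarrow> real \<Rightarrow> (real \<Rightarrow> real) set" where
  "W_12 r M N = {x \<in> L_space r.
     Linf_norm ((deriv ^^ r) x) \<le> 1 \<and>
     Linf_norm ((deriv ^^ (r - 1)) x) \<le> ennreal N \<and>
     Linf_norm ((deriv ^^ (r - 2)) x) \<le> ennreal M}"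

text \<open>A vector of \<open>m\<close> reals is a list of length \<open>m\<close>.\<close>
definition nodes :: "nat \<Rightarrow> real list set" where
  "nodes m = {u. length u = m \<and> sorted_wrt (<) u \<and> set u \<subseteq> {0..<2 * pi}}"

definition recovery_methods :: "nat \<Rightarrow> (real list \<Rightarrow> real \<Rightarrow> real) set" where
  "recovery_methods m = {\<Psi>. \<forall>v. length v = m \<longrightarrow> \<Psi> v \<in> C_periodic}"

definition method_error ::
  "(real \<Rightarrow> real) set \<Rightarrow> real list \<Rightarrow> (real list \<Rightarrow> real \<Rightarrow> real) \<Rightarrow> ((real \<Rightarrow> real) \<Rightarrow> ennreal) \<Rightarrow> ennreal"
  where "method_error X u \<Psi> nrm = (SUP x\<in>X. nrm (\<lambda>t. x t - \<Psi> (map x u) t))"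

definition best_error_at ::
  "(real \<Rightarrow> real) set \<Rightarrow> real list \<Rightarrow> ((real \<Rightarrow> real) \<Rightarrow> ennreal) \<Rightarrow> ennreal"
  where "best_error_at X u nrm = (INF \<Psi>\<in>recovery_methods (length u). method_error X u \<Psi> nrm)"

definition best_error ::
  "nat \<Rightarrow> (real \<Rightarrow> real) set \<Rightarrow> ((real \<Rightarrow> real) \<Rightarrow> ennreal) \<Rightarrow> ennreal"
  where "best_error m X nrm = (INF u\<in>nodes m. best_error_at X u nrm)"

definition uniform_nodes :: "nat \<Rightarrow> real list" where
  "uniform_nodes n = map (\<lambda>k. real k * pi / real n) [0..<2 * n]"

end

(*
The error at fixed nodes u is the largest norm of a function of the class that vanishes at u. Let h = pi/n
and let G be the h-antiperiodic function that moves back and forth as fast as the constraints on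
x^(r-2) and its derivatives permit, between plateaus (possibly of width zero) at the distance h;
phi is its (r-2)-fold integral.

A function of the class that vanishes at the uniform nodes is bounded by the norm of phi. Otherwise some
multiple of it, by a factor less than 1 in absolute value, minus a translate of phi has 2n + 1 zeros in a
period. By Rolle so does the (r-2)-th derivative of the difference (and the next one), although one of the
two vanishes at most once between consecutive plateaus (or consecutive slopes) of G.

For arbitrary nodes, consider the 2n-dimensional space of integrated splines whose (r-2)-th derivative
moves between arbitrary plateau values in the way G does. Some translate of this space contains a nonzero
function vanishing at all 2n nodes: the determinant of the evaluation matrix changes sign under
translation by h, which permutes the 2n basis functions cyclically. Normalise that function so that its
largest plateau value is that of G. It lies in the class, and if its norm were less than that of phi, then
its difference with phi, and hence the (r-2)-th derivative of the difference, would alternate in sign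
2n times, while one of the 2n plateau values of that derivative is zero.

The bound on x^(r) holds only almost everywhere; it makes x^(r-1) Lipschitz because absolutely continuous
functions are differentiable almost everywhere, which follows from the Vitali covering theorem.
*)
theory Submission
  imports Defs "Jordan_Normal_Form.Determinant"
begin

text \<open>With r = p + 2, a function of a class is handled through its tower of derivatives, where
  the bound on the r-th one becomes a Lipschitz condition on the top member. The three classes are
  treated as one: a bound that a class lacks is replaced by 2 pi for x^(r-1) or by (2 pi)^2 for
  x^(r-2), which a function vanishing at a node obeys anyway, since every derivative of a periodic
  function has a zero. The half-width \<open>a\<close> of the bumps of G' is at most h/2 and as
  large as M permits. Either G attains M, and the (r-2)-th derivatives are compared, or the bumps
  fill the cells, and one further derivative is compared. The obstacle in the lower bound is that
  periodic integration kills constants, while the spline space must keep the even dimension 2n for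
  the determinant to change sign. The integration therefore puts the mean back. The p-th derivative
  of a spline then has its plateau values shifted by a common constant, and the normalisation and
  the comparison with phi use these shifted values.\<close>

section \<open>Vitali coverings by finitely many intervals\<close>

text \<open>The Vitali theorem yields countably many disjoint intervals covering \<open>S\<close> up
  to a null set. Inside \<open>U\<close> they have finite total measure, so finitely many of them
  leave out less than \<open>\<epsilon>\<close>; \<open>T\<close> collects the null set and the
  discarded intervals.\<close>

lemma Vitali_finite_intervals:
  fixes K :: "(real \<times> real) set" and S U :: "real set"
  assumes fine: "\<And>x d. \<lbrakk>x \<in> S; 0 < d\<rbrakk> \<Longrightarrow> \<exists>s t. (s, t) \<in> K \<and> s \<le> x \<and> x \<le> t \<and> s < t \<and> t - s < d"
    and U: "open U" "U \<in> lmeasurable" "S \<subseteq> U" and "0 < \<epsilon>"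
  obtains C T where "finite C" "C \<subseteq> K" "\<And>s t. (s, t) \<in> C \<Longrightarrow> s < t \<and> {s..t} \<subseteq> U"
    "pairwise (\<lambda>p q. disjnt {fst p..snd p} {fst q..snd q}) C"
    "S \<subseteq> (\<Union>p\<in>C. {fst p..snd p}) \<union> T" "T \<in> lmeasurable" "measure lebesgue T < \<epsilon>"
proof -
  define K' where "K' = {p \<in> K. fst p < snd p \<and> {fst p..snd p} \<subseteq> U}"
  define a r :: "real \<times> real \<Rightarrow> real"
    where "a = (\<lambda>p. (fst p + snd p) / 2)" and "r = (\<lambda>p. (snd p - fst p) / 2)"
  have cb: "cball (a p) (r p) = {fst p..snd p}" for p
    by (simp add: a_def r_def cball_eq_atLeastAtMost field_simps)
  have 1: "0 < r p" if "p \<in> K'" for p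
    using that by (auto simp: K'_def r_def)
  have 2: "\<exists>p. p \<in> K' \<and> x \<in> cball (a p) (r p) \<and> r p < d" if xd: "x \<in> S" "0 < d" for x d
  proof -
    obtain e where e: "e > 0" "ball x e \<subseteq> U"
      using U(1) U(3) xd(1) by (meson openE subsetD)
    obtain s t where st: "(s, t) \<in> K" "s \<le> x" "x \<le> t" "s < t" "t - s < min d e"
      using fine[OF xd(1), of "min d e"] xd(2) e by auto
    have "{s..t} \<subseteq> ball x e"
      using st by (auto simp: dist_real_def)
    then have "(s, t) \<in> K'"
      using st e by (auto simp: K'_def)
    moreover have "x \<in> cball (a (s, t)) (r (s, t))"
      using st unfolding cb by simp
    moreover have "r (s, t) < d"
      using st by (simp add: r_def)
    ultimately show ?thesis by blast
  qed
  obtain C0 where C0: "countable C0" "C0 \<subseteq> K'"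
    "pairwise (\<lambda>i j. disjnt (cball (a i) (r i)) (cball (a j) (r j))) C0"
    "negligible (S - (\<Union>i\<in>C0. cball (a i) (r i)))"
    by (rule Vitali_covering_theorem_cballs[of K' r S a, OF 1 2])
  define V where "V = (\<Union>p\<in>C0. {fst p..snd p})"
  show thesis
  proof (cases "C0 = {}")
    case True
    then have "negligible S" using C0 by simp
    then show thesis
      by (intro that[of "{}" S]) (auto simp: negligible_imp_measurable negligible_imp_measure0 \<open>0 < \<epsilon>\<close>)
  next
    case False
    define A where "A n = (\<Union>p\<in>from_nat_into C0 ` {..n}. {fst p..snd p})" for n
    have CC: "from_nat_into C0 ` {..n} \<subseteq> C0" for n
      using from_nat_into[OF False] by auto
    have Vun: "V = (\<Union>n. A n)"
    proof -
      have "range (from_nat_into C0) = C0" using C0(1) False by (simp add: range_from_nat_into)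
      then have "V = (\<Union>p\<in>range (from_nat_into C0). {fst p..snd p})"
        by (simp add: V_def)
      also have "\<dots> = (\<Union>n. A n)" unfolding A_def by auto
      finally show ?thesis .
    qed
    have Am: "A n \<in> lmeasurable" for n unfolding A_def
      by (intro fmeasurable.finite_UN) auto
    have VU: "V \<subseteq> U" using C0(2) by (auto simp: V_def K'_def)
    have Vm: "V \<in> lmeasurable"
    proof (rule fmeasurableI2[OF U(2) VU])
      show "V \<in> sets lebesgue" unfolding Vun using Am by (auto simp: fmeasurable_def)
    qed
    have "(\<lambda>n. measure lebesgue (A n)) \<longlonglongrightarrow> measure lebesgue (\<Union>n. A n)"
    proof (rule Lim_measure_incseq)
      show "range A \<subseteq> sets lebesgue" using Am by (auto simp: fmeasurable_def)
      show "incseq A" unfolding A_def incseq_def by (force intro!: UN_mono)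
      show "emeasure lebesgue (\<Union>n. A n) \<noteq> \<infinity>" using fmeasurableD2[OF Vm] unfolding Vun by (simp del: emeasure_completion)
    qed
    then have "eventually (\<lambda>n. measure lebesgue (A n) > measure lebesgue V - \<epsilon>) sequentially"
      unfolding Vun using \<open>0 < \<epsilon>\<close> by (intro order_tendstoD) auto
    then obtain n where n: "measure lebesgue (A n) > measure lebesgue V - \<epsilon>"
      by (auto simp: eventually_sequentially)
    define C where "C = from_nat_into C0 ` {..n}"
    have AV: "A n \<subseteq> V" using Vun by blast
    define N where "N = S - V"
    have N: "negligible N" using C0(4) by (simp add: N_def V_def cb)
    show thesis
    proof (rule that[of C "(V - A n) \<union> N"])
      show "finite C" by (simp add: C_def)
      show "C \<subseteq> K" using CC[of n] C0(2) by (auto simp: C_def K'_def)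
      show "s < t \<and> {s..t} \<subseteq> U" if "(s, t) \<in> C" for s t
      proof -
        have "(s, t) \<in> K'" using that CC[of n] C0(2) unfolding C_def by blast
        then show ?thesis by (simp add: K'_def)
      qed
      show "pairwise (\<lambda>p q. disjnt {fst p..snd p} {fst q..snd q}) C"
        using pairwise_subset[OF C0(3) CC[of n]] by (simp add: C_def cb)
      show "S \<subseteq> (\<Union>p\<in>C. {fst p..snd p}) \<union> (V - A n \<union> N)"
        by (auto simp: N_def A_def C_def)
      have VA: "V - A n \<in> lmeasurable" using Vm Am by (intro fmeasurable.Diff)
      then show "V - A n \<union> N \<in> lmeasurable"
        using N by (intro fmeasurable.Un) (auto simp: negligible_imp_measurable)
      have "measure lebesgue (V - A n \<union> N) \<le> measure lebesgue (V - A n) + measure lebesgue N"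
        using VA N by (intro measure_Un_le) (auto simp: negligible_imp_measurable fmeasurableD)
      also have "\<dots> = measure lebesgue V - measure lebesgue (A n)"
        using N Vm Am AV by (simp add: negligible_imp_measure0 measurable_measure_Diff fmeasurableD)
      finally show "measure lebesgue (V - A n \<union> N) < \<epsilon>" using n by simp
    qed
  qed
qed

lemma measure_finite_disjoint_intervals:
  fixes C :: "(real \<times> real) set"
  assumes "finite C" "\<And>s t. (s, t) \<in> C \<Longrightarrow> s \<le> t"
    and "pairwise (\<lambda>p q. disjnt {fst p..snd p} {fst q..snd q}) C"
  shows "measure lebesgue (\<Union>p\<in>C. {fst p..snd p}) = (\<Sum>(s, t)\<in>C. t - s)"
proof -
  have "measure lebesgue (\<Union>p\<in>C. {fst p..snd p}) = (\<Sum>p\<in>C. measure lebesgue {fst p..snd p})"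
    using assms by (intro measure_UNION') auto
  also have "\<dots> = (\<Sum>(s, t)\<in>C. t - s)"
    using assms(2) by (intro sum.cong) (auto split: prod.splits)
  finally show ?thesis .
qed

text \<open>\<open>P\<close> consists of the gaps that the intervals of \<open>C\<close> leave in \<open>[u, v]\<close>.\<close>
lemma interval_gaps:
  fixes C :: "(real \<times> real) set" and f :: "real \<Rightarrow> real"
  assumes "finite C" "u \<le> v" "\<And>s t. (s, t) \<in> C \<Longrightarrow> s < t \<and> {s..t} \<subseteq> {u..v}"
    and "pairwise (\<lambda>p q. disjnt {fst p..snd p} {fst q..snd q}) C"
  shows "\<exists>P. finite P \<and> (\<forall>(s, t)\<in>P. s < t \<and> {s..t} \<subseteq> {u..v}) \<and>
     pairwise (\<lambda>p q. {fst p<..<snd p} \<inter> {fst q<..<snd q} = {}) P \<and>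
     (\<Sum>(s, t)\<in>P. t - s) = (v - u) - (\<Sum>(s, t)\<in>C. t - s) \<and>
     (\<Sum>(s, t)\<in>P. f t - f s) = (f v - f u) - (\<Sum>(s, t)\<in>C. f t - f s)"
  using assms
proof (induction "card C" arbitrary: C v)
  case 0
  then have C: "C = {}" by simp
  show ?case
  proof (cases "u = v")
    case True
    then show ?thesis using C by (intro exI[of _ "{}"]) auto
  next
    case False
    then show ?thesis using C 0 by (intro exI[of _ "{(u, v)}"]) auto
  qed
next
  case (Suc k)
  have ne: "C \<noteq> {}" using Suc.hyps(2) by auto
  \<comment> \<open>With the rightmost interval \<open>(s, t)\<close> removed, the others lie in
    \<open>[u, s]\<close>; the induction fills that part, and \<open>[t, v]\<close> is the one
    further gap.\<close>
  obtain p where p: "p \<in> C" "\<And>q. q \<in> C \<Longrightarrow> snd q \<le> snd p"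
  proof -
    have "Max (snd ` C) \<in> snd ` C" using Suc.prems(1) ne by (intro Max_in) auto
    then obtain p where "p \<in> C" "snd p = Max (snd ` C)" by auto
    then show ?thesis using that[of p] Suc.prems(1) by auto
  qed
  obtain s t where st: "p = (s, t)" by (cases p)
  have stp: "s < t" "u \<le> s" "t \<le> v" using Suc.prems(3)[of s t] p st by auto
  let ?C = "C - {p}"
  have sub: "s' < t' \<and> {s'..t'} \<subseteq> {u..s}" if "(s', t') \<in> ?C" for s' t'
  proof -
    have a: "s' < t'" "{s'..t'} \<subseteq> {u..v}" using that Suc.prems(3)[of s' t'] by auto
    have b: "t' \<le> t" using p(2)[of "(s', t')"] that st by auto
    have "disjnt {s'..t'} {s..t}"
      using Suc.prems(4) that p(1) st unfolding pairwise_def by force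
    then have "t' \<notin> {s..t}" using a unfolding disjnt_iff by (meson atLeastAtMost_iff less_imp_le order_refl)
    then have "t' < s" using b by auto
    then show ?thesis using a by auto
  qed
  have "\<exists>P. finite P \<and> (\<forall>(s', t')\<in>P. s' < t' \<and> {s'..t'} \<subseteq> {u..s}) \<and>
     pairwise (\<lambda>p q. {fst p<..<snd p} \<inter> {fst q<..<snd q} = {}) P \<and>
     (\<Sum>(s, t)\<in>P. t - s) = (s - u) - (\<Sum>(s, t)\<in>?C. t - s) \<and>
     (\<Sum>(s, t)\<in>P. f t - f s) = (f s - f u) - (\<Sum>(s, t)\<in>?C. f t - f s)"
  proof (rule Suc.hyps(1))
    show "k = card ?C" using Suc.hyps(2) p(1) Suc.prems(1) by simp
    show "pairwise (\<lambda>p q. disjnt {fst p..snd p} {fst q..snd q}) ?C"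
      using Suc.prems(4) by (rule pairwise_mono) auto
  qed (use Suc.prems(1) sub stp in auto)
  then obtain P where P: "finite P" "\<forall>(s', t')\<in>P. s' < t' \<and> {s'..t'} \<subseteq> {u..s}"
     "pairwise (\<lambda>p q. {fst p<..<snd p} \<inter> {fst q<..<snd q} = {}) P"
     "(\<Sum>(s, t)\<in>P. t - s) = (s - u) - (\<Sum>(s, t)\<in>?C. t - s)"
     "(\<Sum>(s, t)\<in>P. f t - f s) = (f s - f u) - (\<Sum>(s, t)\<in>?C. f t - f s)"
    by blast
  have sumC: "(\<Sum>(s, t)\<in>C. g s t) = g s t + (\<Sum>(s, t)\<in>?C. g s t)" for g :: "real \<Rightarrow> real \<Rightarrow> real"
    using sum.remove[OF Suc.prems(1) p(1), of "\<lambda>(s, t). g s t"] st by simp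
  show ?case
  proof (cases "t = v")
    case True
    show ?thesis
      using P stp True sumC[of "\<lambda>s t. t - s"] sumC[of "\<lambda>s t. f t - f s"]
      by (intro exI[of _ P]) fastforce
  next
    case False
    then have tv: "t < v" using stp by simp
    have nin: "(t, v) \<notin> P" using P(2) stp tv by fastforce
    have dis: "{s'<..<t'} \<inter> {t<..<v} = {}" if "(s', t') \<in> P" for s' t'
      using P(2) that stp by fastforce
    show ?thesis
    proof (intro exI[of _ "insert (t, v) P"] conjI)
      show "finite (insert (t, v) P)" using P by simp
      show "\<forall>(s', t')\<in>insert (t, v) P. s' < t' \<and> {s'..t'} \<subseteq> {u..v}"
        using P(2) stp tv by fastforce
      show "pairwise (\<lambda>p q. {fst p<..<snd p} \<inter> {fst q<..<snd q} = {}) (insert (t, v) P)"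
        unfolding pairwise_insert using P(3) dis by fastforce
    qed (use P nin sumC[of "\<lambda>s t. t - s"] sumC[of "\<lambda>s t. f t - f s"] in auto)
  qed
qed

text \<open>Meant for nested coverings: absolute continuity controls the increment over
  \<open>P\<close>, hence the difference between the increments over \<open>C\<close> and
  \<open>D\<close>. The groups \<open>DD p\<close> partition \<open>D\<close>, so the gaps can be
  formed in each interval of \<open>C\<close> separately.\<close>

lemma interval_family_gaps:
  fixes C D :: "(real \<times> real) set" and f :: "real \<Rightarrow> real"
  assumes C: "finite C" "\<And>s t. (s, t) \<in> C \<Longrightarrow> s < t"
      "pairwise (\<lambda>p q. disjnt {fst p..snd p} {fst q..snd q}) C"
    and D: "finite D" "\<And>s t. (s, t) \<in> D \<Longrightarrow> s < t \<and> (\<exists>p\<in>C. {s..t} \<subseteq> {fst p..snd p})"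
      "pairwise (\<lambda>p q. disjnt {fst p..snd p} {fst q..snd q}) D"
  obtains P where "finite P" "\<And>s t. (s, t) \<in> P \<Longrightarrow> s < t \<and> (\<exists>p\<in>C. {s..t} \<subseteq> {fst p..snd p})"
     "pairwise (\<lambda>p q. {fst p<..<snd p} \<inter> {fst q<..<snd q} = {}) P"
     "(\<Sum>(s, t)\<in>P. t - s) = (\<Sum>(s, t)\<in>C. t - s) - (\<Sum>(s, t)\<in>D. t - s)"
     "(\<Sum>(s, t)\<in>P. f t - f s) = (\<Sum>(s, t)\<in>C. f t - f s) - (\<Sum>(s, t)\<in>D. f t - f s)"
proof -
  define DD where "DD p = {q \<in> D. {fst q..snd q} \<subseteq> {fst p..snd p}}" for p
  have ne: "{fst q..snd q} \<noteq> {}" if "q \<in> D" for q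
    using D(2)[of "fst q" "snd q"] that by auto
  have DD_disj: "DD p \<inter> DD p' = {}" if "p \<in> C" "p' \<in> C" "p \<noteq> p'" for p p'
  proof -
    have "disjnt {fst p..snd p} {fst p'..snd p'}" using C(3) that by (auto simp: pairwise_def)
    then have "q \<notin> DD p'" if "q \<in> DD p" for q
      using ne[of q] that disjnt_subset1[of "{fst p..snd p}" "{fst p'..snd p'}" "{fst q..snd q}"]
      unfolding DD_def disjnt_def by blast
    then show ?thesis by blast
  qed
  have D_eq: "D = (\<Union>p\<in>C. DD p)"
    using D(2) by (fastforce simp: DD_def)
  have sumD: "sum g D = (\<Sum>p\<in>C. sum g (DD p))" for g :: "real \<times> real \<Rightarrow> real"
    by (subst D_eq, rule sum.UNION_disjoint) (use C(1) D(1) DD_disj in \<open>auto simp: DD_def\<close>)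
  define gaps where "gaps p P \<longleftrightarrow> finite P \<and> (\<forall>(s, t)\<in>P. s < t \<and> {s..t} \<subseteq> {fst p..snd p}) \<and>
     pairwise (\<lambda>p q. {fst p<..<snd p} \<inter> {fst q<..<snd q} = {}) P \<and>
     (\<Sum>(s, t)\<in>P. t - s) = (snd p - fst p) - (\<Sum>(s, t)\<in>DD p. t - s) \<and>
     (\<Sum>(s, t)\<in>P. f t - f s) = (f (snd p) - f (fst p)) - (\<Sum>(s, t)\<in>DD p. f t - f s)" for p P
  have "\<exists>P. gaps p P" if "p \<in> C" for p
    unfolding gaps_def
  proof (rule interval_gaps)
    show "finite (DD p)" using D(1) by (simp add: DD_def)
    show "fst p \<le> snd p" using C(2)[of "fst p" "snd p"] that by simp
    show "s < t \<and> {s..t} \<subseteq> {fst p..snd p}" if "(s, t) \<in> DD p" for s t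
      using that D(2)[of s t] by (simp add: DD_def)
    show "pairwise (\<lambda>p q. disjnt {fst p..snd p} {fst q..snd q}) (DD p)"
      using D(3) by (rule pairwise_mono) (auto simp: DD_def)
  qed
  then obtain G where "\<And>p. p \<in> C \<Longrightarrow> gaps p (G p)"
    by metis
  note G = this[unfolded gaps_def]
  have sep: "{fst q<..<snd q} \<inter> {fst q'<..<snd q'} = {} \<and> q \<noteq> q'"
    if "p \<in> C" "p' \<in> C" "p \<noteq> p'" "q \<in> G p" "q' \<in> G p'" for p p' q q'
  proof -
    have d: "disjnt {fst p..snd p} {fst p'..snd p'}" using C(3) that by (auto simp: pairwise_def)
    have q: "fst q < snd q" "{fst q..snd q} \<subseteq> {fst p..snd p}" using G[OF that(1)] that(4) by auto
    have q': "fst q' < snd q'" "{fst q'..snd q'} \<subseteq> {fst p'..snd p'}" using G[OF that(2)] that(5) by auto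
    have d': "disjnt {fst q..snd q} {fst q'..snd q'}"
      by (meson d q(2) q'(2) disjnt_subset1 disjnt_subset2)
    then have "q \<noteq> q'" using q by (auto simp: disjnt_def)
    moreover have "disjnt {fst q<..<snd q} {fst q'<..<snd q'}"
      by (meson d' disjnt_subset1 disjnt_subset2 greaterThanLessThan_subseteq_atLeastAtMost_iff order_refl)
    ultimately show ?thesis by (simp add: disjnt_def)
  qed
  have sumP: "sum g (\<Union>p\<in>C. G p) = (\<Sum>p\<in>C. sum g (G p))" for g :: "real \<times> real \<Rightarrow> real"
    by (rule sum.UNION_disjoint) (use C(1) G sep in blast)+
  show thesis
  proof (rule that[of "\<Union>p\<in>C. G p"])
    show "finite (\<Union>p\<in>C. G p)" using C(1) G by auto
    show "s < t \<and> (\<exists>p\<in>C. {s..t} \<subseteq> {fst p..snd p})" if "(s, t) \<in> (\<Union>p\<in>C. G p)" for s t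
      using that G by fast
    show "pairwise (\<lambda>p q. {fst p<..<snd p} \<inter> {fst q<..<snd q} = {}) (\<Union>p\<in>C. G p)"
      unfolding pairwise_def
    proof (intro ballI impI)
      fix q q' assume "q \<in> (\<Union>p\<in>C. G p)" "q' \<in> (\<Union>p\<in>C. G p)" and neq: "q \<noteq> q'"
      then obtain p p' where pp: "p \<in> C" "p' \<in> C" "q \<in> G p" "q' \<in> G p'" by blast
      show "{fst q<..<snd q} \<inter> {fst q'<..<snd q'} = {}"
      proof (cases "p = p'")
        case True
        then show ?thesis using G[OF pp(1)] pp neq by (simp add: pairwise_def)
      qed (use sep pp in blast)
    qed
    show "(\<Sum>(s, t)\<in>(\<Union>p\<in>C. G p). t - s) = (\<Sum>(s, t)\<in>C. t - s) - (\<Sum>(s, t)\<in>D. t - s)"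
      unfolding sumP sumD using G by (simp add: sum_subtractf case_prod_unfold)
    show "(\<Sum>(s, t)\<in>(\<Union>p\<in>C. G p). f t - f s) = (\<Sum>(s, t)\<in>C. f t - f s) - (\<Sum>(s, t)\<in>D. f t - f s)"
      unfolding sumP sumD using G by (simp add: sum_subtractf case_prod_unfold)
  qed
qed

section \<open>Differentiability of absolutely continuous functions\<close>

lemma absolutely_continuous_onD:
  assumes "absolutely_continuous_on S f" "0 < \<epsilon>"
  shows "\<exists>\<delta>>0. \<forall>P. finite P \<longrightarrow> (\<forall>(s, t)\<in>P. s < t \<and> {s..t} \<subseteq> S) \<longrightarrow>
      pairwise (\<lambda>p q. {fst p<..<snd p} \<inter> {fst q<..<snd q} = {}) P \<longrightarrow> (\<Sum>(s, t)\<in>P. t - s) < \<delta> \<longrightarrow>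
      \<bar>\<Sum>(s, t)\<in>P. f t - f s\<bar> < \<epsilon>"
proof -
  obtain \<delta> where \<delta>: "0 < \<delta>" and
    *: "\<forall>P. finite P \<longrightarrow> (\<forall>(s, t)\<in>P. s \<le> t \<and> {s..t} \<subseteq> S) \<longrightarrow>
        pairwise (\<lambda>p q. {fst p<..<snd p} \<inter> {fst q<..<snd q} = {}) P \<longrightarrow>
        (\<Sum>(s, t)\<in>P. t - s) < \<delta> \<longrightarrow> (\<Sum>(s, t)\<in>P. \<bar>f t - f s\<bar>) < \<epsilon>"
    using assms unfolding absolutely_continuous_on_def by meson
  show ?thesis
  proof (intro exI[of _ \<delta>] conjI \<delta> allI impI)
    fix P :: "(real \<times> real) set"
    assume P: "finite P" "\<forall>(s, t)\<in>P. s < t \<and> {s..t} \<subseteq> S"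
      "pairwise (\<lambda>p q. {fst p<..<snd p} \<inter> {fst q<..<snd q} = {}) P" "(\<Sum>(s, t)\<in>P. t - s) < \<delta>"
    have "\<bar>\<Sum>(s, t)\<in>P. f t - f s\<bar> \<le> (\<Sum>(s, t)\<in>P. \<bar>f t - f s\<bar>)"
      using sum_abs[of "\<lambda>(s, t). f t - f s" P] by (simp add: case_prod_unfold)
    also have "\<dots> < \<epsilon>"
      using P by (intro *[rule_format]) (auto simp: less_imp_le)
    finally show "\<bar>\<Sum>(s, t)\<in>P. f t - f s\<bar> < \<epsilon>" .
  qed
qed

lemma absolutely_continuous_on_minus:
  assumes "absolutely_continuous_on S f"
  shows "absolutely_continuous_on S (\<lambda>x. - f x)"
proof -
  have "\<bar>- f t - - f s\<bar> = \<bar>f t - f s\<bar>" for s t by simp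
  then show ?thesis using assms unfolding absolutely_continuous_on_def by simp
qed

text \<open>The intervals straddle \<open>x\<close> and may have it as an end point, the form in
  which the covering lemma takes its family. For \<open>- f\<close> and \<open>- p\<close> the
  condition produces quotients below \<open>p\<close>, so the two together express oscillation of
  the difference quotients.\<close>

definition steep_at :: "(real \<Rightarrow> real) \<Rightarrow> real \<Rightarrow> real \<Rightarrow> bool" where
  "steep_at f c x \<longleftrightarrow> (\<forall>d>0. \<exists>s t. s \<le> x \<and> x \<le> t \<and> s < t \<and> t - s < d \<and> c * (t - s) < f t - f s)"

lemma pairwise_disjnt_imp_open_disjoint:
  assumes "pairwise (\<lambda>p q. disjnt {fst p..snd p} {fst q..snd (q :: real \<times> real)}) P"
  shows "pairwise (\<lambda>p q. {fst p<..<snd p} \<inter> {fst q<..<snd q} = {}) P"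
proof (rule pairwise_mono[OF assms])
  show "{fst p<..<snd p} \<inter> {fst q<..<snd q} = {}" if "disjnt {fst p..snd p} {fst q..snd q}" for p q :: "real \<times> real"
    using disjnt_subset1[OF disjnt_subset2[OF that]] greaterThanLessThan_subseteq_atLeastAtMost_iff
    by (metis disjnt_def order_refl)
qed auto

lemma negligible_steep_unbounded:
  assumes "absolutely_continuous_on {a..b} f"
  shows "negligible {x \<in> {a<..<b}. \<forall>q. steep_at f q x}"
proof -
  let ?E = "{x \<in> {a<..<b}. \<forall>q. steep_at f q x}"
  obtain \<delta> where \<delta>: "0 < \<delta>" and
    AC: "\<forall>P. finite P \<longrightarrow> (\<forall>(s, t)\<in>P. s < t \<and> {s..t} \<subseteq> {a..b}) \<longrightarrow>
      pairwise (\<lambda>p q. {fst p<..<snd p} \<inter> {fst q<..<snd q} = {}) P \<longrightarrow> (\<Sum>(s, t)\<in>P. t - s) < \<delta> \<longrightarrow>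
      \<bar>\<Sum>(s, t)\<in>P. f t - f s\<bar> < 1"
    using absolutely_continuous_onD[OF assms, of 1] zero_less_one_class.zero_less_one by blast
  have local: "\<exists>U. openin (top_of_set ?E) U \<and> z \<in> U \<and> negligible U" if z: "z \<in> ?E" for z
  proof (intro exI conjI)
    \<comment> \<open>Disjoint intervals inside a ball of radius \<open>\<delta> / 4\<close> have
      total length below \<open>\<delta>\<close>.\<close>
    define V where "V = ball z (\<delta> / 4) \<inter> {a<..<b}"
    show "openin (top_of_set ?E) (?E \<inter> V)"
      unfolding V_def by (intro openin_open_Int) auto
    show "z \<in> ?E \<inter> V" using z \<delta> by (auto simp: V_def)
    have V: "open V" "V \<in> lmeasurable" unfolding V_def
      by (auto intro!: bounded_set_imp_lmeasurable bounded_Int)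
    show "negligible (?E \<inter> V)"
      unfolding negligible_outer
    proof (intro allI impI)
      fix e :: real assume e: "e > 0"
      \<comment> \<open>Absolute continuity bounds the increment over the cover by 1, so slopes
        above \<open>2 / e\<close> leave total length below \<open>e / 2\<close>; the other half is
        for \<open>T\<close>.\<close>
      define q where "q = 2 / e"
      obtain C T where C: "finite C" "C \<subseteq> {(s, t). q * (t - s) < f t - f s}"
          "\<And>s t. (s, t) \<in> C \<Longrightarrow> s < t \<and> {s..t} \<subseteq> V"
          "pairwise (\<lambda>p q. disjnt {fst p..snd p} {fst q..snd q}) C"
          "?E \<inter> V \<subseteq> (\<Union>p\<in>C. {fst p..snd p}) \<union> T" "T \<in> lmeasurable" "measure lebesgue T < e / 2"
      proof (rule Vitali_finite_intervals[of "?E \<inter> V" "{(s, t). q * (t - s) < f t - f s}" V "e / 2"])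
        show "\<exists>s t. (s, t) \<in> {(s, t). q * (t - s) < f t - f s} \<and> s \<le> x \<and> x \<le> t \<and> s < t \<and> t - s < d"
          if "x \<in> ?E \<inter> V" "0 < d" for x d
          using that unfolding steep_at_def by fast
      qed (use V e in auto)
      have len: "(\<Sum>(s, t)\<in>C. t - s) = measure lebesgue (\<Union>p\<in>C. {fst p..snd p})"
        by (rule measure_finite_disjoint_intervals[symmetric]) (use C in \<open>auto simp: less_imp_le\<close>)
      have CV: "(\<Union>p\<in>C. {fst p..snd p}) \<subseteq> V" using C(3) by fastforce
      have "measure lebesgue (\<Union>p\<in>C. {fst p..snd p}) \<le> measure lebesgue (ball z (\<delta> / 4))"
        using CV C(1) by (intro measure_mono_fmeasurable) (auto simp: V_def)
      also have "ball z (\<delta> / 4) = {z - \<delta> / 4<..<z + \<delta> / 4}" by (rule ball_eq_greaterThanLessThan)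
      also have "measure lebesgue \<dots> = \<delta> / 2" using \<delta> by simp
      finally have len\<delta>: "(\<Sum>(s, t)\<in>C. t - s) < \<delta>" using \<delta> len by simp
      have "q * (\<Sum>(s, t)\<in>C. t - s) \<le> (\<Sum>(s, t)\<in>C. f t - f s)"
        unfolding sum_distrib_left using C(2) by (intro sum_mono) force
      also have "\<dots> < 1"
      proof -
        have "V \<subseteq> {a..b}" by (auto simp: V_def)
        then have "s < t \<and> {s..t} \<subseteq> {a..b}" if "(s, t) \<in> C" for s t
          using C(3)[OF that] by blast
        then have "\<forall>(s, t)\<in>C. s < t \<and> {s..t} \<subseteq> {a..b}" by blast
        then have "\<bar>\<Sum>(s, t)\<in>C. f t - f s\<bar> < 1"
          using C len\<delta> by (intro AC[rule_format] pairwise_disjnt_imp_open_disjoint) auto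
        then show ?thesis by simp
      qed
      finally have "(\<Sum>(s, t)\<in>C. t - s) < e / 2" using e by (simp add: q_def field_simps)
      moreover have "(\<Union>p\<in>C. {fst p..snd p}) \<in> sets lebesgue"
        using C(1) by (intro sets.finite_UN) auto
      ultimately have "measure lebesgue ((\<Union>p\<in>C. {fst p..snd p}) \<union> T) < e"
        using measure_Un_le[of "\<Union>p\<in>C. {fst p..snd p}" lebesgue T] C(6,7) len by (simp add: fmeasurableD)
      moreover have "(\<Union>p\<in>C. {fst p..snd p}) \<union> T \<in> lmeasurable"
        using C by (intro fmeasurable.Un fmeasurable.finite_UN) auto
      ultimately show "\<exists>T. ?E \<inter> V \<subseteq> T \<and> T \<in> lmeasurable \<and> measure lebesgue T < e"
        using C(5) by blast
    qed
  qed
  then show ?thesis using locally_negligible_alt[of ?E] by blast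
qed

text \<open>Cover the set by disjoint intervals of slope below \<open>p\<close>, of total length
  hardly above its outer measure \<open>L\<close>, and cover it again inside these by intervals of
  slope above \<open>q\<close>. The gaps are short, so by absolute continuity both families have
  almost the same increment, at most about \<open>p * L\<close> and at least about
  \<open>q * L\<close>, which is impossible for \<open>L > 0\<close>.\<close>

lemma negligible_steep_oscillation:
  assumes "absolutely_continuous_on {a..b} f" "p < q"
  shows "negligible {x \<in> {a<..<b}. steep_at f q x \<and> steep_at (\<lambda>x. - f x) (- p) x}"
proof (rule ccontr)
  let ?E = "{x \<in> {a<..<b}. steep_at f q x \<and> steep_at (\<lambda>x. - f x) (- p) x}"
  assume nn: "\<not> negligible ?E"
  \<comment> \<open>\<open>L\<close> below is an outer measure, as the set is not known to be
    measurable.\<close>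
  define OM where "OM = measure lebesgue ` {T. T \<in> lmeasurable \<and> ?E \<subseteq> T}"
  define L where "L = Inf OM"
  have bdd: "bdd_below OM" by (auto simp: OM_def intro!: bdd_belowI[of _ 0])
  have ab: "{a<..<b} \<in> lmeasurable" by (intro bounded_set_imp_lmeasurable) auto
  have "measure lebesgue {a<..<b} \<in> OM" unfolding OM_def by (rule imageI) (use ab in auto)
  then have ne: "OM \<noteq> {}" by blast
  have Lle: "L \<le> measure lebesgue T" if "T \<in> lmeasurable" "?E \<subseteq> T" for T
    unfolding L_def OM_def using that by (intro cInf_lower bdd[unfolded OM_def] imageI) auto
  have Lex: "\<exists>T. T \<in> lmeasurable \<and> ?E \<subseteq> T \<and> measure lebesgue T < L + e" if "e > 0" for e
  proof -
    have "Inf OM < L + e" using that by (simp add: L_def)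
    then obtain z where "z \<in> OM" "z < L + e" using cInf_lessD[OF ne] by blast
    then show ?thesis unfolding OM_def by blast
  qed
  have L: "L > 0"
  proof (rule ccontr)
    assume "\<not> L > 0"
    have "\<exists>T. ?E \<subseteq> T \<and> T \<in> lmeasurable \<and> measure lebesgue T < e" if e: "e > 0" for e
    proof -
      obtain T where "T \<in> lmeasurable" "?E \<subseteq> T" "measure lebesgue T < L + e" using Lex[OF e] by blast
      then show ?thesis using \<open>\<not> L > 0\<close> by (intro exI[of _ T]) auto
    qed
    then have "negligible ?E" unfolding negligible_outer by blast
    then show False using nn by blast
  qed
  define \<eta> where "\<eta> = (q - p) * L / 4"
  have \<eta>: "\<eta> > 0" using L assms(2) by (simp add: \<eta>_def)
  obtain \<delta> where \<delta>: "0 < \<delta>" and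
    AC: "\<forall>P. finite P \<longrightarrow> (\<forall>(s, t)\<in>P. s < t \<and> {s..t} \<subseteq> {a..b}) \<longrightarrow>
      pairwise (\<lambda>p q. {fst p<..<snd p} \<inter> {fst q<..<snd q} = {}) P \<longrightarrow> (\<Sum>(s, t)\<in>P. t - s) < \<delta> \<longrightarrow>
      \<bar>\<Sum>(s, t)\<in>P. f t - f s\<bar> < \<eta>"
    using absolutely_continuous_onD[OF assms(1) \<eta>] by blast
  \<comment> \<open>\<open>D * e\<close> gathers the errors of the final estimate:
    \<open>2 * (q - p)\<close> stems from the loss \<open>2 * e\<close> in the length of the second
    family, \<open>3 * \<bar>p\<bar>\<close> from gaps of length below \<open>3 * e\<close>.\<close>
  define D where "D = 2 * (q - p) + 3 * \<bar>p\<bar>"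
  have D: "D > 0" using assms(2) by (simp add: D_def)
  define e where "e = min (\<delta> / 4) (\<eta> / D)"
  have e: "e > 0" "3 * e < \<delta>" using \<delta> \<eta> D by (auto simp: e_def)
  have eD: "D * e \<le> \<eta>" using D by (simp add: e_def min_def field_simps)
  obtain T0 where T0: "T0 \<in> lmeasurable" "?E \<subseteq> T0" "measure lebesgue T0 < L + e / 2"
    using Lex[of "e / 2"] e by auto
  obtain U0 where U0: "open U0" "T0 \<subseteq> U0" "U0 - T0 \<in> lmeasurable" "measure lebesgue (U0 - T0) < e / 2"
  proof (rule sets_lebesgue_outer_open[OF fmeasurableD[OF T0(1)], of "e / 2"])
    fix U assume "open U" "T0 \<subseteq> U" "U - T0 \<in> lmeasurable" "emeasure lebesgue (U - T0) < ennreal (e / 2)"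
    then show thesis using that[of U] e
      by (simp add: emeasure_eq_measure2 ennreal_less_iff del: emeasure_completion)
  qed (use e in auto)
  define U where "U = U0 \<inter> {a<..<b}"
  have U: "open U" "U \<in> lmeasurable" "?E \<subseteq> U"
    using U0 T0 by (auto simp: U_def intro!: bounded_set_imp_lmeasurable bounded_Int)
  have U0m: "U0 \<in> lmeasurable" "measure lebesgue U0 < L + e"
  proof -
    have *: "U0 = T0 \<union> (U0 - T0)" using U0(2) by blast
    show "U0 \<in> lmeasurable" by (subst *, intro fmeasurable.Un T0 U0)
    show "measure lebesgue U0 < L + e"
      by (subst *) (use measure_Un_le[of T0 lebesgue "U0 - T0"] T0 U0 in \<open>simp add: fmeasurableD\<close>)
  qed
  have Um: "measure lebesgue U < L + e"
    using measure_mono_fmeasurable[of U U0 lebesgue] U0m U by (auto simp: U_def fmeasurableD)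
  obtain C T where C: "finite C" "C \<subseteq> {(s, t). f t - f s < p * (t - s)}"
      "\<And>s t. (s, t) \<in> C \<Longrightarrow> s < t \<and> {s..t} \<subseteq> U"
      "pairwise (\<lambda>p q. disjnt {fst p..snd p} {fst q..snd q}) C"
      "?E \<subseteq> (\<Union>p\<in>C. {fst p..snd p}) \<union> T" "T \<in> lmeasurable" "measure lebesgue T < e"
  proof (rule Vitali_finite_intervals[of ?E "{(s, t). f t - f s < p * (t - s)}" U e])
    show "\<exists>s t. (s, t) \<in> {(s, t). f t - f s < p * (t - s)} \<and> s \<le> x \<and> x \<le> t \<and> s < t \<and> t - s < d"
      if x: "x \<in> ?E" "0 < d" for x d
    proof -
      obtain s t where "s \<le> x" "x \<le> t" "s < t" "t - s < d" "- p * (t - s) < - f t - - f s"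
        using x unfolding steep_at_def by blast
      then show ?thesis by (intro exI[of _ s] exI[of _ t]) auto
    qed
  qed (use U e in auto)
  \<comment> \<open>Open intervals leave room to place each interval of the second family inside a
    single member of \<open>C\<close>; the end points lost form the null set
    \<open>F\<close>.\<close>
  define W where "W = (\<Union>p\<in>C. {fst p<..<snd p})"
  have W: "open W" "W \<in> lmeasurable" using C(1) by (auto simp: W_def intro!: fmeasurable.finite_UN
      bounded_set_imp_lmeasurable)
  obtain C' T' where C': "finite C'" "C' \<subseteq> {(s, t). q * (t - s) < f t - f s \<and> (\<exists>p\<in>C. {s..t} \<subseteq> {fst p..snd p})}"
      "\<And>s t. (s, t) \<in> C' \<Longrightarrow> s < t \<and> {s..t} \<subseteq> W"
      "pairwise (\<lambda>p q. disjnt {fst p..snd p} {fst q..snd q}) C'"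
      "?E \<inter> W \<subseteq> (\<Union>p\<in>C'. {fst p..snd p}) \<union> T'" "T' \<in> lmeasurable" "measure lebesgue T' < e"
  proof (rule Vitali_finite_intervals[of "?E \<inter> W"
       "{(s, t). q * (t - s) < f t - f s \<and> (\<exists>p\<in>C. {s..t} \<subseteq> {fst p..snd p})}" W e])
    show "\<exists>s t. (s, t) \<in> {(s, t). q * (t - s) < f t - f s \<and> (\<exists>p\<in>C. {s..t} \<subseteq> {fst p..snd p})} \<and>
        s \<le> x \<and> x \<le> t \<and> s < t \<and> t - s < d"
      if x: "x \<in> ?E \<inter> W" "0 < d" for x d
    proof -
      obtain p where p: "p \<in> C" "fst p < x" "x < snd p" using x by (auto simp: W_def)
      have "min d (min (x - fst p) (snd p - x)) > 0" using x p by simp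
      then obtain s t where "s \<le> x" "x \<le> t" "s < t" "t - s < min d (min (x - fst p) (snd p - x))"
          "q * (t - s) < f t - f s"
        using x unfolding steep_at_def by blast
      then show ?thesis using p by (intro exI[of _ s] exI[of _ t]) (auto intro!: bexI[of _ p])
    qed
  qed (use W e in auto)
  have len: "(\<Sum>(s, t)\<in>C. t - s) = measure lebesgue (\<Union>p\<in>C. {fst p..snd p})"
    by (rule measure_finite_disjoint_intervals[symmetric]) (use C in \<open>auto simp: less_imp_le\<close>)
  have len': "(\<Sum>(s, t)\<in>C'. t - s) = measure lebesgue (\<Union>p\<in>C'. {fst p..snd p})"
    by (rule measure_finite_disjoint_intervals[symmetric]) (use C' in \<open>auto simp: less_imp_le\<close>)
  have "(\<Union>p\<in>C. {fst p..snd p}) \<subseteq> U" using C(3) by fastforce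
  then have lenC: "(\<Sum>(s, t)\<in>C. t - s) < L + e"
    unfolding len using measure_mono_fmeasurable[of "\<Union>p\<in>C. {fst p..snd p}" U lebesgue] U Um C(1)
    by (auto simp: sets.finite_UN)
  define F where "F = (\<Union>p\<in>C. {fst p, snd p})"
  have F: "negligible F" using C(1) by (auto simp: F_def intro!: negligible_finite)
  have "?E \<subseteq> (\<Union>p\<in>C'. {fst p..snd p}) \<union> T' \<union> (T \<union> F)"
  proof
    fix x assume x: "x \<in> ?E"
    then consider "x \<in> T" | "x \<in> F" | "x \<in> W"
      using C(5) unfolding W_def F_def by fastforce
    then show "x \<in> (\<Union>p\<in>C'. {fst p..snd p}) \<union> T' \<union> (T \<union> F)"
      using x C'(5) by cases blast+
  qed
  then have "L \<le> measure lebesgue ((\<Union>p\<in>C'. {fst p..snd p}) \<union> T' \<union> (T \<union> F))"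
    using C(6) C'(1,6) F
    by (intro Lle fmeasurable.Un fmeasurable.finite_UN) (auto simp: negligible_imp_measurable)
  also have "\<dots> \<le> measure lebesgue (\<Union>p\<in>C'. {fst p..snd p}) + measure lebesgue T' + (measure lebesgue T + measure lebesgue F)"
  proof -
    have "(\<Union>p\<in>C'. {fst p..snd p}) \<in> sets lebesgue" using C'(1) by (intro sets.finite_UN) auto
    moreover have "F \<in> sets lebesgue" using F by (simp add: negligible_imp_sets)
    ultimately show ?thesis using C(6) C'(6)
      by (intro order_trans[OF measure_Un_le] add_mono measure_Un_le sets.Un) (simp_all add: fmeasurableD)
  qed
  also have "measure lebesgue F = 0" using F by (simp add: negligible_imp_measure0)
  finally have lenC': "L - 2 * e < (\<Sum>(s, t)\<in>C'. t - s)" using C(7) C'(7) len' by simp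
  obtain P where P: "finite P" "\<And>s t. (s, t) \<in> P \<Longrightarrow> s < t \<and> (\<exists>p\<in>C. {s..t} \<subseteq> {fst p..snd p})"
     "pairwise (\<lambda>p q. {fst p<..<snd p} \<inter> {fst q<..<snd q} = {}) P"
     "(\<Sum>(s, t)\<in>P. t - s) = (\<Sum>(s, t)\<in>C. t - s) - (\<Sum>(s, t)\<in>C'. t - s)"
     "(\<Sum>(s, t)\<in>P. f t - f s) = (\<Sum>(s, t)\<in>C. f t - f s) - (\<Sum>(s, t)\<in>C'. f t - f s)"
    by (rule interval_family_gaps[of C C' f]) (use C(1,3,4) C'(1-4) in auto)
  have "\<bar>\<Sum>(s, t)\<in>P. f t - f s\<bar> < \<eta>"
  proof (rule AC[rule_format])
    have "s < t \<and> {s..t} \<subseteq> {a..b}" if st: "(s, t) \<in> P" for s t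
    proof -
      obtain p where "p \<in> C" "{s..t} \<subseteq> {fst p..snd p}" "s < t" using P(2)[OF st] by blast
      moreover have "{fst p..snd p} \<subseteq> U" using C(3)[of "fst p" "snd p"] \<open>p \<in> C\<close> by simp
      moreover have "U \<subseteq> {a..b}" by (auto simp: U_def)
      ultimately show ?thesis by blast
    qed
    then show "case p of (s, t) \<Rightarrow> s < t \<and> {s..t} \<subseteq> {a..b}" if "p \<in> P" for p
      using that by (cases p) simp
    show "(\<Sum>(s, t)\<in>P. t - s) < \<delta>" using P(4) lenC lenC' e by simp
  qed (use P in auto)
  moreover have "(\<Sum>(s, t)\<in>C. f t - f s) \<le> p * (\<Sum>(s, t)\<in>C. t - s)"
    unfolding sum_distrib_left using C(2) by (intro sum_mono) force
  moreover have "q * (\<Sum>(s, t)\<in>C'. t - s) \<le> (\<Sum>(s, t)\<in>C'. f t - f s)"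
    unfolding sum_distrib_left using C'(2) by (intro sum_mono) force
  ultimately have 1: "q * (\<Sum>(s, t)\<in>C'. t - s) < p * (\<Sum>(s, t)\<in>C. t - s) + \<eta>"
    using P(5) by simp
  have "0 \<le> (\<Sum>(s, t)\<in>P. t - s)" using P(2) by (intro sum_nonneg) (auto simp: less_imp_le)
  then have "p * ((\<Sum>(s, t)\<in>C. t - s) - (\<Sum>(s, t)\<in>C'. t - s)) \<le> \<bar>p\<bar> * (3 * e)"
    using P(4) lenC lenC' by (intro mult_mono) auto
  then have "(q - p) * (\<Sum>(s, t)\<in>C'. t - s) < 3 * \<bar>p\<bar> * e + \<eta>"
    using 1 by (simp add: algebra_simps)
  moreover have "(q - p) * (L - 2 * e) \<le> (q - p) * (\<Sum>(s, t)\<in>C'. t - s)"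
    using lenC' assms(2) by (intro mult_left_mono) auto
  ultimately have "(q - p) * L < D * e + \<eta>" by (simp add: D_def algebra_simps)
  then show False using eD \<eta> by (simp add: \<eta>_def)
qed

text \<open>The derivative is the infimum of the slopes that are not steep. A non-steep slope close
  to it bounds the quotients near \<open>x\<close> from above; a rational \<open>q'\<close> below it
  is steep, so \<open>osc\<close> makes a rational \<open>p < q'\<close> a lower bound. Working with
  rationals keeps the number of exceptional sets countable.\<close>

lemma differentiable_if_not_steep:
  fixes f :: "real \<Rightarrow> real"
  assumes up: "\<not> steep_at f q0 x" and down: "\<not> steep_at (\<lambda>x. - f x) p0 x"
    and osc: "\<And>p q. \<lbrakk>p \<in> \<rat>; q \<in> \<rat>; p < q; steep_at f q x\<rbrakk> \<Longrightarrow> \<not> steep_at (\<lambda>x. - f x) (- p) x"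
  shows "f field_differentiable (at x)"
proof -
  define S where "S = {q. \<not> steep_at f q x}"
  have upper: "\<exists>d>0. \<forall>s t. s \<le> x \<longrightarrow> x \<le> t \<longrightarrow> s < t \<longrightarrow> t - s < d \<longrightarrow> f t - f s \<le> q * (t - s)"
    if "\<not> steep_at f q x" for q
    using that unfolding steep_at_def by (meson not_less)
  have lower: "\<exists>d>0. \<forall>s t. s \<le> x \<longrightarrow> x \<le> t \<longrightarrow> s < t \<longrightarrow> t - s < d \<longrightarrow> p * (t - s) \<le> f t - f s"
    if nst: "\<not> steep_at (\<lambda>x. - f x) (- p) x" for p
  proof -
    obtain d where d: "d > 0" "\<forall>s t. s \<le> x \<longrightarrow> x \<le> t \<longrightarrow> s < t \<longrightarrow> t - s < d \<longrightarrow> \<not> - p * (t - s) < - f t - - f s"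
      using nst unfolding steep_at_def by meson
    have "p * (t - s) \<le> f t - f s" if "s \<le> x" "x \<le> t" "s < t" "t - s < d" for s t
      using d(2)[rule_format, OF that] by (simp add: not_less)
    then show ?thesis using d(1) by blast
  qed
  have bdd: "bdd_below S"
  proof (rule bdd_belowI)
    fix q assume "q \<in> S"
    then obtain d where d: "d > 0" "\<forall>s t. s \<le> x \<longrightarrow> x \<le> t \<longrightarrow> s < t \<longrightarrow> t - s < d \<longrightarrow> f t - f s \<le> q * (t - s)"
      using upper[of q] unfolding S_def by blast
    obtain d' where d': "d' > 0" "\<forall>s t. s \<le> x \<longrightarrow> x \<le> t \<longrightarrow> s < t \<longrightarrow> t - s < d' \<longrightarrow> - p0 * (t - s) \<le> f t - f s"
      using lower[of "- p0"] down by auto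
    define h where "h = min d d' / 2"
    have h: "h > 0" "h < d" "h < d'" using d(1) d'(1) by (auto simp: h_def)
    have "- p0 * h \<le> q * h"
      using d(2)[rule_format, of x "x + h"] d'(2)[rule_format, of x "x + h"] h by simp
    then show "- p0 \<le> q" using h by (metis mult_le_cancel_right_pos)
  qed
  have ne: "S \<noteq> {}" using up by (auto simp: S_def)
  define D where "D = Inf S"
  have "((\<lambda>y. (f y - f x) / (y - x)) \<longlongrightarrow> D) (at x)"
    unfolding LIM_eq
  proof (intro allI impI)
    fix e :: real assume e: "e > 0"
    have "Inf S < D + e" using e by (simp add: D_def)
    then obtain q where q: "\<not> steep_at f q x" "q < D + e"
      using cInf_lessD[OF ne] unfolding S_def by blast
    obtain p where p: "p \<in> \<rat>" "D - e < p" "p < D"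
      using Rats_dense_in_real[of "D - e" D] e by auto
    then obtain q' where pq: "p \<in> \<rat>" "q' \<in> \<rat>" "D - e < p" "p < q'" "q' < D"
      using Rats_dense_in_real[of p D] by auto
    have "steep_at f q' x"
      using cInf_lower[OF _ bdd, of q'] pq(5) unfolding S_def D_def by force
    then have "\<not> steep_at (\<lambda>x. - f x) (- p) x" using osc pq by blast
    then obtain d where d: "d > 0" "\<forall>s t. s \<le> x \<longrightarrow> x \<le> t \<longrightarrow> s < t \<longrightarrow> t - s < d \<longrightarrow> p * (t - s) \<le> f t - f s"
      using lower by blast
    obtain d' where d': "d' > 0" "\<forall>s t. s \<le> x \<longrightarrow> x \<le> t \<longrightarrow> s < t \<longrightarrow> t - s < d' \<longrightarrow> f t - f s \<le> q * (t - s)"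
      using upper[OF q(1)] by blast
    show "\<exists>s>0. \<forall>y. y \<noteq> x \<and> norm (y - x) < s \<longrightarrow> norm ((f y - f x) / (y - x) - D) < e"
    proof (intro exI[of _ "min d d'"] conjI allI impI)
      fix y assume y: "y \<noteq> x \<and> norm (y - x) < min d d'"
      have "p \<le> (f y - f x) / (y - x) \<and> (f y - f x) / (y - x) \<le> q"
      proof (cases "x < y")
        case True
        then show ?thesis using y d(2)[rule_format, of x y] d'(2)[rule_format, of x y]
          by (simp add: pos_le_divide_eq pos_divide_le_eq)
      next
        case False
        then have "y < x" using y by simp
        moreover have "(f y - f x) / (y - x) = (f x - f y) / (x - y)"
          using minus_divide_divide[of "f x - f y" "x - y"] by simp
        ultimately show ?thesis using y d(2)[rule_format, of y x] d'(2)[rule_format, of y x]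
          by (simp add: pos_le_divide_eq pos_divide_le_eq)
      qed
      then show "norm ((f y - f x) / (y - x) - D) < e" using q pq by (auto simp: abs_less_iff)
    qed (use d d' in auto)
  qed
  then show ?thesis by (auto simp: field_differentiable_def has_field_derivative_iff)
qed

theorem AE_differentiable_if_locally_absolutely_continuous:
  assumes "locally_absolutely_continuous f"
  shows "AE x in lebesgue. f field_differentiable (at x)"
proof -
  have ac: "absolutely_continuous_on {a..b} f" for a b
    using assms by (simp add: locally_absolutely_continuous_def)
  define A where "A = (\<lambda>(p, q, n :: nat). {x \<in> {- real n<..<real n}. steep_at f q x \<and> steep_at (\<lambda>x. - f x) (- p) x})"
  define B where "B n = {x \<in> {- real n<..<real n}. \<forall>q. steep_at f q x}" for n
  define B' where "B' n = {x \<in> {- real n<..<real n}. \<forall>q. steep_at (\<lambda>x. - f x) q x}" for n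
  define I where "I = {(p, q, n :: nat). p \<in> \<rat> \<and> q \<in> \<rat> \<and> p < (q :: real)}"
  have "I \<subseteq> \<rat> \<times> \<rat> \<times> UNIV" by (auto simp: I_def)
  then have "countable I"
    by (rule countable_subset) (auto intro!: countable_SIGMA simp: countable_rat)
  moreover have "negligible (A i)" if "i \<in> I" for i
    using that negligible_steep_oscillation[OF ac]
    by (cases i) (simp add: A_def I_def del: greaterThanLessThan_iff)
  ultimately have "negligible (\<Union>i\<in>I. A i)"
    by (intro negligible_countable_Union) auto
  moreover have "negligible (\<Union>n. B n)"
    unfolding B_def by (intro negligible_countable_Union) (auto simp del: greaterThanLessThan_iff intro: negligible_steep_unbounded ac)
  moreover have "negligible (\<Union>n. B' n)"
    unfolding B'_def by (intro negligible_countable_Union)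
      (auto simp del: greaterThanLessThan_iff intro: negligible_steep_unbounded absolutely_continuous_on_minus ac)
  ultimately have "negligible ((\<Union>i\<in>I. A i) \<union> ((\<Union>n. B n) \<union> (\<Union>n. B' n)))"
    by (intro negligible_Un)
  moreover have "{x. \<not> f field_differentiable (at x)} \<subseteq> (\<Union>i\<in>I. A i) \<union> ((\<Union>n. B n) \<union> (\<Union>n. B' n))"
  proof
    fix x assume x: "x \<in> {x. \<not> f field_differentiable (at x)}"
    obtain n :: nat where n: "\<bar>x\<bar> < real n" using reals_Archimedean2 by blast
    show "x \<in> (\<Union>i\<in>I. A i) \<union> ((\<Union>n. B n) \<union> (\<Union>n. B' n))"
    proof (rule ccontr)
      assume nx: "x \<notin> (\<Union>i\<in>I. A i) \<union> ((\<Union>n. B n) \<union> (\<Union>n. B' n))"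
      then have "x \<notin> B n" "x \<notin> B' n" by blast+
      then obtain q0 p0 where "\<not> steep_at f q0 x" "\<not> steep_at (\<lambda>x. - f x) p0 x"
        using n by (auto simp: B_def B'_def abs_less_iff)
      moreover have "\<not> steep_at (\<lambda>x. - f x) (- p) x" if "p \<in> \<rat>" "q \<in> \<rat>" "p < q" "steep_at f q x" for p q
      proof -
        have "(p, q, n) \<in> I" using that by (simp add: I_def)
        then have "x \<notin> A (p, q, n)" using nx by blast
        then show ?thesis using that n by (auto simp: A_def abs_less_iff)
      qed
      ultimately have "f field_differentiable (at x)" by (rule differentiable_if_not_steep)
      then show False using x by simp
    qed
  qed
  ultimately show ?thesis unfolding eventually_ae_filter_negligible by blast
qed

text \<open>The good points are covered, up to little, by disjoint intervals of slope at most
  \<open>c + e\<close>; what remains of \<open>[a, b]\<close> is so short that absolute continuity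
  makes its increment less than \<open>e\<close>.\<close>

lemma increment_le_if_AE_deriv_le:
  fixes f :: "real \<Rightarrow> real"
  assumes ac: "absolutely_continuous_on {a..b} f" and ab: "a < b" and c: "0 \<le> c" and N: "negligible N"
    and deriv: "\<And>x. x \<in> {a<..<b} - N \<Longrightarrow> \<exists>D\<le>c. (f has_real_derivative D) (at x)"
  shows "f b - f a \<le> c * (b - a)"
proof -
  have *: "f b - f a \<le> (c + e) * (b - a) + e" if e: "e > 0" for e
  proof -
    obtain \<delta> where \<delta>: "0 < \<delta>" and
      AC: "\<forall>P. finite P \<longrightarrow> (\<forall>(s, t)\<in>P. s < t \<and> {s..t} \<subseteq> {a..b}) \<longrightarrow>
      pairwise (\<lambda>p q. {fst p<..<snd p} \<inter> {fst q<..<snd q} = {}) P \<longrightarrow> (\<Sum>(s, t)\<in>P. t - s) < \<delta> \<longrightarrow>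
      \<bar>\<Sum>(s, t)\<in>P. f t - f s\<bar> < e"
      using absolutely_continuous_onD[OF ac e] by blast
    define K where "K = {(s, t). f t - f s \<le> (c + e) * (t - s)}"
    obtain C T where C: "finite C" "C \<subseteq> K"
        "\<And>s t. (s, t) \<in> C \<Longrightarrow> s < t \<and> {s..t} \<subseteq> {a<..<b}"
        "pairwise (\<lambda>p q. disjnt {fst p..snd p} {fst q..snd q}) C"
        "{a<..<b} - N \<subseteq> (\<Union>p\<in>C. {fst p..snd p}) \<union> T" "T \<in> lmeasurable" "measure lebesgue T < \<delta>"
    proof (rule Vitali_finite_intervals[of "{a<..<b} - N" K "{a<..<b}" \<delta>])
      show "\<exists>s t. (s, t) \<in> K \<and> s \<le> x \<and> x \<le> t \<and> s < t \<and> t - s < d" if x: "x \<in> {a<..<b} - N" "0 < d" for x d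
      proof -
        obtain D where D: "D \<le> c" "(f has_real_derivative D) (at x)" using deriv x by blast
        then have "((\<lambda>y. (f y - f x) / (y - x)) \<longlongrightarrow> D) (at x)" by (simp add: has_field_derivative_iff)
        then obtain s where s: "s > 0" "\<forall>y. y \<noteq> x \<and> norm (y - x) < s \<longrightarrow> norm ((f y - f x) / (y - x) - D) < e"
          using e unfolding LIM_eq by blast
        define h where "h = min s d / 2"
        have h: "h > 0" "h < s" "h < d" using s x by (auto simp: h_def)
        have "(f (x + h) - f x) / h \<le> c + e"
          using s(2)[rule_format, of "x + h"] h D(1) by (simp add: abs_less_iff)
        then have "(x, x + h) \<in> K" using h by (simp add: K_def pos_divide_le_eq)
        then show ?thesis using h by (intro exI[of _ x] exI[of _ "x + h"]) auto
      qed
    qed (use \<delta> in \<open>auto intro!: bounded_set_imp_lmeasurable\<close>)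
    have sub: "s < t \<and> {s..t} \<subseteq> {a..b}" if "(s, t) \<in> C" for s t
      using C(3)[OF that] greaterThanLessThan_subseteq_atLeastAtMost_iff[of a b a b] by blast
    have "\<exists>P. finite P \<and> (\<forall>(s, t)\<in>P. s < t \<and> {s..t} \<subseteq> {a..b}) \<and>
     pairwise (\<lambda>p q. {fst p<..<snd p} \<inter> {fst q<..<snd q} = {}) P \<and>
     (\<Sum>(s, t)\<in>P. t - s) = (b - a) - (\<Sum>(s, t)\<in>C. t - s) \<and>
     (\<Sum>(s, t)\<in>P. f t - f s) = (f b - f a) - (\<Sum>(s, t)\<in>C. f t - f s)"
      by (rule interval_gaps) (use C(1,4) ab sub in auto)
    then obtain P where P: "finite P" "\<forall>(s, t)\<in>P. s < t \<and> {s..t} \<subseteq> {a..b}"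
     "pairwise (\<lambda>p q. {fst p<..<snd p} \<inter> {fst q<..<snd q} = {}) P"
     "(\<Sum>(s, t)\<in>P. t - s) = (b - a) - (\<Sum>(s, t)\<in>C. t - s)"
     "(\<Sum>(s, t)\<in>P. f t - f s) = (f b - f a) - (\<Sum>(s, t)\<in>C. f t - f s)"
      by blast
    have len: "(\<Sum>(s, t)\<in>C. t - s) = measure lebesgue (\<Union>p\<in>C. {fst p..snd p})"
      by (rule measure_finite_disjoint_intervals[symmetric]) (use C in \<open>auto simp: less_imp_le\<close>)
    have UC: "(\<Union>p\<in>C. {fst p..snd p}) \<in> lmeasurable"
      using C(1) by (intro fmeasurable.finite_UN) auto
    have "b - a = measure lebesgue {a<..<b}" using ab by simp
    also have "\<dots> \<le> measure lebesgue ((\<Union>p\<in>C. {fst p..snd p}) \<union> (T \<union> N))"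
      by (rule measure_mono_fmeasurable)
        (use C(5,6) UC N in \<open>auto intro!: fmeasurable.Un simp: negligible_imp_measurable\<close>)
    also have "\<dots> \<le> measure lebesgue (\<Union>p\<in>C. {fst p..snd p}) + (measure lebesgue T + measure lebesgue N)"
      using UC C(6) N
      by (intro order_trans[OF measure_Un_le] add_mono measure_Un_le sets.Un order_refl)
         (simp_all add: fmeasurableD negligible_imp_sets)
    also have "measure lebesgue N = 0" using N by (simp add: negligible_imp_measure0)
    finally have "(\<Sum>(s, t)\<in>P. t - s) < \<delta>" using P(4) len C(7) by simp
    then have "\<bar>\<Sum>(s, t)\<in>P. f t - f s\<bar> < e" using AC P(1,2,3) by blast
    moreover have "(\<Sum>(s, t)\<in>C. f t - f s) \<le> (c + e) * (\<Sum>(s, t)\<in>C. t - s)"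
      unfolding sum_distrib_left using C(2) by (intro sum_mono) (auto simp: K_def)
    moreover have "0 \<le> (\<Sum>(s, t)\<in>P. t - s)" using P(2) by (intro sum_nonneg) (auto simp: less_imp_le)
    then have "(c + e) * (\<Sum>(s, t)\<in>C. t - s) \<le> (c + e) * (b - a)"
      using P(4) c e by (intro mult_left_mono) auto
    ultimately show ?thesis using P(5) by linarith
  qed
  show ?thesis
  proof (rule field_le_epsilon)
    fix e :: real assume "e > 0"
    \<comment> \<open>The estimate has the error \<open>e * (b - a) + e\<close>.\<close>
    define e' where "e' = e / (b - a + 1)"
    have "e' > 0" "e' * (b - a + 1) = e" using \<open>e > 0\<close> ab by (auto simp: e'_def)
    then have "f b - f a \<le> c * (b - a) + e' * (b - a + 1)"
      using *[of e'] by (simp add: algebra_simps)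
    also have "e' * (b - a + 1) = e" by fact
    finally show "f b - f a \<le> c * (b - a) + e" .
  qed
qed

lemma Lipschitz_if_AE_deriv_le:
  fixes f :: "real \<Rightarrow> real"
  assumes ac: "locally_absolutely_continuous f" and c: "0 \<le> c"
    and AE: "AE x in lebesgue. \<bar>deriv f x\<bar> \<le> c"
  shows "\<bar>f t - f s\<bar> \<le> c * \<bar>t - s\<bar>"
proof -
  have "AE x in lebesgue. \<bar>deriv f x\<bar> \<le> c \<and> f field_differentiable (at x)"
    using AE_differentiable_if_locally_absolutely_continuous[OF ac] AE by auto
  then obtain N where N: "negligible N" "{x. \<not> (\<bar>deriv f x\<bar> \<le> c \<and> f field_differentiable (at x))} \<subseteq> N"
    unfolding eventually_ae_filter_negligible by blast
  have D: "(f has_real_derivative deriv f x) (at x) \<and> \<bar>deriv f x\<bar> \<le> c" if "x \<notin> N" for x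
    using N(2) that field_differentiable_derivI by blast
  have abc: "absolutely_continuous_on {a..b} f" for a b
    using ac by (simp add: locally_absolutely_continuous_def)
  have *: "\<bar>f b - f a\<bar> \<le> c * (b - a)" if "a < b" for a b
  proof -
    have "f b - f a \<le> c * (b - a)"
    proof (rule increment_le_if_AE_deriv_le[OF abc that c N(1)])
      show "\<exists>D\<le>c. (f has_real_derivative D) (at x)" if "x \<in> {a<..<b} - N" for x
        using D[of x] that by (auto intro!: exI[of _ "deriv f x"])
    qed
    moreover have "- f b - - f a \<le> c * (b - a)"
    proof (rule increment_le_if_AE_deriv_le[OF absolutely_continuous_on_minus[OF abc] that c N(1)])
      show "\<exists>D\<le>c. ((\<lambda>x. - f x) has_real_derivative D) (at x)" if "x \<in> {a<..<b} - N" for x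
        using D[of x] that by (auto intro!: exI[of _ "- deriv f x"] DERIV_minus)
    qed
    ultimately show ?thesis by linarith
  qed
  show ?thesis
    using *[of s t] *[of t s] by (cases s t rule: linorder_cases) (auto simp: abs_minus_commute)
qed

section \<open>The function classes\<close>

text \<open>Where a continuous function exceeds \<open>M\<close> in modulus, it does so on a
  nonempty open set, which is not null.\<close>

lemma Linf_norm_le_iff:
  assumes g: "continuous_on UNIV g" and M: "0 \<le> M"
  shows "Linf_norm g \<le> ennreal M \<longleftrightarrow> (\<forall>t. \<bar>g t\<bar> \<le> M)"
proof
  have meas: "(\<lambda>x. ennreal \<bar>g x\<bar>) \<in> borel_measurable lebesgue"
    using borel_measurable_continuous_onI[OF g] by (intro measurable_completion) simp
  show "Linf_norm g \<le> ennreal M" if "\<forall>t. \<bar>g t\<bar> \<le> M"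
    unfolding Linf_norm_def using meas that by (intro esssup_I) (auto intro: ennreal_leI)
  show "\<forall>t. \<bar>g t\<bar> \<le> M" if le: "Linf_norm g \<le> ennreal M"
  proof (rule ccontr)
    assume "\<not> (\<forall>t. \<bar>g t\<bar> \<le> M)"
    then have ne: "{t. M < \<bar>g t\<bar>} \<noteq> {}" by (auto simp: not_le)
    have op: "open {t. M < \<bar>g t\<bar>}"
      using g by (intro open_Collect_less continuous_intros)
    have "AE x in lebesgue. ennreal \<bar>g x\<bar> \<le> ennreal M"
      using esssup_AE[of "\<lambda>x. ennreal \<bar>g x\<bar>" lebesgue] le unfolding Linf_norm_def
      by (auto elim: eventually_mono order_trans)
    then obtain N where "negligible N" "{x. \<not> ennreal \<bar>g x\<bar> \<le> ennreal M} \<subseteq> N"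
      unfolding eventually_ae_filter_negligible by blast
    then have "negligible {t. M < \<bar>g t\<bar>}"
      using M by (auto simp: ennreal_le_iff not_le intro: negligible_subset)
    then show False using open_not_negligible[OF op ne] by simp
  qed
qed

lemma Lipschitz_imp_locally_absolutely_continuous:
  assumes "\<And>s t. \<bar>f t - f s\<bar> \<le> c * \<bar>t - s\<bar>" and c: "0 < c"
  shows "locally_absolutely_continuous f"
  unfolding locally_absolutely_continuous_def absolutely_continuous_on_def
proof (intro allI impI)
  fix a b \<epsilon> :: real assume \<epsilon>: "\<epsilon> > 0"
  show "\<exists>\<delta>>0. \<forall>P. finite P \<longrightarrow> (\<forall>(s, t)\<in>P. s \<le> t \<and> {s..t} \<subseteq> {a..b}) \<longrightarrow>
     pairwise (\<lambda>p q. {fst p<..<snd p} \<inter> {fst q<..<snd q} = {}) P \<longrightarrow>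
     (\<Sum>(s, t)\<in>P. t - s) < \<delta> \<longrightarrow> (\<Sum>(s, t)\<in>P. \<bar>f t - f s\<bar>) < \<epsilon>"
  proof (intro exI[of _ "\<epsilon> / c"] conjI allI impI)
    fix P :: "(real \<times> real) set"
    assume P: "\<forall>(s, t)\<in>P. s \<le> t \<and> {s..t} \<subseteq> {a..b}" "(\<Sum>(s, t)\<in>P. t - s) < \<epsilon> / c"
    have "(\<Sum>(s, t)\<in>P. \<bar>f t - f s\<bar>) \<le> c * (\<Sum>(s, t)\<in>P. t - s)"
      unfolding sum_distrib_left
    proof (intro sum_mono)
      fix p assume p: "p \<in> P"
      obtain s t where st: "p = (s, t)" by (cases p)
      then have "s \<le> t" using P(1) p by auto
      then show "(case p of (s, t) \<Rightarrow> \<bar>f t - f s\<bar>) \<le> c * (case p of (s, t) \<Rightarrow> t - s)"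
        using assms(1)[of t s] st by simp
    qed
    also have "\<dots> < \<epsilon>" using P(2) c by (simp add: field_simps)
    finally show "(\<Sum>(s, t)\<in>P. \<bar>f t - f s\<bar>) < \<epsilon>" .
  qed (use \<epsilon> c in auto)
qed

lemma Lipschitz_imp_continuous:
  fixes f :: "real \<Rightarrow> real"
  assumes "\<And>s t. \<bar>f t - f s\<bar> \<le> c * \<bar>t - s\<bar>" and "0 \<le> c"
  shows "continuous_on UNIV f"
  by (rule lipschitz_on_continuous_on[where L = c])
    (use assms in \<open>auto intro!: lipschitz_onI simp: dist_real_def\<close>)

text \<open>\<open>deriv f\<close> is arbitrary where \<open>f\<close> is not differentiable, so it
  is compared with the limit of the difference quotients of step \<open>1 / (n + 1)\<close>: that
  limit is Borel and agrees with it almost everywhere, and Lebesgue measure is complete.\<close>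

lemma Lipschitz_imp_deriv_Linf:
  assumes lip: "\<And>s t. \<bar>f t - f s\<bar> \<le> \<bar>t - s\<bar>"
  shows "deriv f \<in> borel_measurable lebesgue" "Linf_norm (deriv f) \<le> 1"
proof -
  have lac: "locally_absolutely_continuous f"
    by (rule Lipschitz_imp_locally_absolutely_continuous[of f 1]) (use lip in auto)
  have cont: "continuous_on UNIV f"
    by (rule Lipschitz_imp_continuous[of f 1]) (use lip in auto)
  define g where "g n x = (f (x + inverse (Suc n)) - f x) / inverse (Suc n)" for n :: nat and x :: real
  have "g n \<in> borel_measurable borel" for n
    unfolding g_def
    by (intro borel_measurable_continuous_onI continuous_intros continuous_on_compose2[OF cont]) auto
  then have "(\<lambda>x. lim (\<lambda>n. g n x)) \<in> borel_measurable lborel" by simp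
  then have 1: "(\<lambda>x. lim (\<lambda>n. g n x)) \<in> borel_measurable lebesgue" by (rule measurable_completion)
  have lim: "AE x in lebesgue. (\<lambda>n. g n x) \<longlonglongrightarrow> deriv f x"
    using AE_differentiable_if_locally_absolutely_continuous[OF lac]
  proof (rule eventually_mono)
    fix x assume "f field_differentiable at x"
    then have D: "(\<lambda>h. (f (x + h) - f x) / h) \<midarrow>0\<rightarrow> deriv f x"
      using field_differentiable_derivI DERIV_def by blast
    have "filterlim (\<lambda>n. inverse (real (Suc n))) (at 0) sequentially"
      by (intro filterlim_atI LIMSEQ_inverse_real_of_nat) auto
    from filterlim_compose[OF D this] show "(\<lambda>n. g n x) \<longlonglongrightarrow> deriv f x"
      by (simp add: g_def)
  qed
  then have "AE x in lebesgue. lim (\<lambda>n. g n x) = deriv f x"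
    by (rule eventually_mono) (rule limI)
  with 1 show m: "deriv f \<in> borel_measurable lebesgue" by (rule borel_measurable_AE)
  have "AE x in lebesgue. ennreal \<bar>deriv f x\<bar> \<le> 1"
    using lim
  proof (rule eventually_mono)
    fix x assume "(\<lambda>n. g n x) \<longlonglongrightarrow> deriv f x"
    then have "(\<lambda>n. \<bar>g n x\<bar>) \<longlonglongrightarrow> \<bar>deriv f x\<bar>" by (rule tendsto_rabs)
    moreover have "\<bar>g n x\<bar> \<le> 1" for n
    proof -
      have "\<bar>f (x + inverse (Suc n)) - f x\<bar> \<le> inverse (real (Suc n))"
        using lip[of "x + inverse (Suc n)" x] by simp
      then have "\<bar>f (x + inverse (Suc n)) - f x\<bar> / inverse (real (Suc n)) \<le> 1"
        by (subst pos_divide_le_eq) auto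
      then show ?thesis by (simp add: g_def abs_divide)
    qed
    ultimately have "\<bar>deriv f x\<bar> \<le> 1" by (intro LIMSEQ_le_const2) auto
    then show "ennreal \<bar>deriv f x\<bar> \<le> 1" using ennreal_leI by fastforce
  qed
  moreover have "(\<lambda>x. ennreal \<bar>deriv f x\<bar>) \<in> borel_measurable lebesgue" using m by simp
  ultimately show "Linf_norm (deriv f) \<le> 1" unfolding Linf_norm_def by (intro esssup_I)
qed

text \<open>\<open>D k\<close> stands for the \<open>k\<close>-th derivative of a function of order
  r = p + 2. The Lipschitz condition replaces the bound on the r-th derivative, and an explicit
  family \<open>D\<close> can also come from integration instead of \<open>deriv\<close>.\<close>

definition smooth_tower :: "nat \<Rightarrow> (nat \<Rightarrow> real \<Rightarrow> real) \<Rightarrow> bool" where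
  "smooth_tower p D \<longleftrightarrow> (\<forall>k\<le>p. \<forall>t. (D k has_real_derivative D (Suc k) t) (at t)) \<and>
     (\<forall>t. D 0 (t + 2 * pi) = D 0 t) \<and> (\<forall>s t. \<bar>D (Suc p) t - D (Suc p) s\<bar> \<le> \<bar>t - s\<bar>)"

lemma smooth_tower_higher_deriv:
  assumes "smooth_tower p D" "k \<le> Suc p"
  shows "(deriv ^^ k) (D 0) = D k"
  using assms(2)
proof (induction k)
  case (Suc k)
  then have "deriv (D k) = D (Suc k)"
    using assms(1) by (intro ext DERIV_imp_deriv) (auto simp: smooth_tower_def)
  then show ?case using Suc by simp
qed simp

lemma smooth_tower_cong:
  assumes "\<And>k. k \<le> Suc p \<Longrightarrow> D k = D' k" "smooth_tower p D"
  shows "smooth_tower p D'"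
  using assms unfolding smooth_tower_def by (metis Suc_le_mono le_SucI order_refl zero_le)

lemma periodic_fun_simple_iff:
  "periodic_fun_simple f c \<longleftrightarrow> (\<forall>x. f (x + c) = f (x :: real))"
  by (simp add: periodic_fun_simple_def)

text \<open>The bound almost everywhere gives the Lipschitz condition by
  \<open>Lipschitz_if_AE_deriv_le\<close>; conversely a Lipschitz function is absolutely continuous
  with a measurable, bounded derivative.\<close>

lemma L_space_iff_smooth_tower:
  "x \<in> L_space (Suc (Suc p)) \<and> Linf_norm ((deriv ^^ Suc (Suc p)) x) \<le> 1 \<longleftrightarrow>
     smooth_tower p (\<lambda>k. (deriv ^^ k) x)"
proof
  assume x: "x \<in> L_space (Suc (Suc p)) \<and> Linf_norm ((deriv ^^ Suc (Suc p)) x) \<le> 1"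
  have D: "((deriv ^^ k) x has_real_derivative (deriv ^^ Suc k) x t) (at t)" if "k \<le> p" for k t
    using x that by (auto simp: L_space_def less_Suc_eq_le intro: field_differentiable_derivI)
  have "AE t in lebesgue. ennreal \<bar>(deriv ^^ Suc (Suc p)) x t\<bar> \<le> Linf_norm ((deriv ^^ Suc (Suc p)) x)"
    unfolding Linf_norm_def by (rule esssup_AE)
  then have "AE t in lebesgue. \<bar>deriv ((deriv ^^ Suc p) x) t\<bar> \<le> 1"
  proof (rule eventually_mono)
    fix t assume "ennreal \<bar>(deriv ^^ Suc (Suc p)) x t\<bar> \<le> Linf_norm ((deriv ^^ Suc (Suc p)) x)"
    also have "\<dots> \<le> 1" using x by blast
    finally show "\<bar>deriv ((deriv ^^ Suc p) x) t\<bar> \<le> 1" by simp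
  qed
  then have "\<bar>(deriv ^^ Suc p) x t - (deriv ^^ Suc p) x s\<bar> \<le> 1 * \<bar>t - s\<bar>" for s t
    using x by (intro Lipschitz_if_AE_deriv_le) (auto simp: L_space_def)
  then show "smooth_tower p (\<lambda>k. (deriv ^^ k) x)"
    using D x by (auto simp: smooth_tower_def L_space_def periodic_fun_simple_iff)
next
  assume x: "smooth_tower p (\<lambda>k. (deriv ^^ k) x)"
  have lip: "\<bar>(deriv ^^ Suc p) x t - (deriv ^^ Suc p) x s\<bar> \<le> \<bar>t - s\<bar>" for s t
    using x unfolding smooth_tower_def by blast
  note Linf = Lipschitz_imp_deriv_Linf[of "(deriv ^^ Suc p) x", OF lip]
  have "locally_absolutely_continuous ((deriv ^^ Suc p) x)"
    by (rule Lipschitz_imp_locally_absolutely_continuous[of _ 1]) (use lip in auto)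
  moreover have "(deriv ^^ k) x field_differentiable (at t)" if "k \<le> p" for k t
    using x that unfolding smooth_tower_def field_differentiable_def by blast
  ultimately show "x \<in> L_space (Suc (Suc p)) \<and> Linf_norm ((deriv ^^ Suc (Suc p)) x) \<le> 1"
    using x Linf by (auto simp: L_space_def smooth_tower_def periodic_fun_simple_iff Linf_def less_Suc_eq_le
        intro: le_less_trans)
qed

lemma smooth_tower_continuous:
  assumes "smooth_tower p D" "k \<le> Suc p"
  shows "continuous_on UNIV (D k)"
proof (cases "k = Suc p")
  case True
  then show ?thesis
    using assms(1) by (auto simp: smooth_tower_def intro!: Lipschitz_imp_continuous[of _ 1])
next
  case False
  then show ?thesis
    using assms by (auto simp: smooth_tower_def intro!: DERIV_continuous_on[of UNIV _ "D (Suc k)"])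
qed

lemma W_1_iff:
  assumes "0 \<le> M"
  shows "x \<in> W_1 (Suc (Suc p)) M \<longleftrightarrow>
     smooth_tower p (\<lambda>k. (deriv ^^ k) x) \<and> (\<forall>t. \<bar>(deriv ^^ Suc p) x t\<bar> \<le> M)"
  using L_space_iff_smooth_tower[of x p]
    Linf_norm_le_iff[OF smooth_tower_continuous[of p "\<lambda>k. (deriv ^^ k) x" "Suc p"] assms]
  unfolding W_1_def by auto

lemma W_2_iff:
  assumes "0 \<le> M"
  shows "x \<in> W_2 (Suc (Suc p)) M \<longleftrightarrow>
     smooth_tower p (\<lambda>k. (deriv ^^ k) x) \<and> (\<forall>t. \<bar>(deriv ^^ p) x t\<bar> \<le> M)"
  using L_space_iff_smooth_tower[of x p]
    Linf_norm_le_iff[OF smooth_tower_continuous[of p "\<lambda>k. (deriv ^^ k) x" p] assms]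
  unfolding W_2_def by auto

lemma W_12_iff:
  assumes "0 \<le> M" "0 \<le> N"
  shows "x \<in> W_12 (Suc (Suc p)) M N \<longleftrightarrow>
     smooth_tower p (\<lambda>k. (deriv ^^ k) x) \<and> (\<forall>t. \<bar>(deriv ^^ Suc p) x t\<bar> \<le> N) \<and>
     (\<forall>t. \<bar>(deriv ^^ p) x t\<bar> \<le> M)"
  using L_space_iff_smooth_tower[of x p]
    Linf_norm_le_iff[OF smooth_tower_continuous[of p "\<lambda>k. (deriv ^^ k) x" p] assms(1)]
    Linf_norm_le_iff[OF smooth_tower_continuous[of p "\<lambda>k. (deriv ^^ k) x" "Suc p"] assms(2)]
  unfolding W_12_def by auto

section \<open>Optimal recovery at fixed nodes\<close>

lemma Linf_norm_ge_abs:
  assumes "continuous_on UNIV g"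
  shows "ennreal \<bar>g t\<bar> \<le> Linf_norm g"
proof (cases "Linf_norm g")
  case (real M)
  then have "\<forall>t. \<bar>g t\<bar> \<le> M" using Linf_norm_le_iff[OF assms, of M] by simp
  then show ?thesis using real by (simp add: ennreal_leI)
qed auto

text \<open>The data of \<open>x\<close> and of \<open>- x\<close> are both zero, so every method
  answers both with the same function, which misses one of them by at least
  \<open>\<bar>x t0\<bar>\<close> at \<open>t0\<close>.\<close>

lemma best_error_at_ge:
  assumes x: "x \<in> X" "(\<lambda>t. - x t) \<in> X" "continuous_on UNIV x"
    and zero: "\<And>t. t \<in> set u \<Longrightarrow> x t = 0"
  shows "ennreal \<bar>x t0\<bar> \<le> best_error_at X u Linf_norm"
  unfolding best_error_at_def
proof (rule INF_greatest)
  fix \<Psi> assume \<Psi>: "\<Psi> \<in> recovery_methods (length u)"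
  define v where "v = map x u"
  have v': "map (\<lambda>t. - x t) u = v" using zero by (simp add: v_def)
  have "\<Psi> v \<in> C_periodic" using \<Psi> by (simp add: recovery_methods_def v_def)
  then have cont: "continuous_on UNIV (\<Psi> v)" by (simp add: C_periodic_def)
  have "ennreal \<bar>x t0 - \<Psi> v t0\<bar> \<le> Linf_norm (\<lambda>t. x t - \<Psi> v t)"
    by (rule Linf_norm_ge_abs) (intro continuous_on_diff x(3) cont)
  also have "\<dots> \<le> method_error X u \<Psi> Linf_norm"
    unfolding method_error_def v_def using x(1) by (intro SUP_upper2[of x]) auto
  finally have 1: "ennreal \<bar>x t0 - \<Psi> v t0\<bar> \<le> method_error X u \<Psi> Linf_norm" .
  have "ennreal \<bar>- x t0 - \<Psi> v t0\<bar> \<le> Linf_norm (\<lambda>t. - x t - \<Psi> v t)"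
    by (rule Linf_norm_ge_abs) (intro continuous_on_diff continuous_on_minus x(3) cont)
  also have "\<dots> \<le> method_error X u \<Psi> Linf_norm"
    unfolding method_error_def using x(2) v' by (intro SUP_upper2[of "\<lambda>t. - x t"]) auto
  finally have 2: "ennreal \<bar>- x t0 - \<Psi> v t0\<bar> \<le> method_error X u \<Psi> Linf_norm" .
  have "\<bar>x t0\<bar> \<le> \<bar>x t0 - \<Psi> v t0\<bar> \<or> \<bar>x t0\<bar> \<le> \<bar>- x t0 - \<Psi> v t0\<bar>" by linarith
  then show "ennreal \<bar>x t0\<bar> \<le> method_error X u \<Psi> Linf_norm"
    using 1 2 by (auto intro: order_trans[OF ennreal_leI])
qed

lemma Lipschitz_SUP:
  fixes F :: "(real \<Rightarrow> real) set"
  assumes ne: "F \<noteq> {}" and bdd: "\<And>t. bdd_above ((\<lambda>x. x t) ` F)"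
    and lip: "\<And>x s t. x \<in> F \<Longrightarrow> \<bar>x s - x t\<bar> \<le> K * \<bar>s - t\<bar>"
  shows "\<bar>(SUP x\<in>F. x s) - (SUP x\<in>F. x t)\<bar> \<le> K * \<bar>s - t\<bar>"
proof -
  have *: "(SUP x\<in>F. x s) \<le> (SUP x\<in>F. x t) + K * \<bar>s - t\<bar>" for s t
  proof (rule cSUP_least[OF ne])
    fix x assume x: "x \<in> F"
    have "x s \<le> x t + K * \<bar>s - t\<bar>" using lip[OF x, of s t] by linarith
    also have "x t \<le> (SUP x\<in>F. x t)" using x bdd by (rule cSUP_upper)
    finally show "x s \<le> (SUP x\<in>F. x t) + K * \<bar>s - t\<bar>" by simp
  qed
  show ?thesis using *[of s t] *[of t s] by (simp add: abs_le_iff abs_minus_commute)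
qed

text \<open>The optimal method assigns to the data the pointwise midpoint of the values
  attained by the functions of the class with these data.\<close>
lemma best_error_at_le:
  assumes per: "\<And>x t. x \<in> X \<Longrightarrow> x (t + 2 * pi) = x t"
    and lip: "\<And>x s t. x \<in> X \<Longrightarrow> \<bar>x s - x t\<bar> \<le> K * \<bar>s - t\<bar>" and K: "0 \<le> K"
    and mid: "\<And>x y. \<lbrakk>x \<in> X; y \<in> X\<rbrakk> \<Longrightarrow> (\<lambda>t. (x t - y t) / 2) \<in> X"
    and bound: "\<And>x t. \<lbrakk>x \<in> X; \<And>t. t \<in> set u \<Longrightarrow> x t = 0\<rbrakk> \<Longrightarrow> \<bar>x t\<bar> \<le> e"
    and e: "0 \<le> e"
  shows "best_error_at X u Linf_norm \<le> ennreal e"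
proof -
  define F where "F v = {x \<in> X. map x u = v}" for v
  \<comment> \<open>Data that no function of the class produces get the zero function, so that all
    values of \<open>\<Psi>\<close> are continuous and periodic.\<close>
  define \<Psi> where "\<Psi> v t = (if F v = {} then 0 else ((SUP x\<in>F v. x t) + (INF x\<in>F v. x t)) / 2)" for v t
  \<comment> \<open>Half the difference of two functions with the same data lies in \<open>X\<close>
    and vanishes at the nodes.\<close>
  have close: "\<bar>x t - y t\<bar> \<le> 2 * e" if xy: "x \<in> F v" "y \<in> F v" for x y v t
  proof -
    have "x s = y s" if "s \<in> set u" for s
    proof -
      have "map x u = map y u" using xy by (simp add: F_def)
      then show ?thesis using that by simp
    qed
    then have "\<bar>(x t - y t) / 2\<bar> \<le> e"
      using xy by (intro bound[where x = "\<lambda>t. (x t - y t) / 2"] mid) (auto simp: F_def)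
    then show ?thesis by simp
  qed
  have bdda: "bdd_above ((\<lambda>x. x t) ` F v)" and bddb: "bdd_below ((\<lambda>x. x t) ` F v)" for v t
  proof -
    have "bdd_above ((\<lambda>x. x t) ` F v) \<and> bdd_below ((\<lambda>x. x t) ` F v)"
    proof (cases "F v = {}")
      case False
      then obtain y where y: "y \<in> F v" by blast
      have "y t - 2 * e \<le> x t \<and> x t \<le> y t + 2 * e" if "x \<in> F v" for x
        using close[OF that y, of t] by linarith
      then show ?thesis by (auto intro!: bdd_aboveI[of _ "y t + 2 * e"] bdd_belowI[of _ "y t - 2 * e"])
    qed simp
    then show "bdd_above ((\<lambda>x. x t) ` F v)" "bdd_below ((\<lambda>x. x t) ` F v)" by auto
  qed
  have \<Psi>_lip: "\<bar>\<Psi> v s - \<Psi> v t\<bar> \<le> K * \<bar>s - t\<bar>" for v s t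
  proof (cases "F v = {}")
    case False
    let ?G = "(\<lambda>x t. - x t) ` F v"
    have inf: "(INF x\<in>F v. x t) = - (SUP x\<in>?G. x t)" for t
      by (simp add: image_image Inf_real_def)
    have "\<bar>(SUP x\<in>F v. x s) - (SUP x\<in>F v. x t)\<bar> \<le> K * \<bar>s - t\<bar>"
      by (rule Lipschitz_SUP[OF False bdda]) (use lip in \<open>auto simp: F_def\<close>)
    moreover have "\<bar>(SUP x\<in>?G. x s) - (SUP x\<in>?G. x t)\<bar> \<le> K * \<bar>s - t\<bar>"
    proof (rule Lipschitz_SUP)
      show "bdd_above ((\<lambda>x. x t) ` ?G)" for t
        using bddb[of t v] by (simp add: image_image flip: bdd_below_uminus)
      show "\<bar>x s - x t\<bar> \<le> K * \<bar>s - t\<bar>" if "x \<in> ?G" for x s t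
        using that lip[of _ s t] by (auto simp: F_def abs_minus_commute)
    qed (use False in auto)
    ultimately show ?thesis using False unfolding \<Psi>_def inf by (simp add: abs_le_iff field_simps)
  qed (use K in \<open>simp add: \<Psi>_def\<close>)
  have "\<Psi> v \<in> C_periodic" for v
  proof -
    have "(\<lambda>x. x (t + 2 * pi)) ` F v = (\<lambda>x. x t) ` F v" for t
      using per by (intro image_cong) (auto simp: F_def)
    then have "\<Psi> v (t + 2 * pi) = \<Psi> v t" for t
      by (simp add: \<Psi>_def)
    moreover have "continuous_on UNIV (\<Psi> v)"
      by (rule Lipschitz_imp_continuous[of _ K]) (use \<Psi>_lip K in auto)
    ultimately show ?thesis by (simp add: C_periodic_def periodic_fun_simple_iff)
  qed
  then have "\<Psi> \<in> recovery_methods (length u)" by (simp add: recovery_methods_def)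
  then have "best_error_at X u Linf_norm \<le> method_error X u \<Psi> Linf_norm"
    unfolding best_error_at_def by (rule INF_lower)
  also have "\<dots> \<le> ennreal e"
    unfolding method_error_def
  proof (rule SUP_least)
    fix x assume x: "x \<in> X"
    define v where "v = map x u"
    have xF: "x \<in> F v" using x by (simp add: F_def v_def)
    have "\<bar>x t - \<Psi> v t\<bar> \<le> e" for t
    proof -
      have 1: "x t \<le> (SUP x\<in>F v. x t)" using xF bdda by (rule cSUP_upper)
      have 2: "(INF x\<in>F v. x t) \<le> x t" using bddb xF by (rule cINF_lower)
      have "(SUP x\<in>F v. x t) \<le> (INF x\<in>F v. x t) + 2 * e"
      proof (rule cSUP_least)
        fix y assume y: "y \<in> F v"
        have "y t - 2 * e \<le> (INF x\<in>F v. x t)"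
        proof (rule cINF_greatest)
          show "y t - 2 * e \<le> z t" if "z \<in> F v" for z using close[OF y that, of t] by linarith
        qed (use xF in auto)
        then show "y t \<le> (INF x\<in>F v. x t) + 2 * e" by simp
      qed (use xF in auto)
      then show ?thesis using 1 2 xF by (auto simp: \<Psi>_def abs_le_iff field_simps)
    qed
    moreover have "continuous_on UNIV (\<lambda>t. x t - \<Psi> v t)"
      using lip[OF x] \<Psi>_lip[of v] K
      by (intro continuous_on_diff Lipschitz_imp_continuous[of _ K]) auto
    ultimately show "Linf_norm (\<lambda>t. x t - \<Psi> (map x u) t) \<le> ennreal e"
      using e by (simp add: Linf_norm_le_iff v_def)
  qed
  finally show ?thesis .
qed

section \<open>Mean-preserving periodic integration\<close>

lemma antiderivative_exists:
  fixes f :: "real \<Rightarrow> real"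
  assumes "continuous_on UNIV f"
  shows "\<exists>F. F 0 = 0 \<and> (\<forall>t. (F has_real_derivative f t) (at t))"
proof -
  obtain F where F: "\<And>t. (F has_vector_derivative f t) (at t)"
    using einterval_antiderivative[of "-\<infinity>" "\<infinity>" f] assms continuous_on_eq_continuous_at[of UNIV f] by auto
  have "((\<lambda>t. F t - F 0) has_real_derivative f t) (at t)" for t
    using F[of t] by (auto intro!: derivative_eq_intros simp: has_real_derivative_iff_has_vector_derivative)
  then show ?thesis by (intro exI[of _ "\<lambda>t. F t - F 0"]) auto
qed

text \<open>Choosing the antiderivative that vanishes at 0 gives one function on the whole line,
  without a case distinction for oriented integrals.\<close>

definition prim :: "(real \<Rightarrow> real) \<Rightarrow> real \<Rightarrow> real" where
  "prim f = (SOME F. F 0 = 0 \<and> (\<forall>t. (F has_real_derivative f t) (at t)))"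

lemma prim_0: "continuous_on UNIV f \<Longrightarrow> prim f 0 = 0"
  and DERIV_prim: "continuous_on UNIV f \<Longrightarrow> (prim f has_real_derivative f t) (at t)"
  using someI_ex[OF antiderivative_exists] unfolding prim_def by blast+

lemma DERIV_eq_imp_diff_eq:
  fixes F G :: "real \<Rightarrow> real"
  assumes "\<And>t. (F has_real_derivative f t) (at t)" "\<And>t. (G has_real_derivative f t) (at t)"
  shows "F t - F s = G t - G s"
proof -
  have "((\<lambda>t. F t - G t) has_real_derivative 0) (at t)" for t
    using DERIV_diff[OF assms] by simp
  then have "F t - G t = F s - G s" by (intro DERIV_isconst_all[of "\<lambda>t. F t - G t"]) auto
  then show ?thesis by simp
qed

lemma prim_eq:
  assumes "\<And>t. (G has_real_derivative f t) (at t)" "continuous_on UNIV f"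
  shows "prim f t = G t - G 0"
  using DERIV_eq_imp_diff_eq[OF DERIV_prim[OF assms(2)] assms(1), of t 0] prim_0[OF assms(2)] by simp

definition mean :: "(real \<Rightarrow> real) \<Rightarrow> real" where
  "mean f = prim f (2 * pi) / (2 * pi)"

definition periodic_continuous :: "(real \<Rightarrow> real) \<Rightarrow> bool" where
  "periodic_continuous f \<longleftrightarrow> continuous_on UNIV f \<and> (\<forall>t. f (t + 2 * pi) = f t)"

lemma periodic_continuous_shift:
  assumes "periodic_continuous f"
  shows "periodic_continuous (\<lambda>t. f (t + s))"
proof -
  have "f (t + 2 * pi + s) = f (t + s)" for t
    using assms by (metis add.assoc add.commute periodic_continuous_def)
  then show ?thesis using assms
    by (auto simp: periodic_continuous_def intro!: continuous_intros continuous_on_compose2[of UNIV f])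
qed

lemma mean_linear:
  assumes "continuous_on UNIV f" "continuous_on UNIV g"
  shows "mean (\<lambda>t. a * f t + b * g t) = a * mean f + b * mean g"
proof -
  have "prim (\<lambda>t. a * f t + b * g t) (2 * pi) = (a * prim f (2 * pi) + b * prim g (2 * pi)) - (a * prim f 0 + b * prim g 0)"
    by (rule prim_eq) (use assms in \<open>auto intro!: derivative_eq_intros continuous_intros DERIV_prim\<close>)
  then show ?thesis using assms by (simp add: mean_def prim_0 add_divide_distrib)
qed

lemma mean_const: "mean (\<lambda>_. c) = c"
  using prim_eq[of "\<lambda>t. c * t" "\<lambda>_. c" "2 * pi"]
  by (auto simp: mean_def intro!: derivative_eq_intros)

text \<open>As \<open>f\<close> is periodic, the increment of \<open>prim f\<close> over an interval
  of length \<open>2 * pi\<close> does not depend on where it starts.\<close>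

lemma mean_shift:
  assumes "periodic_continuous f"
  shows "mean (\<lambda>t. f (t + s)) = mean f"
proof -
  have c: "continuous_on UNIV f" and c': "continuous_on UNIV (\<lambda>t. f (t + s))"
    using assms periodic_continuous_shift[OF assms, of s] by (auto simp: periodic_continuous_def)
  have sh: "((\<lambda>t. prim f (t + a)) has_real_derivative f (t + a)) (at t)" for t a
    using DERIV_shift[of "prim f" "f (t + a)" t a] DERIV_prim[OF c, of "t + a"] by simp
  have "prim (\<lambda>t. f (t + s)) (2 * pi) = prim f (2 * pi + s) - prim f (0 + s)"
    by (rule prim_eq[OF sh c'])
  moreover have "prim f (s + 2 * pi) - prim f (0 + 2 * pi) = prim f s - prim f 0"
  proof (rule DERIV_eq_imp_diff_eq)
    show "((\<lambda>t. prim f (t + 2 * pi)) has_real_derivative f t) (at t)" for t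
      using sh[of "2 * pi" t] assms by (simp add: periodic_continuous_def)
  qed (rule DERIV_prim[OF c])
  ultimately show ?thesis using prim_0[OF c] by (simp add: mean_def add.commute)
qed

text \<open>Restoring the mean makes this operator injective, so that the spline coefficients can be recovered.\<close>
definition pint :: "(real \<Rightarrow> real) \<Rightarrow> real \<Rightarrow> real" where
  "pint f t = prim (\<lambda>t. f t - mean f) t - mean (prim (\<lambda>t. f t - mean f)) + mean f"

lemma DERIV_pint:
  assumes "continuous_on UNIV f"
  shows "(pint f has_real_derivative f t - mean f) (at t)"
  unfolding pint_def using assms
  by (auto intro!: derivative_eq_intros DERIV_prim continuous_intros)

lemma continuous_pint:
  assumes "continuous_on UNIV f"
  shows "continuous_on UNIV (pint f)"
  using DERIV_pint[OF assms] by (auto intro!: DERIV_continuous_on)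

lemma mean_pint:
  assumes "continuous_on UNIV f"
  shows "mean (pint f) = mean f"
proof -
  let ?P = "prim (\<lambda>t. f t - mean f)"
  have "continuous_on UNIV ?P"
    by (rule DERIV_continuous_on[OF has_field_derivative_at_within[OF DERIV_prim]])
      (use assms in \<open>auto intro!: continuous_intros\<close>)
  then have "mean (\<lambda>t. 1 * ?P t + 1 * (mean f - mean ?P)) = 1 * mean ?P + 1 * mean (\<lambda>t::real. mean f - mean ?P)"
    by (intro mean_linear) auto
  then show ?thesis unfolding pint_def[abs_def] by (simp add: mean_const algebra_simps)
qed

lemma periodic_continuous_pint:
  assumes "periodic_continuous f"
  shows "periodic_continuous (pint f)"
proof -
  have c: "continuous_on UNIV f" using assms by (simp add: periodic_continuous_def)
  have sh: "((\<lambda>t. pint f (t + 2 * pi)) has_real_derivative f t - mean f) (at t)" for t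
    using DERIV_shift[of "pint f" "f t - mean f" t "2 * pi"] DERIV_pint[OF c, of "t + 2 * pi"] assms
    by (simp add: periodic_continuous_def)
  have "pint f (t + 2 * pi) - pint f (0 + 2 * pi) = pint f t - pint f 0" for t
    by (rule DERIV_eq_imp_diff_eq[OF sh DERIV_pint[OF c]])
  moreover have "pint f (2 * pi) = pint f 0"
  proof -
    have "prim (\<lambda>t. f t - mean f) (2 * pi) = (prim f (2 * pi) - mean f * (2 * pi)) - (prim f 0 - mean f * 0)"
      by (rule prim_eq) (use c in \<open>auto intro!: derivative_eq_intros continuous_intros DERIV_prim\<close>)
    moreover have "prim (\<lambda>t. f t - mean f) 0 = 0" using c by (intro prim_0 continuous_intros)
    ultimately show ?thesis using prim_0[OF c] by (simp add: pint_def mean_def)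
  qed
  ultimately show ?thesis using continuous_pint[OF c] by (simp add: periodic_continuous_def)
qed

text \<open>Derivative and mean determine \<open>pint f\<close>; linearity, translation and the
  action on constants are read off from this.\<close>

lemma pint_eqI:
  assumes c: "continuous_on UNIV f"
    and D: "\<And>t. (G has_real_derivative f t - mean f) (at t)" and m: "mean G = mean f"
  shows "pint f = G"
proof
  fix t
  define d where "d = pint f 0 - G 0"
  have *: "pint f s = G s + d" for s
    using DERIV_eq_imp_diff_eq[OF DERIV_pint[OF c] D, of s 0] by (simp add: d_def)
  have cG: "continuous_on UNIV G" using D by (auto intro!: DERIV_continuous_on)
  have "mean (\<lambda>t. 1 * G t + 1 * d) = 1 * mean G + 1 * mean (\<lambda>t::real. d)"
    using cG by (intro mean_linear) auto
  moreover have "pint f = (\<lambda>t. 1 * G t + 1 * d)" using * by (simp add: fun_eq_iff)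
  ultimately have "d = 0" using m mean_pint[OF c] by (simp add: mean_const)
  then show "pint f t = G t" using * by simp
qed

lemma pint_linear:
  assumes "continuous_on UNIV f" "continuous_on UNIV g"
  shows "pint (\<lambda>t. a * f t + b * g t) = (\<lambda>t. a * pint f t + b * pint g t)"
proof (rule pint_eqI)
  show "((\<lambda>t. a * pint f t + b * pint g t) has_real_derivative
      a * f t + b * g t - mean (\<lambda>t. a * f t + b * g t)) (at t)" for t
    unfolding mean_linear[OF assms]
    by (auto intro!: derivative_eq_intros DERIV_pint assms simp: algebra_simps)
  show "mean (\<lambda>t. a * pint f t + b * pint g t) = mean (\<lambda>t. a * f t + b * g t)"
    using assms by (simp add: mean_linear continuous_pint mean_pint)
qed (use assms in \<open>auto intro!: continuous_intros\<close>)

lemma pint_shift: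
  assumes "periodic_continuous f"
  shows "pint (\<lambda>t. f (t + s)) = (\<lambda>t. pint f (t + s))"
proof (rule pint_eqI)
  have c: "continuous_on UNIV f" using assms by (simp add: periodic_continuous_def)
  show "continuous_on UNIV (\<lambda>t. f (t + s))"
    using periodic_continuous_shift[OF assms] by (simp add: periodic_continuous_def)
  show "((\<lambda>t. pint f (t + s)) has_real_derivative f (t + s) - mean (\<lambda>t. f (t + s))) (at t)" for t
    using DERIV_shift[of "pint f" "f (t + s) - mean f" t s] DERIV_pint[OF c, of "t + s"]
    by (simp add: mean_shift[OF assms])
  show "mean (\<lambda>t. pint f (t + s)) = mean (\<lambda>t. f (t + s))"
    by (simp add: mean_shift assms periodic_continuous_pint mean_pint c)
qed

lemma pint_const: "pint (\<lambda>_. c) = (\<lambda>_. c)"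
  by (rule pint_eqI) (auto simp: mean_const)

lemma pint_funpow:
  assumes f: "periodic_continuous f"
  shows periodic_continuous_pint_funpow: "periodic_continuous ((pint ^^ m) f)"
    and mean_pint_funpow: "mean ((pint ^^ m) f) = mean f"
proof (induction m)
  case (Suc m)
  case 1
  show ?case using Suc by (simp add: periodic_continuous_pint)
  case 2
  show ?case using Suc by (simp add: mean_pint periodic_continuous_def)
qed (use f in auto)

lemma pint_funpow_linear:
  assumes "periodic_continuous f" "periodic_continuous g"
  shows "(pint ^^ m) (\<lambda>t. a * f t + b * g t) = (\<lambda>t. a * (pint ^^ m) f t + b * (pint ^^ m) g t)"
proof (induction m)
  case (Suc m)
  show ?case using assms[THEN periodic_continuous_pint_funpow, of m]
    by (simp add: Suc pint_linear periodic_continuous_def)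
qed simp

lemma pint_funpow_shift:
  assumes "periodic_continuous f"
  shows "(pint ^^ m) (\<lambda>t. f (t + s)) = (\<lambda>t. (pint ^^ m) f (t + s))"
  by (induction m) (simp_all add: pint_shift periodic_continuous_pint_funpow assms)

lemma pint_funpow_const: "(pint ^^ m) (\<lambda>_. c) = (\<lambda>_. c)"
  by (induction m) (simp_all add: pint_const)

text \<open>These are the derivatives of \<open>(pint ^^ p) f\<close>. Every iterate carries the
  mean of \<open>f\<close>, which differentiation removes, hence the subtraction from
  \<open>k = 1\<close> on.\<close>

definition pint_tower :: "nat \<Rightarrow> (real \<Rightarrow> real) \<Rightarrow> nat \<Rightarrow> real \<Rightarrow> real" where
  "pint_tower p f k t = (pint ^^ (p - k)) f t - (if k = 0 then 0 else mean f)"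

lemma DERIV_pint_tower:
  assumes f: "periodic_continuous f" and "k < p"
  shows "(pint_tower p f k has_real_derivative pint_tower p f (Suc k) t) (at t)"
proof -
  have Suc: "p - k = Suc (p - Suc k)" using assms(2) by simp
  have "((pint ^^ (p - k)) f has_real_derivative (pint ^^ (p - Suc k)) f t - mean ((pint ^^ (p - Suc k)) f)) (at t)"
    unfolding Suc using periodic_continuous_pint_funpow[OF f, of "p - Suc k"]
    by (auto simp: periodic_continuous_def intro!: DERIV_pint)
  then show ?thesis
    unfolding pint_tower_def[abs_def] mean_pint_funpow[OF f] by (auto intro!: derivative_eq_intros)
qed

section \<open>Splines with truncated derivatives\<close>

lemma DERIV_eq_imp_diff_eq_on:
  fixes F G :: "real \<Rightarrow> real"
  assumes "s \<le> t" "\<And>x. \<lbrakk>s \<le> x; x \<le> t\<rbrakk> \<Longrightarrow> (F has_real_derivative f x) (at x)"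
    "\<And>x. \<lbrakk>s \<le> x; x \<le> t\<rbrakk> \<Longrightarrow> (G has_real_derivative f x) (at x)"
  shows "F t - F s = G t - G s"
proof (cases "s = t")
  case False
  have D: "((\<lambda>x. F x - G x) has_real_derivative 0) (at x)" if "s \<le> x" "x \<le> t" for x
    using DERIV_diff[OF assms(2,3)[OF that]] by simp
  have "F t - G t = F s - G s"
  proof (rule DERIV_isconst_end[of s t "\<lambda>x. F x - G x"])
    show "continuous_on {s..t} (\<lambda>x. F x - G x)"
      by (intro continuous_at_imp_continuous_on ballI DERIV_isCont[OF D]) auto
  qed (use D False assms(1) in auto)
  then show ?thesis by simp
qed simp

text \<open>\<open>N\<close> caps the derivative of the splines, and \<open>a\<close> is the
  half-width of a transition between plateaus, each fitting into one cell. The bound M enters only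
  through the choice of \<open>a\<close>, which fixes the plateau height \<open>H\<close>.\<close>

locale ramp_spline =
  fixes n :: nat and N a :: real
  assumes n: "1 \<le> n" and N: "0 < N" and a: "0 < a" "2 * a \<le> pi / real n"
begin

definition h :: real where "h = pi / real n"

definition q :: "real \<Rightarrow> real" where "q v = min N (max 0 v)"

definition Q :: "real \<Rightarrow> real" where "Q = prim q"

definition H :: real where "H = Q a"

text \<open>For integer \<open>k\<close>, \<open>ramp e\<close> is \<open>e k\<close> times a trapezoidal bump of half-width \<open>a\<close> on the cell
  \<open>[k h, (k + 1) h]\<close>, and \<open>spl c\<close> is the antiderivative with the values \<open>H * c k\<close> at the nodes \<open>k h\<close>.\<close>
definition ramp :: "(int \<Rightarrow> real) \<Rightarrow> real \<Rightarrow> real" where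
  "ramp e t = e \<lfloor>t / h\<rfloor> * q (a - \<bar>t - (of_int \<lfloor>t / h\<rfloor> + 1 / 2) * h\<bar>)"

text \<open>The factor 1/2 is there because \<open>step\<close> rises by \<open>2 * H\<close> across
  a cell.\<close>

definition half_diff :: "(int \<Rightarrow> real) \<Rightarrow> int \<Rightarrow> real" where
  "half_diff c k = (c (k + 1) - c k) / 2"

definition spl :: "(int \<Rightarrow> real) \<Rightarrow> real \<Rightarrow> real" where
  "spl c t = H * c 0 + prim (ramp (half_diff c)) t"

text \<open>The odd transition from \<open>- H\<close> to \<open>H\<close>, constant at distance
  \<open>a\<close> or more from 0 on either side.\<close>

definition step :: "real \<Rightarrow> real" where "step = prim (\<lambda>s. q (a - \<bar>s\<bar>))"

definition periodic_coeffs :: "(int \<Rightarrow> real) \<Rightarrow> bool" where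
  "periodic_coeffs c \<longleftrightarrow> (\<forall>k. c (k + 2 * int n) = c k)"

section \<open>The profile of a single transition\<close>

lemma h: "0 < h" "2 * a \<le> h" "2 * real n * h = 2 * pi"
  using n a by (auto simp: h_def)

lemma q_bounds: "0 \<le> q v" "q v \<le> N" "q v \<le> max 0 v"
  using N by (auto simp: q_def)

lemma q_nonpos: "v \<le> 0 \<Longrightarrow> q v = 0"
  using N by (auto simp: q_def)

lemma q_Lipschitz: "\<bar>q v - q w\<bar> \<le> \<bar>v - w\<bar>"
  by (auto simp: q_def min_def max_def)

lemma continuous_q: "continuous_on S q"
  unfolding q_def[abs_def] by (intro continuous_intros)

lemma DERIV_Q: "(Q has_real_derivative q v) (at v)"
  unfolding Q_def by (intro DERIV_prim continuous_q)

lemma Q_0: "Q 0 = 0"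
  unfolding Q_def by (intro prim_0 continuous_q)

lemma Q_nonpos:
  assumes "v \<le> 0"
  shows "Q v = 0"
proof -
  have "Q 0 - Q v = 0 - 0"
  proof (rule DERIV_eq_imp_diff_eq_on[OF assms DERIV_Q])
    show "((\<lambda>_. 0) has_real_derivative q x) (at x)" if "x \<le> 0" for x
      using q_nonpos[OF that] by simp
  qed
  then show ?thesis by (simp add: Q_0)
qed

lemma Q_mono: "v \<le> w \<Longrightarrow> Q v \<le> Q w"
  using DERIV_Q q_bounds(1) by (intro DERIV_nonneg_imp_nondecreasing[of v w Q]) blast+

lemma Q_nonneg: "0 \<le> Q v"
  using Q_mono[of "min 0 v" v] Q_nonpos[of "min 0 v"] by simp

lemma Q_square:
  assumes "0 \<le> v" "v \<le> N"
  shows "Q v = v\<^sup>2 / 2"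
proof -
  have "Q v - Q 0 = v\<^sup>2 / 2 - 0\<^sup>2 / 2"
  proof (rule DERIV_eq_imp_diff_eq_on[OF assms(1) DERIV_Q])
    show "((\<lambda>x. x\<^sup>2 / 2) has_real_derivative q x) (at x)" if "0 \<le> x" "x \<le> v" for x
      using that assms by (auto intro!: derivative_eq_intros simp: q_def)
  qed
  then show ?thesis by (simp add: Q_0)
qed

lemma H_pos: "0 < H"
proof -
  have "0 < (min a N)\<^sup>2 / 2" using a N by simp
  also have "\<dots> = Q (min a N)" using a N by (intro Q_square[symmetric]) auto
  also have "\<dots> \<le> H" unfolding H_def by (rule Q_mono) simp
  finally show ?thesis .
qed

lemma continuous_bump: "continuous_on UNIV (\<lambda>s. q (a - \<bar>s\<bar>))"
  by (intro continuous_on_compose2[OF continuous_q[of UNIV]] continuous_intros) auto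

lemma DERIV_step: "(step has_real_derivative q (a - \<bar>s\<bar>)) (at s)"
  unfolding step_def by (intro DERIV_prim continuous_bump)

lemma step_0: "step 0 = 0"
  unfolding step_def by (intro prim_0 continuous_bump)

lemma step_minus: "step (- s) = - step s"
proof -
  have D: "((\<lambda>s. - step (- s)) has_real_derivative q (a - \<bar>s\<bar>)) (at s)" for s
    using DERIV_minus[OF DERIV_mirror[of step "q (a - \<bar>s\<bar>)" s, THEN iffD1]] DERIV_step[of "- s"]
    by (auto intro!: derivative_eq_intros DERIV_chain2[OF DERIV_step])
  show ?thesis using DERIV_eq_imp_diff_eq[OF DERIV_step D, of s 0] step_0 by simp
qed

lemma step_eq:
  assumes "0 \<le> s"
  shows "step s = H - Q (a - s)"
proof -
  have "step s - step 0 = (H - Q (a - s)) - (H - Q (a - 0))"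
  proof (rule DERIV_eq_imp_diff_eq_on[OF assms])
    show "(step has_real_derivative q (a - x)) (at x)" if "0 \<le> x" for x
      using DERIV_step[of x] that by simp
    show "((\<lambda>s. H - Q (a - s)) has_real_derivative q (a - x)) (at x)" for x
      by (auto intro!: derivative_eq_intros DERIV_chain2[OF DERIV_Q])
  qed
  then show ?thesis by (simp add: step_0 H_def)
qed

lemma step_half: "step (h / 2) = H"
  using h by (simp add: step_eq Q_nonpos)

lemma step_mono: "s \<le> t \<Longrightarrow> step s \<le> step t"
  using DERIV_step q_bounds(1) by (intro DERIV_nonneg_imp_nondecreasing[of s t step]) blast+

lemma abs_step: "\<bar>step s\<bar> \<le> H"
proof -
  have *: "\<bar>step s\<bar> \<le> H" if "0 \<le> s" for s
    using step_eq[OF that] Q_nonneg step_mono[OF that] step_0 by simp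
  show ?thesis using *[of s] *[of "- s"] by (cases "0 \<le> s") (auto simp: step_minus)
qed

section \<open>Ramps, cell by cell\<close>

lemma floor_cell:
  assumes "of_int k * h \<le> t" "t < (of_int k + 1) * h"
  shows "\<lfloor>t / h\<rfloor> = k"
  using assms h(1) by (intro floor_unique) (auto simp: field_simps)

lemma cell_bounds: "of_int \<lfloor>t / h\<rfloor> * h \<le> t" "t < (of_int \<lfloor>t / h\<rfloor> + 1) * h"
  by (simp_all flip: pos_le_divide_eq[OF h(1)] pos_divide_less_eq[OF h(1)])

lemma floor_shift: "\<lfloor>(t + of_int j * h) / h\<rfloor> = \<lfloor>t / h\<rfloor> + j"
proof -
  have "(t + of_int j * h) / h = t / h + of_int j" using h(1) by (simp add: field_simps)
  then show ?thesis by simp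
qed

text \<open>At the right end point the floor already denotes the next cell; both bumps vanish there
  since \<open>2 * a \<le> h\<close>.\<close>

lemma ramp_cell:
  assumes "of_int k * h \<le> t" "t \<le> (of_int k + 1) * h"
  shows "ramp e t = e k * q (a - \<bar>t - (of_int k + 1 / 2) * h\<bar>)"
proof (cases "t = (of_int k + 1) * h")
  case True
  then have "\<lfloor>t / h\<rfloor> = k + 1" using h(1) by (intro floor_cell) (auto simp: algebra_simps)
  moreover have "t - (of_int (k + 1) + 1 / 2) * h = - (h / 2)" "t - (of_int k + 1 / 2) * h = h / 2"
    using True by (simp_all add: algebra_simps)
  ultimately show ?thesis using h by (simp add: ramp_def q_nonpos)
next
  case False
  then have "\<lfloor>t / h\<rfloor> = k" using assms by (intro floor_cell) auto
  then show ?thesis by (simp add: ramp_def)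
qed

text \<open>Within a cell \<open>q\<close> is 1-Lipschitz. For points of different cells each value
  is at most \<open>B\<close> times the distance to the cell border facing the other point, and
  these two distances add up to at most \<open>\<bar>s - t\<bar>\<close>.\<close>

lemma ramp_Lipschitz:
  assumes B: "\<And>k. \<bar>e k\<bar> \<le> B"
  shows "\<bar>ramp e s - ramp e t\<bar> \<le> B * \<bar>s - t\<bar>"
proof -
  have B0: "0 \<le> B" using B[of 0] by linarith
  have *: "\<bar>ramp e s - ramp e t\<bar> \<le> B * (t - s)" if st: "s \<le> t" for s t
  proof -
    let ?k = "\<lfloor>s / h\<rfloor>" and ?l = "\<lfloor>t / h\<rfloor>"
    have "?k \<le> ?l" using st h(1) by (intro floor_mono divide_right_mono) auto
    then consider "?k = ?l" | "?k < ?l" by linarith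
    then show ?thesis
    proof cases
      case 1
      let ?r = "(of_int ?k + 1 / 2) * h"
      have "\<bar>ramp e s - ramp e t\<bar> = \<bar>e ?k\<bar> * \<bar>q (a - \<bar>s - ?r\<bar>) - q (a - \<bar>t - ?r\<bar>)\<bar>"
        using 1 by (simp add: ramp_def right_diff_distrib[symmetric] abs_mult)
      also have "\<dots> \<le> B * (t - s)"
      proof (rule mult_mono[OF B])
        have "\<bar>q (a - \<bar>s - ?r\<bar>) - q (a - \<bar>t - ?r\<bar>)\<bar> \<le> \<bar>(a - \<bar>s - ?r\<bar>) - (a - \<bar>t - ?r\<bar>)\<bar>"
          by (rule q_Lipschitz)
        also have "\<dots> \<le> t - s" using st by linarith
        finally show "\<bar>q (a - \<bar>s - ?r\<bar>) - q (a - \<bar>t - ?r\<bar>)\<bar> \<le> t - s" .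
      qed (use B0 in auto)
      finally show ?thesis .
    next
      case 2
      let ?r = "(of_int ?k + 1 / 2) * h" and ?r' = "(of_int ?l + 1 / 2) * h"
      have "\<bar>ramp e s\<bar> \<le> B * ((of_int ?k + 1) * h - s)"
      proof -
        have r: "?r = (of_int ?k + 1) * h - h / 2" by (simp add: algebra_simps)
        have "\<bar>ramp e s\<bar> = \<bar>e ?k\<bar> * q (a - \<bar>s - ?r\<bar>)"
          using q_bounds(1) by (simp add: ramp_def abs_mult)
        also have "\<dots> \<le> B * ((of_int ?k + 1) * h - s)"
          using B q_bounds(1) B0 cell_bounds[of s] h(2) q_bounds(3)[of "a - \<bar>s - ?r\<bar>"] r
          by (intro mult_mono) (auto simp: abs_if max_def split: if_splits)
        finally show ?thesis .
      qed
      moreover have "\<bar>ramp e t\<bar> \<le> B * (t - of_int ?l * h)"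
      proof -
        have r: "?r' = of_int ?l * h + h / 2" by (simp add: algebra_simps)
        have "\<bar>ramp e t\<bar> = \<bar>e ?l\<bar> * q (a - \<bar>t - ?r'\<bar>)"
          using q_bounds(1) by (simp add: ramp_def abs_mult)
        also have "\<dots> \<le> B * (t - of_int ?l * h)"
          using B q_bounds(1) B0 cell_bounds[of t] h(2) q_bounds(3)[of "a - \<bar>t - ?r'\<bar>"] r
          by (intro mult_mono) (auto simp: abs_if max_def split: if_splits)
        finally show ?thesis .
      qed
      moreover have "(of_int ?k + 1) * h \<le> of_int ?l * h"
        using 2 h(1) by (intro mult_right_mono) linarith+
      then have "B * ((of_int ?k + 1) * h - s) + B * (t - of_int ?l * h) \<le> B * (t - s)"
        using B0 unfolding distrib_left[symmetric] by (intro mult_left_mono) auto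
      ultimately show ?thesis by linarith
    qed
  qed
  show ?thesis using *[of s t] *[of t s] by (cases "s \<le> t") (auto simp: abs_minus_commute)
qed

section \<open>Splines with periodic coefficients\<close>

lemma periodic_coeffs_mult:
  assumes "periodic_coeffs c"
  shows "c (k + 2 * int n * j) = c k"
proof (induction j rule: int_induct[where k = 0])
  case (step1 i)
  have "c (k + 2 * int n * i + 2 * int n) = c (k + 2 * int n * i)"
    using assms unfolding periodic_coeffs_def by blast
  then show ?case using step1 by (simp add: algebra_simps)
next
  case (step2 i)
  have "c (k + 2 * int n * (i - 1) + 2 * int n) = c (k + 2 * int n * (i - 1))"
    using assms unfolding periodic_coeffs_def by blast
  then show ?case using step2 by (simp add: algebra_simps)
qed simp

lemma periodic_coeffs_bounded:
  assumes "periodic_coeffs c"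
  shows "\<exists>B>0. \<forall>k. \<bar>c k\<bar> \<le> B"
proof -
  have mod: "c k = c (k mod (2 * int n))" for k
    using periodic_coeffs_mult[OF assms, of "k mod (2 * int n)" "k div (2 * int n)"] by simp
  define B where "B = 1 + (\<Sum>k\<in>{0..<2 * int n}. \<bar>c k\<bar>)"
  show ?thesis
  proof (intro exI[of _ B] conjI allI)
    have nn: "0 \<le> (\<Sum>k\<in>{0..<2 * int n}. \<bar>c k\<bar>)" by (intro sum_nonneg) auto
    then show "0 < B" unfolding B_def by linarith
    fix k
    have "\<bar>c (k mod (2 * int n))\<bar> \<le> (\<Sum>k\<in>{0..<2 * int n}. \<bar>c k\<bar>)"
      using n by (intro member_le_sum) auto
    then show "\<bar>c k\<bar> \<le> B" using mod[of k] by (simp add: B_def)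
  qed
qed

lemma periodic_half_diff:
  assumes "periodic_coeffs c"
  shows "periodic_coeffs (half_diff c)"
proof -
  have "c (k + 2 * int n + 1) = c (k + 1)" for k
    using assms unfolding periodic_coeffs_def by (metis add.assoc add.commute)
  then show ?thesis using assms by (simp add: periodic_coeffs_def half_diff_def)
qed

lemma continuous_ramp:
  assumes "periodic_coeffs e"
  shows "continuous_on UNIV (ramp e)"
proof -
  obtain B where "0 < B" "\<And>k. \<bar>e k\<bar> \<le> B" using periodic_coeffs_bounded[OF assms] by blast
  then show ?thesis using ramp_Lipschitz[of e B] by (intro Lipschitz_imp_continuous[of _ B]) auto
qed

lemma DERIV_spl:
  assumes "periodic_coeffs c"
  shows "(spl c has_real_derivative ramp (half_diff c) t) (at t)"
  unfolding spl_def[abs_def]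
  using DERIV_prim[OF continuous_ramp[OF periodic_half_diff[OF assms]], of t]
  by (auto intro!: derivative_eq_intros)

lemma spl_increment:
  assumes c: "periodic_coeffs c" and t: "of_int k * h \<le> t" "t \<le> (of_int k + 1) * h"
  shows "spl c t - spl c (of_int k * h) = half_diff c k * (step (t - (of_int k + 1 / 2) * h) + H)"
proof -
  let ?r = "(of_int k + 1 / 2) * h"
  have "spl c t - spl c (of_int k * h) = half_diff c k * step (t - ?r) - half_diff c k * step (of_int k * h - ?r)"
  proof (rule DERIV_eq_imp_diff_eq_on[OF t(1) DERIV_spl[OF c]])
    fix x assume "of_int k * h \<le> x" "x \<le> t"
    then show "((\<lambda>x. half_diff c k * step (x - ?r)) has_real_derivative ramp (half_diff c) x) (at x)"
      using t ramp_cell[of k x "half_diff c"]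
      by (auto intro!: derivative_eq_intros DERIV_chain2[OF DERIV_step])
  qed
  moreover have "of_int k * h - ?r = - (h / 2)" by (simp add: algebra_simps)
  ultimately show ?thesis by (simp add: step_minus step_half algebra_simps)
qed

lemma spl_node:
  assumes c: "periodic_coeffs c"
  shows "spl c (of_int k * h) = H * c k"
proof -
  have inc: "spl c ((of_int k + 1) * h) - spl c (of_int k * h) = H * c (k + 1) - H * c k" for k
  proof -
    have "(of_int k + 1) * h - (of_int k + 1 / 2) * h = h / 2" by (simp add: algebra_simps)
    then show ?thesis
      using spl_increment[OF c, of k "(of_int k + 1) * h"] h(1)
      by (simp add: step_half half_diff_def algebra_simps)
  qed
  show ?thesis
  proof (induction k rule: int_induct[where k = 0])
    case base
    show ?case using prim_0[OF continuous_ramp[OF periodic_half_diff[OF c]]] by (simp add: spl_def)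
  next
    case (step1 i)
    then show ?case using inc[of i] by simp
  next
    case (step2 i)
    then show ?case using inc[of "i - 1"] by simp
  qed
qed

text \<open>The local formula from which translation, linearity and bounds of splines follow by
  algebra.\<close>

lemma spl_cell:
  assumes c: "periodic_coeffs c" and t: "of_int k * h \<le> t" "t \<le> (of_int k + 1) * h"
  shows "spl c t = H * (c k + c (k + 1)) / 2 + half_diff c k * step (t - (of_int k + 1 / 2) * h)"
  using spl_increment[OF assms] spl_node[OF c, of k] by (simp add: half_diff_def field_simps)

lemma spl_shift:
  assumes c: "periodic_coeffs c"
  shows "spl (\<lambda>k. c (k + j)) t = spl c (t + of_int j * h)"
proof -
  have c': "periodic_coeffs (\<lambda>k. c (k + j))"
    using c unfolding periodic_coeffs_def by (metis add.assoc add.commute)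
  have k: "of_int \<lfloor>t / h\<rfloor> * h \<le> t" "t \<le> (of_int \<lfloor>t / h\<rfloor> + 1) * h"
    using cell_bounds[of t] by auto
  have k': "of_int (\<lfloor>t / h\<rfloor> + j) * h \<le> t + of_int j * h" "t + of_int j * h \<le> (of_int (\<lfloor>t / h\<rfloor> + j) + 1) * h"
    using k by (auto simp: algebra_simps)
  have eq: "t + of_int j * h - (of_int (\<lfloor>t / h\<rfloor> + j) + 1 / 2) * h = t - (of_int \<lfloor>t / h\<rfloor> + 1 / 2) * h"
    by (simp add: algebra_simps)
  have "\<lfloor>t / h\<rfloor> + j + 1 = \<lfloor>t / h\<rfloor> + 1 + j" by simp
  then show ?thesis
    unfolding spl_cell[OF c' k] spl_cell[OF c k', unfolded eq] half_diff_def by (simp only:)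
qed

lemma periodic_continuous_spl:
  assumes c: "periodic_coeffs c"
  shows "periodic_continuous (spl c)"
  unfolding periodic_continuous_def
proof (intro conjI allI)
  show "continuous_on UNIV (spl c)"
    by (rule DERIV_continuous_on[OF has_field_derivative_at_within[OF DERIV_spl[OF c]]])
  fix t
  have "(\<lambda>k. c (k + 2 * int n)) = c" using c by (auto simp: periodic_coeffs_def)
  then show "spl c (t + 2 * pi) = spl c t"
    using spl_shift[OF c, of "2 * int n" t] h(3) by simp
qed

lemma periodic_coeffs_linear:
  "periodic_coeffs c \<Longrightarrow> periodic_coeffs d \<Longrightarrow> periodic_coeffs (\<lambda>k. x * c k + y * d k)"
  by (simp add: periodic_coeffs_def)

lemma spl_linear:
  assumes c: "periodic_coeffs c" and d: "periodic_coeffs d"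
  shows "spl (\<lambda>k. x * c k + y * d k) t = x * spl c t + y * spl d t"
proof -
  have k: "of_int \<lfloor>t / h\<rfloor> * h \<le> t" "t \<le> (of_int \<lfloor>t / h\<rfloor> + 1) * h"
    using cell_bounds[of t] by auto
  show ?thesis
    unfolding spl_cell[OF periodic_coeffs_linear[OF c d, of x y] k] spl_cell[OF c k] spl_cell[OF d k]
    by (simp add: half_diff_def field_simps)
qed

lemma spl_const: "spl (\<lambda>_. x) t = H * x"
proof -
  have k: "of_int \<lfloor>t / h\<rfloor> * h \<le> t" "t \<le> (of_int \<lfloor>t / h\<rfloor> + 1) * h"
    using cell_bounds[of t] by auto
  have "periodic_coeffs (\<lambda>_. x)" by (simp add: periodic_coeffs_def)
  from spl_cell[OF this k] show ?thesis by (simp add: half_diff_def)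
qed

lemma abs_half_diff:
  assumes "\<And>k. \<bar>c k\<bar> \<le> 1"
  shows "\<bar>half_diff c k\<bar> \<le> 1"
  using assms[of k] assms[of "k + 1"] by (auto simp: half_diff_def)

lemma abs_ramp:
  assumes "\<And>k. \<bar>e k\<bar> \<le> 1"
  shows "\<bar>ramp e t\<bar> \<le> N"
proof -
  have "\<bar>ramp e t\<bar> = \<bar>e \<lfloor>t / h\<rfloor>\<bar> * q (a - \<bar>t - (of_int \<lfloor>t / h\<rfloor> + 1 / 2) * h\<bar>)"
    using q_bounds(1) by (simp add: ramp_def abs_mult)
  also have "\<dots> \<le> 1 * N" using assms q_bounds by (intro mult_mono) auto
  finally show ?thesis by simp
qed

lemma abs_spl:
  assumes c: "periodic_coeffs c" and b: "\<And>k. \<bar>c k\<bar> \<le> 1"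
  shows "\<bar>spl c t\<bar> \<le> H"
proof -
  define k where "k = \<lfloor>t / h\<rfloor>"
  define \<sigma> where "\<sigma> = step (t - (of_int k + 1 / 2) * h)"
  have \<sigma>: "\<bar>\<sigma>\<bar> \<le> H" unfolding \<sigma>_def by (rule abs_step)
  have "spl c t = H * (c k + c (k + 1)) / 2 + half_diff c k * \<sigma>"
    unfolding \<sigma>_def by (rule spl_cell[OF c]) (use cell_bounds[of t] in \<open>auto simp: k_def\<close>)
  \<comment> \<open>The weights \<open>(H - \<sigma>) / 2\<close> and
    \<open>(H + \<sigma>) / 2\<close> are nonnegative with sum \<open>H\<close>, so the value is
    \<open>H\<close> times an average of the two coefficients.\<close>
  also have "\<dots> = c k * ((H - \<sigma>) / 2) + c (k + 1) * ((H + \<sigma>) / 2)"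
    by (simp add: half_diff_def field_simps)
  finally have "\<bar>spl c t\<bar> \<le> \<bar>c k\<bar> * ((H - \<sigma>) / 2) + \<bar>c (k + 1)\<bar> * ((H + \<sigma>) / 2)"
    using \<sigma> abs_triangle_ineq[of "c k * ((H - \<sigma>) / 2)" "c (k + 1) * ((H + \<sigma>) / 2)"]
    by (simp add: abs_mult)
  also have "\<dots> \<le> 1 * ((H - \<sigma>) / 2) + 1 * ((H + \<sigma>) / 2)"
    using \<sigma> b by (intro add_mono mult_right_mono) auto
  also have "\<dots> = H" by (simp add: field_simps)
  finally show ?thesis .
qed

end

section \<open>Counting zeros and sign changes\<close>

lemma DERIV_periodic:
  fixes f :: "real \<Rightarrow> real"
  assumes D: "\<And>t. (f has_real_derivative f' t) (at t)" and per: "\<And>t. f (t + c) = f t"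
  shows "f' (t + c) = f' t"
proof -
  have "((\<lambda>t. f (t + c)) has_real_derivative f' (t + c)) (at t)"
    using DERIV_shift[of f "f' (t + c)" t c] D[of "t + c"] by simp
  then have "(f has_real_derivative f' (t + c)) (at t)" by (simp add: per)
  then show ?thesis using D DERIV_unique by blast
qed

text \<open>Points on a circle of length \<open>2 * pi\<close>: the entry with index
  \<open>m\<close> is the first one a period later, so the circle carries \<open>m\<close> of
  them.\<close>

definition cyclic_points :: "nat \<Rightarrow> (nat \<Rightarrow> real) \<Rightarrow> bool" where
  "cyclic_points m t \<longleftrightarrow> (\<forall>i<m. t i < t (Suc i)) \<and> t m = t 0 + 2 * pi"

definition cyclic_zeros :: "nat \<Rightarrow> (real \<Rightarrow> real) \<Rightarrow> bool" where
  "cyclic_zeros m f \<longleftrightarrow> (\<exists>t. cyclic_points m t \<and> (\<forall>i\<le>m. f (t i) = 0))"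

text \<open>Only the sign of \<open>\<sigma>\<close> matters. For a periodic function the signs
  required at the indices 0 and \<open>m\<close> are compatible exactly if \<open>m\<close> is
  even.\<close>

definition cyclic_alternation :: "nat \<Rightarrow> (real \<Rightarrow> real) \<Rightarrow> bool" where
  "cyclic_alternation m f \<longleftrightarrow> (\<exists>\<sigma> t. cyclic_points m t \<and> (\<forall>i\<le>m. 0 < \<sigma> * (-1) ^ i * f (t i)))"

lemma cyclic_points_interlace:
  assumes t: "cyclic_points m t" and m: "0 < m" and s: "\<And>i. i < m \<Longrightarrow> t i < s i \<and> s i < t (Suc i)"
  shows "cyclic_points m (\<lambda>i. if i = m then s 0 + 2 * pi else s i)"
  unfolding cyclic_points_def
proof (intro conjI allI impI)
  fix i assume i: "i < m"
  show "(if i = m then s 0 + 2 * pi else s i) < (if Suc i = m then s 0 + 2 * pi else s (Suc i))"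
  proof (cases "Suc i = m")
    case True
    have "s i < t m" using s[OF i] True by simp
    also have "\<dots> = t 0 + 2 * pi" using t by (simp add: cyclic_points_def)
    also have "\<dots> < s 0 + 2 * pi" using s[OF m] by simp
    finally show ?thesis using True by auto
  next
    case False
    then have "s i < s (Suc i)" using s[OF i] s[of "Suc i"] i by force
    then show ?thesis using False i by simp
  qed
qed (use m in simp)

text \<open>On a circle \<open>m\<close> zeros bound \<open>m\<close> gaps, so Rolle's theorem loses
  none.\<close>

lemma cyclic_zeros_deriv:
  fixes f :: "real \<Rightarrow> real"
  assumes D: "\<And>t. (f has_real_derivative f' t) (at t)" and per: "\<And>t. f (t + 2 * pi) = f t"
    and z: "cyclic_zeros m f" and m: "0 < m"
  shows "cyclic_zeros m f'"
proof -
  obtain t where t: "cyclic_points m t" "\<And>i. i \<le> m \<Longrightarrow> f (t i) = 0"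
    using z by (auto simp: cyclic_zeros_def)
  have "\<exists>s. t i < s \<and> s < t (Suc i) \<and> f' s = 0" if i: "i < m" for i
  proof -
    have "\<exists>s. t i < s \<and> s < t (Suc i) \<and> (f has_real_derivative 0) (at s)"
      using t i D by (intro Rolle) (auto simp: cyclic_points_def real_differentiable_def
          intro!: continuous_at_imp_continuous_on DERIV_isCont)
    then show ?thesis using D DERIV_unique by blast
  qed
  then obtain s where s: "\<And>i. i < m \<Longrightarrow> t i < s i \<and> s i < t (Suc i) \<and> f' (s i) = 0" by metis
  have "f' (s 0 + 2 * pi) = 0"
    using DERIV_periodic[OF D, of "2 * pi" "s 0"] per s[OF m] by simp
  then show ?thesis
    unfolding cyclic_zeros_def using s m
    by (intro exI[of _ "\<lambda>i. if i = m then s 0 + 2 * pi else s i"] conjI cyclic_points_interlace[OF t(1)]) auto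
qed

text \<open>The mean value theorem is applied in each of the \<open>m\<close> gaps; an even
  \<open>m\<close> makes the closing sign consistent.\<close>

lemma cyclic_alternation_deriv:
  fixes f :: "real \<Rightarrow> real"
  assumes D: "\<And>t. (f has_real_derivative f' t) (at t)" and per: "\<And>t. f (t + 2 * pi) = f t"
    and alt: "cyclic_alternation m f" and m: "0 < m" "even m"
  shows "cyclic_alternation m f'"
proof -
  obtain \<sigma> t where t: "cyclic_points m t" "\<And>i. i \<le> m \<Longrightarrow> 0 < \<sigma> * (-1) ^ i * f (t i)"
    using alt by (auto simp: cyclic_alternation_def)
  have "\<exists>s. t i < s \<and> s < t (Suc i) \<and> 0 < - \<sigma> * (-1) ^ i * f' s" if i: "i < m" for i
  proof -
    have lt: "t i < t (Suc i)" using t i by (simp add: cyclic_points_def)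
    obtain s where s: "t i < s" "s < t (Suc i)" "f (t (Suc i)) - f (t i) = (t (Suc i) - t i) * f' s"
      using MVT2[OF lt, of f f'] D by auto
    have "0 < \<sigma> * (-1) ^ i * f (t i)" "0 < \<sigma> * (-1) ^ Suc i * f (t (Suc i))"
      using t(2)[of i] t(2)[of "Suc i"] i by auto
    then have "0 < - \<sigma> * (-1) ^ i * (f (t (Suc i)) - f (t i))" by (simp add: algebra_simps)
    then have "0 < (t (Suc i) - t i) * (- \<sigma> * (-1) ^ i * f' s)" unfolding s(3) by (simp add: algebra_simps)
    then have "0 < - \<sigma> * (-1) ^ i * f' s" by (rule zero_less_mult_pos) (use lt in simp)
    then show ?thesis using s by blast
  qed
  then obtain s where s: "\<And>i. i < m \<Longrightarrow> t i < s i \<and> s i < t (Suc i) \<and> 0 < - \<sigma> * (-1) ^ i * f' (s i)" by metis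
  have "f' (s 0 + 2 * pi) = f' (s 0)"
    using DERIV_periodic[OF D, of "2 * pi" "s 0"] per by simp
  then show ?thesis
    unfolding cyclic_alternation_def using s s[OF m(1)] m
    by (intro exI[of _ "- \<sigma>"] exI[of _ "\<lambda>i. if i = m then s 0 + 2 * pi else s i"] conjI
        cyclic_points_interlace[OF t(1)]) auto
qed

text \<open>The function is negative just after \<open>s\<close> and positive just before
  \<open>t\<close>. At the first zero in between it decreases, so it is positive shortly before, and
  the intermediate value theorem yields a still earlier zero.\<close>

lemma no_two_zeros_if_decreasing_at_zeros:
  fixes w :: "real \<Rightarrow> real"
  assumes D: "\<And>x. (w has_real_derivative w' x) (at x)" and st: "s < t" "w s = 0" "w t = 0"
    and neg: "\<And>x. \<lbrakk>s \<le> x; x \<le> t; w x = 0\<rbrakk> \<Longrightarrow> w' x < 0"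
  shows False
proof -
  have cont: "continuous_on S w" for S
    using D by (auto intro!: continuous_at_imp_continuous_on DERIV_isCont)
  obtain d1 where d1: "d1 > 0" "\<And>e. 0 < e \<Longrightarrow> e < d1 \<Longrightarrow> w (s + e) < w s"
    using DERIV_neg_dec_right[OF D neg[of s]] st by auto
  obtain d2 where d2: "d2 > 0" "\<And>e. 0 < e \<Longrightarrow> e < d2 \<Longrightarrow> w t < w (t - e)"
    using DERIV_neg_dec_left[OF D neg[of t]] st by auto
  define e where "e = min (min d1 d2) (t - s) / 3"
  have e: "0 < e" "e < d1" "e < d2" "s + e < t - e"
    using d1(1) d2(1) st(1) by (auto simp: e_def min_def field_simps)
  have neg1: "w (s + e) < 0" and pos1: "0 < w (t - e)"
    using d1(2)[of e] d2(2)[of e] e st by auto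
  define Z where "Z = {x \<in> {s + e..t - e}. w x = 0}"
  have "Z \<noteq> {}"
    using IVT'[of w "s + e" 0 "t - e"] neg1 pos1 e cont by (auto simp: Z_def)
  have "closed Z" unfolding Z_def
    by (rule continuous_closed_preimage_constant[OF cont]) auto
  then have "compact Z"
    by (rule compact_Int_closed[OF compact_Icc[of "s + e" "t - e"], THEN back_subst[where P = compact]])
      (auto simp: Z_def)
  then obtain z where z: "z \<in> Z" "\<And>x. x \<in> Z \<Longrightarrow> z \<le> x"
    using compact_attains_inf[OF _ \<open>Z \<noteq> {}\<close>] by blast
  have zs: "s + e < z" "z \<le> t - e" "w z = 0"
    using z(1) neg1 by (auto simp: Z_def less_le)
  obtain d where d: "d > 0" "\<And>e. 0 < e \<Longrightarrow> e < d \<Longrightarrow> w z < w (z - e)"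
    using DERIV_neg_dec_left[OF D neg[of z]] zs e by auto
  define e' where "e' = min d (z - (s + e)) / 2"
  have e': "0 < e'" "e' < d" "s + e < z - e'"
    using d(1) zs by (auto simp: e'_def min_def field_simps)
  have "0 < w (z - e')" using d(2)[of e'] e' zs by auto
  then obtain x where x: "s + e \<le> x" "x \<le> z - e'" "w x = 0"
    using IVT'[of w "s + e" 0 "z - e'"] neg1 e' cont by auto
  then have "x \<in> Z" using zs e' by (auto simp: Z_def)
  then show False using z(2) x e' by fastforce
qed

section \<open>Crossings with the alternating spline\<close>

context ramp_spline
begin

text \<open>A period consists of \<open>2 * n\<close> cells anchored at \<open>p\<close>; the cell
  indices of the zeros increase strictly, and by \<open>2 * n\<close> altogether.\<close>

lemma cyclic_zeros_le:
  assumes one: "\<And>s t. \<lbrakk>s < t; f s = 0; f t = 0\<rbrakk> \<Longrightarrow> \<lfloor>(s - p) / h\<rfloor> \<noteq> \<lfloor>(t - p) / h\<rfloor>"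
    and z: "cyclic_zeros m f"
  shows "m \<le> 2 * n"
proof -
  obtain t where t: "cyclic_points m t" "\<And>i. i \<le> m \<Longrightarrow> f (t i) = 0"
    using z by (auto simp: cyclic_zeros_def)
  define j where "j i = \<lfloor>(t i - p) / h\<rfloor>" for i
  have "int i + j 0 \<le> j i" if "i \<le> m" for i
    using that
  proof (induction i)
    case (Suc i)
    have lt: "t i < t (Suc i)" using t(1) Suc by (simp add: cyclic_points_def)
    then have "j i \<le> j (Suc i)"
      unfolding j_def using h(1) by (intro floor_mono divide_right_mono) auto
    moreover have "j i \<noteq> j (Suc i)"
      unfolding j_def using lt t(2)[of i] t(2)[of "Suc i"] Suc.prems by (intro one) auto
    ultimately show ?case using Suc by simp
  qed simp
  then have "int m + j 0 \<le> j m" by simp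
  also have "j m = \<lfloor>(t 0 - p + of_int (2 * int n) * h) / h\<rfloor>"
  proof -
    have "t m - p = t 0 - p + of_int (2 * int n) * h" using t(1) h(3) by (simp add: cyclic_points_def)
    then show ?thesis by (simp only: j_def)
  qed
  also have "\<dots> = j 0 + 2 * int n" unfolding floor_shift by (simp add: j_def)
  finally show ?thesis by simp
qed

text \<open>\<open>spl alt\<close> is the function G of the overview, and
  \<open>smooth_spl p alt\<close>, defined below, is phi.\<close>

definition alt :: "int \<Rightarrow> real" where "alt k = (if even k then 1 else - 1)"

lemma alt: "periodic_coeffs alt" "\<bar>alt k\<bar> = 1" "alt (k + 1) = - alt k" "half_diff alt k = - alt k"
  "alt k * alt k = 1"
  by (auto simp: alt_def periodic_coeffs_def half_diff_def)

lemma spl_alt_antiperiodic: "spl alt (t + h) = - spl alt t"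
proof -
  have "spl alt (t + h) = spl (\<lambda>k. alt (k + 1)) t" using spl_shift[OF alt(1), of 1] by simp
  also have "(\<lambda>k. alt (k + 1)) = (\<lambda>k. (-1) * alt k + 0 * alt k)" using alt(3) by simp
  also have "spl \<dots> t = - spl alt t" by (subst spl_linear[OF alt(1) alt(1)]) simp
  finally show ?thesis .
qed

lemma mean_spl_alt: "mean (spl alt) = 0"
proof -
  note per = periodic_continuous_spl[OF alt(1)]
  have "mean (spl alt) = mean (\<lambda>t. spl alt (t + h))" by (rule mean_shift[OF per, symmetric])
  also have "\<dots> = mean (\<lambda>t. (-1) * spl alt t + 0 * spl alt t)" by (simp add: spl_alt_antiperiodic)
  also have "\<dots> = - mean (spl alt)"
    using per by (subst mean_linear) (auto simp: periodic_continuous_def)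
  finally show ?thesis by simp
qed

text \<open>The zeros of a difference are counted by its crossings with the steep parts of the spline:
  on each of them the spline is strictly steeper than the other function.\<close>
lemma ramp_alt_crossings:
  assumes full: "2 * a = h" and y: "\<And>t. \<bar>y t\<bar> < N"
    and lip: "\<And>s t. \<bar>y s - y t\<bar> \<le> \<mu> * \<bar>s - t\<bar>" and \<mu>: "\<mu> < 1"
    and st: "s < t" "y s = ramp (half_diff alt) s" "y t = ramp (half_diff alt) t"
  shows "\<lfloor>(s - h / 2) / h\<rfloor> \<noteq> \<lfloor>(t - h / 2) / h\<rfloor>"
proof
  assume eq: "\<lfloor>(s - h / 2) / h\<rfloor> = \<lfloor>(t - h / 2) / h\<rfloor>"
  define k where "k = \<lfloor>(s - h / 2) / h\<rfloor>"
  define m where "m = (of_int k + 1) * h"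
  \<comment> \<open>Since \<open>\<bar>y x\<bar> < N\<close>, a meeting point is not on a plateau of
    the ramp. As \<open>2 * a = h\<close>, the slopes on both sides of the node \<open>m\<close>
    form one line; the cells are shifted by \<open>h / 2\<close> so that each contains one such
    line.\<close>
  have *: "y x = alt k * (x - m)" if x: "y x = ramp (half_diff alt) x" "\<lfloor>(x - h / 2) / h\<rfloor> = k" for x
  proof -
    have b: "m - h / 2 \<le> x" "x \<le> m + h / 2"
      using cell_bounds[of "x - h / 2"] x(2) by (auto simp: m_def algebra_simps)
    have qq: "q v = v" if "q v < N" "0 \<le> v" for v using that by (auto simp: q_def)
    show ?thesis
    proof (cases "x \<le> m")
      case True
      have "ramp (half_diff alt) x = half_diff alt k * q (a - \<bar>x - (of_int k + 1 / 2) * h\<bar>)"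
        by (rule ramp_cell) (use b True in \<open>auto simp: m_def algebra_simps\<close>)
      also have "a - \<bar>x - (of_int k + 1 / 2) * h\<bar> = m - x"
        using b True full by (simp add: m_def algebra_simps)
      finally have r: "y x = - alt k * q (m - x)" using x alt(4)[of k] by simp
      then have "\<bar>y x\<bar> = q (m - x)" using q_bounds(1) by (simp add: abs_mult alt)
      then have qm: "q (m - x) = m - x" using y[of x] True by (intro qq) auto
      show ?thesis unfolding r qm by (simp add: algebra_simps)
    next
      case False
      have "ramp (half_diff alt) x = half_diff alt (k + 1) * q (a - \<bar>x - (of_int (k + 1) + 1 / 2) * h\<bar>)"
        by (rule ramp_cell) (use b False h(1) in \<open>auto simp: m_def algebra_simps\<close>)
      also have "a - \<bar>x - (of_int (k + 1) + 1 / 2) * h\<bar> = x - m"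
        using b False full by (simp add: m_def algebra_simps)
      finally have r: "y x = alt k * q (x - m)" using x alt(4)[of "k + 1"] alt(3)[of k] by simp
      then have "\<bar>y x\<bar> = q (x - m)" using q_bounds(1) by (simp add: abs_mult alt)
      then have "q (x - m) = x - m" using y[of x] False by (intro qq) auto
      then show ?thesis using r by simp
    qed
  qed
  have "y s - y t = alt k * (s - t)"
    using *[OF st(2)] *[OF st(3)] eq by (simp add: k_def algebra_simps)
  then have "\<bar>y s - y t\<bar> = t - s" using st(1) by (simp add: abs_mult alt)
  then have "t - s \<le> \<mu> * (t - s)" using lip[of s t] st(1) by simp
  moreover have "\<mu> * (t - s) < 1 * (t - s)" using st(1) \<mu> by (intro mult_strict_right_mono) auto
  ultimately show False by simp
qed

text \<open>A function below \<open>H\<close> with these bounds on its derivatives that meets the final parabola or ramp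
  of \<open>step\<close> at least as steeply would overshoot \<open>H\<close>.\<close>
lemma step_steeper:
  assumes D: "\<And>t. (y has_real_derivative y' t) (at t)" and y: "\<And>t. \<bar>y t\<bar> < H"
    and y': "\<And>t. \<bar>y' t\<bar> < N" and lip: "\<And>s t. \<bar>y' s - y' t\<bar> \<le> \<bar>s - t\<bar>"
    and s: "y s = step (s - r)"
  shows "y' s < q (a - \<bar>s - r\<bar>)"
proof -
  have *: "y' s < q (a - (s - r))"
    if D: "\<And>t. (y has_real_derivative y' t) (at t)" and y: "\<And>t. \<bar>y t\<bar> < H"
      and y': "\<And>t. \<bar>y' t\<bar> < N" and lip: "\<And>s t. \<bar>y' s - y' t\<bar> \<le> \<bar>s - t\<bar>"
      and s: "y s = step (s - r)" and sr: "r \<le> s" for y y' s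
  proof -
    define v where "v = a - (s - r)"
    have ys: "y s = H - Q v" using s step_eq[of "s - r"] sr by (simp add: v_def)
    then have "Q v \<noteq> 0" using y[of s] by auto
    then have v: "0 < v" using Q_nonpos[of v] by force
    show ?thesis
    proof (cases "v \<le> N")
      case False
      then have "q v = N" using v by (simp add: q_def)
      then show ?thesis using y'[of s] by (simp add: v_def)
    next
      case True
      then have q: "q v = v" using v by (simp add: q_def)
      show ?thesis
      proof (rule ccontr)
        assume "\<not> y' s < q (a - (s - r))"
        then have y's: "v \<le> y' s" using q by (simp add: v_def)
        \<comment> \<open>Starting with slope at least \<open>v\<close> and losing slope at rate at
          most 1, \<open>y\<close> gains at least \<open>v\<^sup>2 / 2\<close>, which is
          \<open>Q v\<close>, on the way to \<open>s + v\<close>.\<close>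
        define g where "g x = y (s + x) - v * x + x\<^sup>2 / 2" for x
        have "g 0 \<le> g v"
        proof (rule DERIV_nonneg_imp_nondecreasing[of 0 v g])
          fix x assume x: "0 \<le> x" "x \<le> v"
          have "(g has_real_derivative y' (s + x) - v + x) (at x)"
            unfolding g_def[abs_def] by (auto intro!: derivative_eq_intros DERIV_chain2[OF D])
          moreover have "0 \<le> y' (s + x) - v + x" using lip[of "s + x" s] y's x by simp
          ultimately show "\<exists>z. (g has_real_derivative z) (at x) \<and> 0 \<le> z" by blast
        qed (use v in simp)
        then have "y s + v\<^sup>2 / 2 \<le> y (s + v)" by (simp add: g_def power2_eq_square)
        moreover have "Q v = v\<^sup>2 / 2" using True v by (intro Q_square) auto
        ultimately have "H \<le> y (s + v)" using ys by simp
        then show False using y[of "s + v"] by simp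
      qed
    qed
  qed
  show ?thesis
  proof (cases "r \<le> s")
    case True
    then show ?thesis using *[OF D y y' lip s] by simp
  next
    case False
    \<comment> \<open>The case \<open>s < r\<close> is reflected at \<open>r\<close>, with the sign
      of \<open>y\<close> reversed because \<open>step\<close> is odd.\<close>
    have "y' (2 * r - (2 * r - s)) < q (a - ((2 * r - s) - r))"
    proof (rule *[where y = "\<lambda>t. - y (2 * r - t)" and y' = "\<lambda>t. y' (2 * r - t)"])
      show "((\<lambda>t. - y (2 * r - t)) has_real_derivative y' (2 * r - t)) (at t)" for t
        by (auto intro!: derivative_eq_intros DERIV_chain2[OF D])
      show "- y (2 * r - (2 * r - s)) = step (2 * r - s - r)"
        using s step_minus[of "s - r"] by simp
      show "\<bar>y' (2 * r - s) - y' (2 * r - t)\<bar> \<le> \<bar>s - t\<bar>" for s t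
        using lip[of "2 * r - s" "2 * r - t"] by simp
    qed (use y y' False in auto)
    then show ?thesis using False by simp
  qed
qed

text \<open>On one cell \<open>spl alt\<close> is \<open>- alt k\<close> times a translate of
  \<open>step\<close>. After multiplication by \<open>- alt k\<close> the difference decreases at
  each of its zeros there, by \<open>step_steeper\<close>, so it has at most one.\<close>

lemma spl_alt_crossings:
  assumes D: "\<And>t. (y has_real_derivative y' t) (at t)" and y: "\<And>t. \<bar>y t\<bar> < H"
    and y': "\<And>t. \<bar>y' t\<bar> < N" and lip: "\<And>s t. \<bar>y' s - y' t\<bar> \<le> \<bar>s - t\<bar>"
    and st: "s < t" "y s = spl alt s" "y t = spl alt t"
  shows "\<lfloor>s / h\<rfloor> \<noteq> \<lfloor>t / h\<rfloor>"
proof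
  assume eq: "\<lfloor>s / h\<rfloor> = \<lfloor>t / h\<rfloor>"
  define k where "k = \<lfloor>s / h\<rfloor>"
  define r where "r = (of_int k + 1 / 2) * h"
  define w where "w x = - alt k * y x - step (x - r)" for x
  have spl: "spl alt x = - alt k * step (x - r)" if "of_int k * h \<le> x" "x \<le> (of_int k + 1) * h" for x
    using spl_cell[OF alt(1) that] by (simp add: alt r_def)
  have cell: "of_int k * h \<le> x" "x \<le> (of_int k + 1) * h" if "s \<le> x" "x \<le> t" for x
    using that cell_bounds[of s] cell_bounds[of t] eq by (auto simp: k_def)
  have w0: "w x = 0" if "y x = spl alt x" "s \<le> x" "x \<le> t" for x
    using that spl[OF cell[OF that(2,3)]] alt(5)[of k] by (simp add: w_def flip: mult.assoc)
  show False
  proof (rule no_two_zeros_if_decreasing_at_zeros[of w _ s t])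
    show "(w has_real_derivative - alt k * y' x - q (a - \<bar>x - r\<bar>)) (at x)" for x
      unfolding w_def[abs_def] by (auto intro!: derivative_eq_intros DERIV_chain2[OF DERIV_step] D)
    show "- alt k * y' x - q (a - \<bar>x - r\<bar>) < 0" if "w x = 0" for x
    proof -
      have "- alt k * y' x < q (a - \<bar>x - r\<bar>)"
      proof (rule step_steeper[where y = "\<lambda>x. - alt k * y x" and y' = "\<lambda>x. - alt k * y' x"])
        show "((\<lambda>x. - alt k * y x) has_real_derivative - alt k * y' t) (at t)" for t
          by (auto intro!: derivative_eq_intros D)
        show "\<bar>- alt k * y' s - - alt k * y' t\<bar> \<le> \<bar>s - t\<bar>" for s t
          using lip[of s t] alt(2)[of k] by (simp add: abs_mult flip: right_diff_distrib)
      qed (use y y' that in \<open>auto simp: abs_mult alt w_def\<close>)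
      then show ?thesis by simp
    qed
  qed (use st w0 in auto)
qed

end

section \<open>Functions vanishing at the uniform nodes\<close>

lemma smooth_tower_periodic:
  assumes "smooth_tower p D" "k \<le> Suc p"
  shows "D k (t + 2 * pi) = D k t"
  using assms(2)
proof (induction k arbitrary: t)
  case (Suc k)
  show ?case
    by (rule DERIV_periodic[of "D k"]) (use assms(1) Suc in \<open>auto simp: smooth_tower_def\<close>)
qed (use assms in \<open>simp add: smooth_tower_def\<close>)

lemma periodic_continuous_attains_sup:
  assumes "periodic_continuous f"
  obtains t where "\<And>s. \<bar>f s\<bar> \<le> \<bar>f t\<bar>"
proof -
  have cont: "continuous_on UNIV f" and per: "\<And>t. f (t + 2 * pi) = f t"
    using assms by (auto simp: periodic_continuous_def)
  interpret periodic_fun_simple f "2 * pi" by unfold_locales (rule per)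
  have "continuous_on {0..2 * pi} (\<lambda>t. \<bar>f t\<bar>)"
    by (intro continuous_intros continuous_on_subset[OF cont]) auto
  then obtain t where t: "\<And>s. s \<in> {0..2 * pi} \<Longrightarrow> \<bar>f s\<bar> \<le> \<bar>f t\<bar>"
    using continuous_attains_sup[of "{0..2 * pi}" "\<lambda>t. \<bar>f t\<bar>"] by fastforce
  show thesis
  proof (rule that)
    fix s
    define j where "j = \<lfloor>s / (2 * pi)\<rfloor>"
    have "of_int j \<le> s / (2 * pi)" "s / (2 * pi) < of_int j + 1"
      using floor_correct[of "s / (2 * pi)"] by (auto simp: j_def)
    then have "s - of_int j * (2 * pi) \<in> {0..2 * pi}"
      by (auto simp: field_simps)
    from t[OF this] show "\<bar>f s\<bar> \<le> \<bar>f t\<bar>" by (simp add: minus_of_int)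
  qed
qed

context ramp_spline
begin

definition smooth_spl :: "nat \<Rightarrow> (int \<Rightarrow> real) \<Rightarrow> real \<Rightarrow> real" where
  "smooth_spl p c = (pint ^^ p) (spl c)"

lemma periodic_continuous_smooth_spl:
  "periodic_coeffs c \<Longrightarrow> periodic_continuous (smooth_spl p c)"
  unfolding smooth_spl_def by (intro periodic_continuous_pint_funpow periodic_continuous_spl)

lemma smooth_spl_linear:
  assumes "periodic_coeffs c" "periodic_coeffs d"
  shows "smooth_spl p (\<lambda>k. x * c k + y * d k) t = x * smooth_spl p c t + y * smooth_spl p d t"
proof -
  have "spl (\<lambda>k. x * c k + y * d k) = (\<lambda>t. x * spl c t + y * spl d t)"
    using assms by (intro ext spl_linear)
  then show ?thesis
    unfolding smooth_spl_def using assms by (simp add: pint_funpow_linear periodic_continuous_spl)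
qed

lemma smooth_spl_shift:
  assumes "periodic_coeffs c"
  shows "smooth_spl p (\<lambda>k. c (k + j)) t = smooth_spl p c (t + of_int j * h)"
proof -
  have "spl (\<lambda>k. c (k + j)) = (\<lambda>t. spl c (t + of_int j * h))"
    using assms by (intro ext spl_shift)
  then show ?thesis
    unfolding smooth_spl_def using assms by (simp add: pint_funpow_shift periodic_continuous_spl)
qed

lemma smooth_spl_const: "smooth_spl p (\<lambda>_. x) t = H * x"
proof -
  have "spl (\<lambda>_. x) = (\<lambda>_. H * x)" by (intro ext spl_const)
  then show ?thesis by (simp add: smooth_spl_def pint_funpow_const)
qed

lemma smooth_spl_alt_shift: "smooth_spl p alt (t + of_int j * h) = alt j * smooth_spl p alt t"
proof -
  have "smooth_spl p alt (t + of_int j * h) = smooth_spl p (\<lambda>k. alt (k + j)) t"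
    by (rule smooth_spl_shift[OF alt(1), symmetric])
  also have "(\<lambda>k. alt (k + j)) = (\<lambda>k. alt j * alt k + 0 * alt k)"
    by (auto simp: alt_def)
  also have "smooth_spl p \<dots> t = alt j * smooth_spl p alt t"
    by (subst smooth_spl_linear[OF alt(1) alt(1)]) simp
  finally show ?thesis .
qed

lemma smooth_spl_alt_zero: "\<exists>z. smooth_spl p alt z = 0"
proof -
  let ?\<phi> = "smooth_spl p alt"
  have c: "continuous_on {0..h} ?\<phi>"
    using periodic_continuous_smooth_spl[OF alt(1), of p] continuous_on_subset
    unfolding periodic_continuous_def by blast
  have "?\<phi> h = - ?\<phi> 0" using smooth_spl_alt_shift[of p 0 1] by (simp add: alt_def)
  then consider "?\<phi> 0 \<le> 0" "0 \<le> ?\<phi> h" | "?\<phi> h \<le> 0" "0 \<le> ?\<phi> 0" by linarith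
  then show ?thesis
    using IVT'[of ?\<phi> 0 0 h, OF _ _ _ c] IVT2'[of ?\<phi> h 0 0, OF _ _ _ c] h(1) by cases auto
qed

lemma bound_if_vanishes_at_nodes:
  assumes T: "smooth_tower p D" and D1: "\<And>t. \<bar>D (Suc p) t\<bar> \<le> N" and D0: "\<And>t. \<bar>D p t\<bar> \<le> M"
    and MH: "M = H \<or> 2 * a = h" and zero: "\<And>k :: int. D 0 (of_int k * h) = 0"
    and e: "\<And>t. \<bar>smooth_spl p alt t\<bar> \<le> e"
  shows "\<bar>D 0 t\<bar> \<le> e"
proof (rule ccontr)
  define t0 where "t0 = t"
  assume "\<not> \<bar>D 0 t\<bar> \<le> e"
  then have gt: "e < \<bar>D 0 t0\<bar>" by (simp add: t0_def)
  let ?G = "spl alt"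
  have G: "periodic_continuous ?G" by (intro periodic_continuous_spl alt)
  have e0: "0 \<le> e" using e[of 0] by linarith
  \<comment> \<open>phi changes sign under translation by \<open>h\<close>, so its translate by a
    zero \<open>z\<close> vanishes at every node.\<close>
  obtain z where z: "smooth_spl p alt z = 0" using smooth_spl_alt_zero by blast
  \<comment> \<open>The factor makes the difference vanish at \<open>t0\<close> too; its modulus is
    below 1 because \<open>\<bar>D 0 t0\<bar>\<close> exceeds \<open>e\<close>.\<close>
  define l where "l = smooth_spl p alt (t0 + z) / D 0 t0"
  have l: "\<bar>l\<bar> < 1" using e[of "t0 + z"] gt e0 by (simp add: l_def abs_divide)
  define f where "f k t = l * D k t - pint_tower p ?G k (t + z)" for k t
  have f0: "f 0 t = l * D 0 t - smooth_spl p alt (t + z)" for t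
    by (simp add: f_def pint_tower_def smooth_spl_def)
  have f0_node: "f 0 (of_int k * h) = 0" for k :: int
    using zero[of k] smooth_spl_alt_shift[of p z k] z by (simp add: f0 add.commute)
  have f0_t0: "f 0 t0 = 0" using gt e0 by (simp add: f0 l_def)
  have Df: "(f k has_real_derivative f (Suc k) t) (at t)" if "k < p" for k t
  proof -
    have "((\<lambda>t. pint_tower p ?G k (t + z)) has_real_derivative pint_tower p ?G (Suc k) (t + z)) (at t)"
      using DERIV_pint_tower[OF G that, of "t + z"] by (simp add: DERIV_shift)
    moreover have "(D k has_real_derivative D (Suc k) t) (at t)"
      using T that by (simp add: smooth_tower_def)
    ultimately show ?thesis unfolding f_def[abs_def] by (auto intro!: derivative_eq_intros)
  qed
  have per: "f k (t + 2 * pi) = f k t" if "k \<le> p" for k t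
  proof -
    have "(pint ^^ (p - k)) ?G (t + z + 2 * pi) = (pint ^^ (p - k)) ?G (t + z)"
      using periodic_continuous_pint_funpow[OF G] by (simp add: periodic_continuous_def)
    moreover have "t + 2 * pi + z = t + z + 2 * pi" by simp
    ultimately show ?thesis
      using smooth_tower_periodic[OF T, of k] that by (simp only: f_def pint_tower_def)
  qed
  have Z0: "cyclic_zeros (2 * n + 1) (f 0)"
  proof -
    define k where "k = \<lfloor>t0 / h\<rfloor>"
    have b: "of_int k * h \<le> t0" "t0 < (of_int k + 1) * h"
      using cell_bounds[of t0] by (auto simp: k_def)
    have "t0 \<noteq> of_int k * h" using zero[of k] gt e0 by auto
    \<comment> \<open>\<open>t0\<close> is inserted after the node \<open>k * h\<close>; an index
      \<open>i \<ge> 2\<close> then denotes the node with number \<open>k + i - 1\<close>, and the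
      index \<open>2 * n + 1\<close> is the first node a period later.\<close>
    define \<tau> where "\<tau> i = (if i = 0 then of_int k * h else if i = 1 then t0 else of_int (k + int i - 1) * h)" for i :: nat
    have "cyclic_points (2 * n + 1) \<tau>"
      unfolding cyclic_points_def
    proof (intro conjI allI impI)
      fix i :: nat
      consider "i = 0" | "i = 1" | "2 \<le> i" by linarith
      then show "\<tau> i < \<tau> (Suc i)"
        using b \<open>t0 \<noteq> of_int k * h\<close> h(1) by cases (auto simp: \<tau>_def add.commute intro!: mult_strict_right_mono)
    next
      show "\<tau> (2 * n + 1) = \<tau> 0 + 2 * pi"
        using n h(3) by (simp add: \<tau>_def algebra_simps)
    qed
    moreover have "f 0 (\<tau> i) = 0" for i using f0_node f0_t0 by (simp add: \<tau>_def del: of_int_add of_int_diff)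
    ultimately show ?thesis unfolding cyclic_zeros_def by blast
  qed
  have Z: "cyclic_zeros (2 * n + 1) (f k)" if "k \<le> p" for k
    using that
  proof (induction k)
    case (Suc k)
    then show ?case by (intro cyclic_zeros_deriv[OF Df per]) auto
  qed (use Z0 in simp)
  have fp: "f p t = l * D p t - ?G (t + z)" for t
    by (simp add: f_def pint_tower_def mean_spl_alt)
  have Dp: "(D p has_real_derivative D (Suc p) t) (at t)" for t
    using T by (simp add: smooth_tower_def)
  have lip: "\<bar>l * D (Suc p) s - l * D (Suc p) t\<bar> \<le> \<bar>l\<bar> * \<bar>s - t\<bar>" for s t
  proof -
    have "\<bar>D (Suc p) s - D (Suc p) t\<bar> \<le> \<bar>s - t\<bar>" using T by (simp add: smooth_tower_def)
    then show ?thesis by (simp add: abs_mult mult_left_mono flip: right_diff_distrib)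
  qed
  have D1': "\<bar>l * D (Suc p) t\<bar> < N" for t
  proof -
    have "\<bar>l * D (Suc p) t\<bar> \<le> \<bar>l\<bar> * N" using D1[of t] by (simp add: abs_mult mult_left_mono)
    also have "\<dots> < 1 * N" using l N by (intro mult_strict_right_mono)
    finally show ?thesis by simp
  qed
  \<comment> \<open>For \<open>M = H\<close> the functions are compared at level \<open>p\<close>.
    In the other case \<open>D p\<close> may exceed \<open>H\<close>, but the bumps fill the cells,
    and the ramps can be compared after one more use of Rolle's theorem.\<close>
  have "2 * n + 1 \<le> 2 * n"
    using MH
  proof
    assume "M = H"
    show ?thesis
    proof (rule cyclic_zeros_le[OF _ Z[OF order_refl], of "- z"])
      fix s t assume st: "s < t" "f p s = 0" "f p t = 0"
      have "\<lfloor>(s + z) / h\<rfloor> \<noteq> \<lfloor>(t + z) / h\<rfloor>"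
      proof (rule spl_alt_crossings[where y = "\<lambda>x. l * D p (x - z)" and y' = "\<lambda>x. l * D (Suc p) (x - z)"])
        show "((\<lambda>x. l * D p (x - z)) has_real_derivative l * D (Suc p) (x - z)) (at x)" for x
          by (auto intro!: derivative_eq_intros DERIV_chain2[OF Dp])
        show "\<bar>l * D p (x - z)\<bar> < H" for x
        proof -
          have "\<bar>l * D p (x - z)\<bar> \<le> \<bar>l\<bar> * H"
            using D0[of "x - z"] \<open>M = H\<close> by (simp add: abs_mult mult_left_mono)
          also have "\<dots> < 1 * H" using l H_pos by (intro mult_strict_right_mono)
          finally show ?thesis by simp
        qed
        show "\<bar>l * D (Suc p) (s - z) - l * D (Suc p) (t - z)\<bar> \<le> \<bar>s - t\<bar>" for s t
        proof -
          have "\<bar>l\<bar> * \<bar>s - t\<bar> \<le> 1 * \<bar>s - t\<bar>" using l by (intro mult_right_mono) auto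
          then show ?thesis using lip[of "s - z" "t - z"] by simp
        qed
      qed (use st D1' fp in auto)
      then show "\<lfloor>(s - - z) / h\<rfloor> \<noteq> \<lfloor>(t - - z) / h\<rfloor>" by simp
    qed
  next
    assume full: "2 * a = h"
    let ?V = "ramp (half_diff alt)"
    define f' where "f' t = l * D (Suc p) t - ?V (t + z)" for t
    have Dfp: "(f p has_real_derivative f' t) (at t)" for t
      unfolding fp[abs_def] f'_def
      by (auto intro!: derivative_eq_intros DERIV_chain2[OF DERIV_spl[OF alt(1)]] Dp)
    have Z': "cyclic_zeros (2 * n + 1) f'"
      by (rule cyclic_zeros_deriv[OF Dfp per[OF order_refl] Z[OF order_refl]]) simp
    show ?thesis
    proof (rule cyclic_zeros_le[OF _ Z', of "h / 2 - z"])
      fix s t assume st: "s < t" "f' s = 0" "f' t = 0"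
      have "\<lfloor>(s + z - h / 2) / h\<rfloor> \<noteq> \<lfloor>(t + z - h / 2) / h\<rfloor>"
      proof (rule ramp_alt_crossings[OF full, where y = "\<lambda>x. l * D (Suc p) (x - z)" and \<mu> = "\<bar>l\<bar>"])
        show "\<bar>l * D (Suc p) (s - z) - l * D (Suc p) (t - z)\<bar> \<le> \<bar>l\<bar> * \<bar>s - t\<bar>" for s t
          using lip[of "s - z" "t - z"] by simp
      qed (use st D1' l in \<open>auto simp: f'_def\<close>)
      then show "\<lfloor>(s - (h / 2 - z)) / h\<rfloor> \<noteq> \<lfloor>(t - (h / 2 - z)) / h\<rfloor>"
        by (simp add: algebra_simps)
    qed
  qed
  then show False by simp
qed

end

section \<open>Functions vanishing at arbitrary nodes\<close>

text \<open>A cyclic shift of \<open>m\<close> columns is a product of \<open>m - 1\<close>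
  transpositions.\<close>

lemma det_rotate_cols:
  fixes A :: "'a :: comm_ring_1 mat"
  assumes A: "A \<in> carrier_mat m m" and m: "0 < m"
  shows "det (mat m m (\<lambda>(i, j). A $$ (i, Suc j mod m))) = (- 1) ^ (m - 1) * det A"
proof -
  have "det A = (- 1) ^ (1 * (m - 1)) *
      det (mat m m (\<lambda>(i, j). A $$ (i, if j < 0 then j else if j < 0 + (m - 1) then j + 1 else j - (m - 1))))"
    using m by (intro det_swap_final_cols[OF A]) simp
  also have "mat m m (\<lambda>(i, j). A $$ (i, if j < 0 then j else if j < 0 + (m - 1) then j + 1 else j - (m - 1))) =
      mat m m (\<lambda>(i, j). A $$ (i, Suc j mod m))"
  proof (rule cong_mat)
    fix i j assume "i < m" "j < m"
    then have "(if j < 0 then j else if j < 0 + (m - 1) then j + 1 else j - (m - 1)) = Suc j mod m"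
      by (cases "Suc j = m") auto
    then show "(case (i, j) of (i, j) \<Rightarrow> A $$ (i, if j < 0 then j else if j < 0 + (m - 1) then j + 1 else j - (m - 1))) =
        (case (i, j) of (i, j) \<Rightarrow> A $$ (i, Suc j mod m))" by simp
  qed auto
  finally have "det A = (- 1) ^ (m - 1) * det (mat m m (\<lambda>(i, j). A $$ (i, Suc j mod m)))" by simp
  then have "(- 1) ^ (m - 1) * det A = ((- 1) ^ (m - 1) * (- 1) ^ (m - 1)) * det (mat m m (\<lambda>(i, j). A $$ (i, Suc j mod m)))"
    by (simp only: mult.assoc)
  then show ?thesis by (simp flip: power_mult_distrib)
qed

text \<open>By the Leibniz formula the determinant is a polynomial in the entries.\<close>

lemma continuous_on_det:
  fixes f :: "nat \<Rightarrow> nat \<Rightarrow> 'a :: topological_space \<Rightarrow> real"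
  assumes "\<And>i j. \<lbrakk>i < m; j < m\<rbrakk> \<Longrightarrow> continuous_on S (\<lambda>x. f i j x)"
  shows "continuous_on S (\<lambda>x. det (mat m m (\<lambda>(i, j). f i j x)))"
proof -
  have less: "\<pi> i < m" if "\<pi> permutes {0..<m}" "i < m" for \<pi> i
    using permutes_in_image[OF that(1), of i] that(2) by simp
  have det: "det (mat m m (\<lambda>(i, j). f i j x)) =
      (\<Sum>\<pi> | \<pi> permutes {0..<m}. signof \<pi> * (\<Prod>i = 0..<m. f i (\<pi> i) x))" for x
  proof -
    have "det (mat m m (\<lambda>(i, j). f i j x)) = (\<Sum>\<pi> | \<pi> permutes {0..<m}. signof \<pi> *
        (\<Prod>i = 0..<m. mat m m (\<lambda>(i, j). f i j x) $$ (i, \<pi> i)))"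
      by (rule det_def') simp
    also have "\<dots> = (\<Sum>\<pi> | \<pi> permutes {0..<m}. signof \<pi> * (\<Prod>i = 0..<m. f i (\<pi> i) x))"
      by (intro sum.cong prod.cong refl arg_cong2[where f = "(*)"]) (auto simp: less)
    finally show ?thesis .
  qed
  show ?thesis
    unfolding det
    by (intro continuous_on_sum continuous_on_mult continuous_on_const continuous_on_prod assms) (auto simp: less)
qed

section \<open>A spline with 2n prescribed zeros\<close>

context ramp_spline
begin

text \<open>These give the basis functions of the spline space that a translation by
  \<open>h\<close> permutes.\<close>

definition unit_coeffs :: "nat \<Rightarrow> int \<Rightarrow> real" where
  "unit_coeffs k j = (if j mod (2 * int n) = int k then 1 else 0)"

lemma periodic_unit_coeffs: "periodic_coeffs (unit_coeffs k)"
  by (simp add: periodic_coeffs_def unit_coeffs_def)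

lemma unit_coeffs_shift:
  assumes "k < 2 * n"
  shows "unit_coeffs k (j - 1) = unit_coeffs (Suc k mod (2 * n)) j"
proof -
  have "(j - 1) mod (2 * int n) = int k \<longleftrightarrow> j mod (2 * int n) = int (Suc k mod (2 * n))"
  proof -
    have "(j - 1) mod (2 * int n) = int k \<longleftrightarrow> (j - 1) mod (2 * int n) = int k mod (2 * int n)"
      using assms by simp
    also have "\<dots> \<longleftrightarrow> j mod (2 * int n) = (int k + 1) mod (2 * int n)"
      by (simp add: mod_eq_dvd_iff algebra_simps)
    also have "(int k + 1) mod (2 * int n) = int (Suc k mod (2 * n))"
      by (simp add: zmod_int algebra_simps)
    finally show ?thesis .
  qed
  then show ?thesis by (simp add: unit_coeffs_def)
qed

lemma smooth_spl_sum_unit_coeffs: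
  assumes "finite K"
  shows "smooth_spl p (\<lambda>j. \<Sum>k\<in>K. v k * unit_coeffs k j) t = (\<Sum>k\<in>K. v k * smooth_spl p (unit_coeffs k) t)"
  using assms
proof (induction K)
  case empty
  show ?case using smooth_spl_const[of p 0 t] by simp
next
  case (insert x K)
  have per: "periodic_coeffs (\<lambda>j. \<Sum>k\<in>K. v k * unit_coeffs k j)"
    using periodic_unit_coeffs by (simp add: periodic_coeffs_def)
  show ?case
    using insert smooth_spl_linear[OF periodic_unit_coeffs per, of p "v x" x 1 t] by simp
qed

text \<open>Translating the spline space by a full step \<open>h\<close> permutes its basis cyclically; an even cycle is
  odd, so the determinant of the evaluation matrix changes sign and vanishes for some translate.\<close>
lemma spline_vanishing_exists:
  fixes u :: "real list"
  assumes u: "length u = 2 * n"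
  obtains c \<alpha> where "periodic_coeffs c" "\<exists>k. c k \<noteq> 0" "\<And>t. t \<in> set u \<Longrightarrow> smooth_spl p c (t - \<alpha>) = 0"
proof -
  define m where "m = 2 * n"
  have m: "0 < m" using n by (simp add: m_def)
  define E where "E k = smooth_spl p (unit_coeffs k)" for k
  define A where "A \<alpha> = mat m m (\<lambda>(i, k). E k (u ! i - \<alpha>))" for \<alpha>
  have A: "A \<alpha> \<in> carrier_mat m m" for \<alpha> by (simp add: A_def)
  have shift: "E k (t - h) = E (Suc k mod m) t" if "k < m" for k t
  proof -
    have "E k (t - h) = smooth_spl p (\<lambda>j. unit_coeffs k (j + (-1))) t"
      using smooth_spl_shift[OF periodic_unit_coeffs, of p k "-1" t] by (simp add: E_def)
    also have "(\<lambda>j. unit_coeffs k (j + (-1))) = unit_coeffs (Suc k mod m)"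
      using unit_coeffs_shift[of k] that by (auto simp: m_def)
    finally show ?thesis by (simp add: E_def)
  qed
  have "A (\<alpha> + h) = mat m m (\<lambda>(i, j). A \<alpha> $$ (i, Suc j mod m))" for \<alpha>
  proof (unfold A_def, rule cong_mat)
    fix i j assume ij: "i < m" "j < m"
    have "E j (u ! i - (\<alpha> + h)) = E (Suc j mod m) (u ! i - \<alpha>)"
      using shift[OF ij(2), of "u ! i - \<alpha>"] by (simp add: algebra_simps)
    then show "(case (i, j) of (i, k) \<Rightarrow> E k (u ! i - (\<alpha> + h))) =
       (case (i, j) of (i, j) \<Rightarrow> mat m m (\<lambda>(i, k). E k (u ! i - \<alpha>)) $$ (i, Suc j mod m))"
      using ij m by simp
  qed auto
  then have "det (A (\<alpha> + h)) = (- 1) ^ (m - 1) * det (A \<alpha>)" for \<alpha>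
    using det_rotate_cols[OF A m, of \<alpha>] by simp
  moreover have "odd (m - 1)" using n by (simp add: m_def)
  ultimately have dneg: "det (A h) = - det (A 0)"
    by (metis add_0 mult_minus1 uminus_power_if power_one)
  have cont: "continuous_on {0..h} (\<lambda>\<alpha>. det (A \<alpha>))"
    unfolding A_def
  proof (rule continuous_on_det)
    fix i k
    have "continuous_on UNIV (E k)"
      using periodic_continuous_smooth_spl[OF periodic_unit_coeffs] by (simp add: periodic_continuous_def E_def)
    then show "continuous_on {0..h} (\<lambda>\<alpha>. E k (u ! i - \<alpha>))"
      by (rule continuous_on_compose2) (auto intro!: continuous_intros)
  qed
  consider "det (A 0) \<le> 0" "0 \<le> det (A h)" | "det (A h) \<le> 0" "0 \<le> det (A 0)"
    using dneg by linarith
  then obtain \<alpha> where "det (A \<alpha>) = 0"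
    using IVT'[of "\<lambda>\<alpha>. det (A \<alpha>)" 0 0 h, OF _ _ _ cont] IVT2'[of "\<lambda>\<alpha>. det (A \<alpha>)" h 0 0, OF _ _ _ cont] h(1)
    by cases auto
  then obtain v where v: "v \<in> carrier_vec m" "v \<noteq> 0\<^sub>v m" "A \<alpha> *\<^sub>v v = 0\<^sub>v m"
    using det_0_iff_vec_prod_zero_field[OF A] by blast
  define c where "c j = (\<Sum>k\<in>{..<m}. v $ k * unit_coeffs k j)" for j
  show thesis
  proof (rule that[of c \<alpha>])
    show "periodic_coeffs c"
      using periodic_unit_coeffs by (simp add: periodic_coeffs_def c_def)
    obtain k where k: "k < m" "v $ k \<noteq> 0" using v(1,2) by (metis carrier_vecD eq_vecI index_zero_vec)
    have "c (int k) = (\<Sum>j\<in>{..<m}. if j = k then v $ k else 0)"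
      unfolding c_def using k by (intro sum.cong) (auto simp: unit_coeffs_def m_def)
    also have "\<dots> = v $ k" using k by simp
    finally show "\<exists>k. c k \<noteq> 0" using k by metis
    fix t assume "t \<in> set u"
    then obtain i where i: "i < m" "t = u ! i" using u by (auto simp: in_set_conv_nth m_def)
    have "smooth_spl p c (t - \<alpha>) = (\<Sum>k\<in>{..<m}. v $ k * E k (t - \<alpha>))"
      unfolding c_def[abs_def] E_def by (rule smooth_spl_sum_unit_coeffs) simp
    also have "\<dots> = (A \<alpha> *\<^sub>v v) $ i"
      using i v(1) by (auto simp: A_def scalar_prod_def mult_mat_vec_def atLeast0LessThan intro!: sum.cong)
    also have "\<dots> = 0" using i v by simp
    finally show "smooth_spl p c (t - \<alpha>) = 0" .
  qed
qed

end

section \<open>Sign changes of a spline with a vanishing coefficient\<close>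

context ramp_spline
begin

text \<open>\<open>\<kappa>\<close> selects an end point of the cell whose coefficient has the sign of the spline. Along an
  alternation it increases strictly, by \<open>2 n\<close> in total, so it meets every residue class.\<close>
lemma no_alternation_if_coeff_zero:
  assumes d: "periodic_coeffs d" and sgn: "\<And>k. 0 \<le> \<sigma> * alt k * d k" and \<sigma>: "\<sigma> \<noteq> 0" and d0: "d k0 = 0"
  shows "\<not> cyclic_alternation (2 * n) (spl d)"
proof
  assume "cyclic_alternation (2 * n) (spl d)"
  then obtain \<rho> t where t: "cyclic_points (2 * n) t" "\<And>i. i \<le> 2 * n \<Longrightarrow> 0 < \<rho> * (-1) ^ i * spl d (t i)"
    by (auto simp: cyclic_alternation_def)
  define fl where "fl x = \<lfloor>x / h\<rfloor>" for x
  \<comment> \<open>The value of the spline, normalised so that by \<open>sgn\<close> the left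
    coefficient of the cell contributes nonnegatively and the right one nonpositively.\<close>
  define S where "S x = \<sigma> * alt (fl x) * spl d x" for x
  define \<kappa> where "\<kappa> x = (if 0 < S x then fl x else fl x + 1)" for x
  have cell: "of_int (fl x) * h \<le> x" "x \<le> (of_int (fl x) + 1) * h" for x
    using cell_bounds[of x] by (auto simp: fl_def)
  define w where "w x = step (x - (of_int (fl x) + 1 / 2) * h)" for x
  have w: "\<bar>w x\<bar> \<le> H" for x unfolding w_def by (rule abs_step)
  have S: "S x = \<sigma> * alt (fl x) * d (fl x) * ((H - w x) / 2) - \<sigma> * alt (fl x + 1) * d (fl x + 1) * ((H + w x) / 2)" for x
  proof -
    have "spl d x = d (fl x) * ((H - w x) / 2) + d (fl x + 1) * ((H + w x) / 2)"
      using spl_cell[OF d cell[of x]] by (simp add: w_def half_diff_def field_simps)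
    then show ?thesis unfolding S_def alt(3) by (simp add: algebra_simps)
  qed
  have S_ne: "S x \<noteq> 0" if "spl d x \<noteq> 0" for x
    using that \<sigma> by (simp add: S_def alt_def)

  have \<kappa>_ne: "d (\<kappa> x) \<noteq> 0" if x: "spl d x \<noteq> 0" for x
  proof (cases "0 < S x")
    case True
    have "0 \<le> \<sigma> * alt (fl x + 1) * d (fl x + 1) * ((H + w x) / 2)"
      by (rule mult_nonneg_nonneg[OF sgn]) (use w[of x] in auto)
    then have "d (fl x) \<noteq> 0" using True S[of x] by auto
    then show ?thesis using True by (simp add: \<kappa>_def)
  next
    case False
    have "0 \<le> \<sigma> * alt (fl x) * d (fl x) * ((H - w x) / 2)"
      by (rule mult_nonneg_nonneg[OF sgn]) (use w[of x] in auto)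
    then have "d (fl x + 1) \<noteq> 0" using False S_ne[OF x] S[of x] by auto
    then show ?thesis using False by (simp add: \<kappa>_def)
  qed
  have \<kappa>_less: "\<kappa> x < \<kappa> y" if xy: "x < y" "spl d x * spl d y < 0" for x y
  proof -
    have "fl x \<le> fl y" unfolding fl_def using xy h(1) by (intro floor_mono divide_right_mono) auto
    then consider "fl x = fl y" | "fl x + 1 = fl y" | "fl x + 1 < fl y" by linarith
    then show ?thesis
    proof cases
      \<comment> \<open>Within one cell \<open>S\<close> decreases, so a sign change goes from
        positive to negative, and \<open>\<kappa>\<close> moves from the left to the right end
        point.\<close>
      case 1
      have "S y \<le> S x"
      proof -
        have "w x \<le> w y" unfolding w_def using 1 xy by (intro step_mono) simp
        moreover have "S x - S y = (\<sigma> * alt (fl x) * d (fl x) + \<sigma> * alt (fl x + 1) * d (fl x + 1)) * ((w y - w x) / 2)"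
          unfolding S using 1 by (simp add: field_simps)
        moreover have "0 \<le> (\<sigma> * alt (fl x) * d (fl x) + \<sigma> * alt (fl x + 1) * d (fl x + 1)) * ((w y - w x) / 2)"
          by (rule mult_nonneg_nonneg[OF add_nonneg_nonneg[OF sgn sgn]]) (use \<open>w x \<le> w y\<close> in simp)
        ultimately show ?thesis by simp
      qed
      moreover have "S x * S y < 0"
      proof -
        have "S x * S y = \<sigma>\<^sup>2 * (alt (fl x) * alt (fl x)) * (spl d x * spl d y)"
          using 1 by (simp add: S_def power2_eq_square mult_ac)
        then show ?thesis using xy(2) \<sigma> by (simp add: alt(5) mult_pos_neg)
      qed
      ultimately have "0 < S x" "S y < 0" by (auto simp: mult_less_0_iff)
      then show ?thesis using 1 by (simp add: \<kappa>_def)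
    next
      \<comment> \<open>The next cell has the opposite value of \<open>alt\<close>, so opposite
        signs of the spline mean equal signs of \<open>S\<close>, and \<open>\<kappa>\<close> grows
        with the cell.\<close>
      case 2
      have "S x * S y = \<sigma>\<^sup>2 * (alt (fl x) * alt (fl y)) * (spl d x * spl d y)"
        by (simp add: S_def power2_eq_square mult_ac)
      also have "alt (fl x) * alt (fl y) = - 1" using alt(3)[of "fl x"] alt(5)[of "fl x"] 2 by simp
      finally have "0 < S x * S y" using xy(2) \<sigma> by (simp add: mult_pos_neg)
      then show ?thesis using 2 by (auto simp: \<kappa>_def zero_less_mult_iff)
    next
      case 3
      then show ?thesis by (auto simp: \<kappa>_def)
    qed
  qed
  have inc: "\<kappa> (t i) < \<kappa> (t (Suc i))" if i: "i < 2 * n" for i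
  proof (rule \<kappa>_less)
    show "t i < t (Suc i)" using t(1) i by (simp add: cyclic_points_def)
    have "0 < (\<rho> * (-1) ^ i * spl d (t i)) * (\<rho> * (-1) ^ Suc i * spl d (t (Suc i)))"
      by (rule mult_pos_pos[OF t(2) t(2)]) (use i in auto)
    also have "\<dots> = - (\<rho>\<^sup>2 * (((-1) ^ i) * ((-1) ^ i)) * (spl d (t i) * spl d (t (Suc i))))"
      by (simp add: power2_eq_square mult_ac)
    also have "((-1) ^ i) * ((-1) ^ i) = (1 :: real)" by (simp flip: power_mult_distrib)
    finally have "\<rho>\<^sup>2 * (spl d (t i) * spl d (t (Suc i))) < 0" by simp
    then show "spl d (t i) * spl d (t (Suc i)) < 0" by (simp add: mult_less_0_iff)
  qed
  have up: "\<kappa> (t 0) + int i \<le> \<kappa> (t i)" if "i \<le> 2 * n" for i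
    using that
  proof (induction i)
    case (Suc i)
    then show ?case using inc[of i] by simp
  qed simp
  \<comment> \<open>Together with \<open>up\<close> and \<open>wrap\<close> this forces
    \<open>\<kappa>\<close> to grow by exactly one at each step.\<close>
  have down: "\<kappa> (t (2 * n - i)) + int i \<le> \<kappa> (t (2 * n))" if "i \<le> 2 * n" for i
    using that
  proof (induction i)
    case (Suc i)
    have "Suc (2 * n - Suc i) = 2 * n - i" using Suc.prems by simp
    then show ?case using Suc inc[of "2 * n - Suc i"] by simp
  qed simp
  have wrap: "\<kappa> (t (2 * n)) = \<kappa> (t 0) + 2 * int n"
  proof -
    have e: "t (2 * n) = t 0 + of_int (2 * int n) * h" using t(1) h(3) by (simp add: cyclic_points_def)
    have "fl (t (2 * n)) = fl (t 0) + 2 * int n" unfolding fl_def e floor_shift ..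
    moreover have "spl d (t (2 * n)) = spl d (t 0)"
      using periodic_continuous_spl[OF d] t(1) by (simp add: periodic_continuous_def cyclic_points_def)
    moreover have "alt (fl (t 0) + 2 * int n) = alt (fl (t 0))"
      using alt(1) by (simp add: periodic_coeffs_def)
    ultimately show ?thesis by (simp add: \<kappa>_def S_def)
  qed
  \<comment> \<open>This index makes \<open>\<kappa> (t i)\<close> congruent to \<open>k0\<close>
    modulo \<open>2 * n\<close>.\<close>
  define i where "i = nat ((k0 - \<kappa> (t 0)) mod (2 * int n))"
  have i: "int i = (k0 - \<kappa> (t 0)) mod (2 * int n)" "i < 2 * n"
    using n by (auto simp: i_def nat_less_iff)
  have "\<kappa> (t i) = \<kappa> (t 0) + int i"
    using up[of i] down[of "2 * n - i"] i(2) wrap by (simp add: of_nat_diff)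
  also have "\<dots> = k0 + 2 * int n * (- ((k0 - \<kappa> (t 0)) div (2 * int n)))"
    unfolding i(1) using minus_div_mult_eq_mod[of "k0 - \<kappa> (t 0)" "2 * int n"] by (simp add: algebra_simps)
  finally have e: "\<kappa> (t i) = k0 + 2 * int n * (- ((k0 - \<kappa> (t 0)) div (2 * int n)))" .
  have "d (\<kappa> (t i)) = 0" unfolding e periodic_coeffs_mult[OF d] by (rule d0)
  moreover have "spl d (t i) \<noteq> 0" using t(2)[of i] i(2) by auto
  ultimately show False using \<kappa>_ne by blast
qed

end

section \<open>Normalised splines and the lower bound\<close>

context ramp_spline
begin

lemma periodic_coeffs_attains_max:
  assumes "periodic_coeffs c"
  obtains k0 where "\<And>k. \<bar>c k\<bar> \<le> \<bar>c k0\<bar>"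
proof -
  have fin: "finite ((\<lambda>k. \<bar>c k\<bar>) ` {0..<2 * int n})" "(\<lambda>k. \<bar>c k\<bar>) ` {0..<2 * int n} \<noteq> {}"
    using n by auto
  obtain k0 where k0: "\<bar>c k0\<bar> = Max ((\<lambda>k. \<bar>c k\<bar>) ` {0..<2 * int n})"
    using Max_in[OF fin] by auto
  show thesis
  proof (rule that)
    fix k
    have "c k = c (k mod (2 * int n))"
      using periodic_coeffs_mult[OF assms, of "k mod (2 * int n)" "k div (2 * int n)"] by simp
    then show "\<bar>c k\<bar> \<le> \<bar>c k0\<bar>"
      unfolding k0 using n by (auto intro!: Max_ge[OF fin(1)])
  qed
qed

text \<open>For \<open>p > 0\<close> the \<open>p\<close>-th derivative of \<open>smooth_spl p c\<close> is \<open>spl c\<close> minus its mean.\<close>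
definition top_coeffs :: "nat \<Rightarrow> (int \<Rightarrow> real) \<Rightarrow> int \<Rightarrow> real" where
  "top_coeffs p c k = c k - (if p = 0 then 0 else mean (spl c) / H)"

lemma periodic_top_coeffs: "periodic_coeffs c \<Longrightarrow> periodic_coeffs (top_coeffs p c)"
  by (simp add: periodic_coeffs_def top_coeffs_def)

lemma half_diff_top_coeffs: "half_diff (top_coeffs p c) = half_diff c"
  by (simp add: fun_eq_iff half_diff_def top_coeffs_def)

lemma top_coeffs_linear:
  assumes "periodic_coeffs c" "periodic_coeffs d"
  shows "top_coeffs p (\<lambda>k. x * c k + y * d k) k = x * top_coeffs p c k + y * top_coeffs p d k"
proof -
  have "spl (\<lambda>k. x * c k + y * d k) = (\<lambda>t. x * spl c t + y * spl d t)"
    using assms by (intro ext spl_linear)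
  moreover have "mean (\<lambda>t. x * spl c t + y * spl d t) = x * mean (spl c) + y * mean (spl d)"
    using assms[THEN periodic_continuous_spl] by (intro mean_linear) (auto simp: periodic_continuous_def)
  ultimately show ?thesis using H_pos by (simp add: top_coeffs_def field_simps)
qed

lemma pint_tower_spl_top:
  assumes "periodic_coeffs c"
  shows "pint_tower p (spl c) p t = spl (top_coeffs p c) t"
proof (cases "p = 0")
  case False
  have one: "periodic_coeffs (\<lambda>_. 1)" by (simp add: periodic_coeffs_def)
  have "top_coeffs p c = (\<lambda>k. 1 * c k + (- mean (spl c) / H) * 1)"
    using False by (auto simp: top_coeffs_def)
  then show ?thesis
    using spl_linear[OF assms one, of 1 "- mean (spl c) / H" t] False H_pos
    by (simp add: pint_tower_def spl_const)
next
  case True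
  then have "top_coeffs p c = c" by (simp add: top_coeffs_def fun_eq_iff)
  then show ?thesis using True by (simp add: pint_tower_def)
qed

text \<open>If all shifted coefficients vanished, \<open>c\<close> would be constant, and since
  \<open>pint\<close> fixes constants the spline would be the nonzero constant
  \<open>H * c k\<close>.\<close>

lemma top_coeffs_nonzero:
  assumes c: "periodic_coeffs c" "c k \<noteq> 0" and van: "smooth_spl p c t = 0"
  shows "\<exists>k. top_coeffs p c k \<noteq> 0"
proof (rule ccontr)
  assume "\<not> (\<exists>k. top_coeffs p c k \<noteq> 0)"
  then have "c = (\<lambda>_. c k)" by (auto simp: top_coeffs_def fun_eq_iff)
  then have "smooth_spl p c t = H * c k" using smooth_spl_const by metis
  then show False using van c(2) H_pos by simp
qed

lemma norm_ge_if_top_coeffs_extremal: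
  assumes c: "periodic_coeffs c" and le: "\<And>k. \<bar>top_coeffs p c k\<bar> \<le> 1" and k0: "\<bar>top_coeffs p c k0\<bar> = 1"
  shows "\<exists>t. \<bar>smooth_spl p alt s\<bar> \<le> \<bar>smooth_spl p c t\<bar>"
proof (rule ccontr)
  let ?\<phi> = "smooth_spl p alt"
  assume "\<not> ?thesis"
  then have less: "\<bar>smooth_spl p c t\<bar> < \<bar>?\<phi> s\<bar>" for t by (simp add: not_le)
  \<comment> \<open>The sign is chosen so that \<open>\<sigma> * alt\<close> agrees at
    \<open>k0\<close> with the shifted coefficients of \<open>c\<close>, which have modulus 1 there;
    this produces the zero coefficient of the difference.\<close>
  define \<sigma> where "\<sigma> = top_coeffs p c k0 * alt k0"
  have \<sigma>: "\<bar>\<sigma>\<bar> = 1" using k0 by (simp add: \<sigma>_def abs_mult alt)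
  have \<sigma>2: "\<sigma> * \<sigma> = 1" using \<sigma> by (auto simp: abs_if split: if_splits)
  define d where "d k = \<sigma> * alt k + (- 1) * c k" for k
  have d: "periodic_coeffs d" unfolding d_def[abs_def] by (intro periodic_coeffs_linear alt c)
  have td: "top_coeffs p d k = \<sigma> * alt k - top_coeffs p c k" for k
    unfolding d_def[abs_def] top_coeffs_linear[OF alt(1) c] by (simp add: top_coeffs_def mean_spl_alt)
  have sd: "smooth_spl p d t = \<sigma> * ?\<phi> t - smooth_spl p c t" for t
    unfolding d_def[abs_def] smooth_spl_linear[OF alt(1) c] by simp
  have G: "periodic_continuous (spl d)" by (intro periodic_continuous_spl d)
  \<comment> \<open>At the points \<open>s + i * h\<close> phi has constant modulus and alternating
    sign, and the term from \<open>c\<close> is too small to change that sign.\<close>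
  have A0: "cyclic_alternation (2 * n) (smooth_spl p d)"
    unfolding cyclic_alternation_def
  proof (intro exI conjI allI impI)
    show "cyclic_points (2 * n) (\<lambda>i. s + of_int (int i) * h)"
      using h by (simp add: cyclic_points_def algebra_simps)
    fix i :: nat
    let ?x = "s + of_int (int i) * h"
    have ai: "alt (int i) = (-1) ^ i" by (simp add: alt_def)
    have "(\<sigma> * ?\<phi> s) * (-1) ^ i * smooth_spl p d ?x =
        (?\<phi> s)\<^sup>2 * (\<sigma> * \<sigma>) * (alt (int i) * alt (int i)) - (\<sigma> * alt (int i) * ?\<phi> s) * smooth_spl p c ?x"
      unfolding sd smooth_spl_alt_shift ai by (simp add: algebra_simps power2_eq_square)
    also have "\<dots> = \<bar>?\<phi> s\<bar> * \<bar>?\<phi> s\<bar> - (\<sigma> * alt (int i) * ?\<phi> s) * smooth_spl p c ?x"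
      by (simp add: \<sigma>2 alt(5) power2_eq_square)
    finally have eq: "(\<sigma> * ?\<phi> s) * (-1) ^ i * smooth_spl p d ?x =
        \<bar>?\<phi> s\<bar> * \<bar>?\<phi> s\<bar> - (\<sigma> * alt (int i) * ?\<phi> s) * smooth_spl p c ?x" .
    have "(\<sigma> * alt (int i) * ?\<phi> s) * smooth_spl p c ?x \<le> \<bar>(\<sigma> * alt (int i) * ?\<phi> s) * smooth_spl p c ?x\<bar>"
      by (rule abs_ge_self)
    also have "\<dots> = \<bar>?\<phi> s\<bar> * \<bar>smooth_spl p c ?x\<bar>" by (simp add: abs_mult \<sigma> alt)
    also have "\<dots> < \<bar>?\<phi> s\<bar> * \<bar>?\<phi> s\<bar>"
      using less[of ?x] less[of s] by (intro mult_strict_left_mono) auto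
    finally show "0 < (\<sigma> * ?\<phi> s) * (-1) ^ i * smooth_spl p d ?x" using eq by simp
  qed
  have "cyclic_alternation (2 * n) (pint_tower p (spl d) k)" if "k \<le> p" for k
    using that
  proof (induction k)
    case 0
    have "pint_tower p (spl d) 0 = smooth_spl p d" by (simp add: pint_tower_def fun_eq_iff smooth_spl_def)
    then show ?case using A0 by simp
  next
    case (Suc k)
    show ?case
    proof (rule cyclic_alternation_deriv)
      show "(pint_tower p (spl d) k has_real_derivative pint_tower p (spl d) (Suc k) t) (at t)" for t
        using Suc.prems by (intro DERIV_pint_tower G) simp
      show "pint_tower p (spl d) k (t + 2 * pi) = pint_tower p (spl d) k t" for t
        using periodic_continuous_pint_funpow[OF G] by (simp add: pint_tower_def periodic_continuous_def)
    qed (use Suc n in auto)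
  qed
  then have "cyclic_alternation (2 * n) (pint_tower p (spl d) p)" by simp
  also have "pint_tower p (spl d) p = spl (top_coeffs p d)" using pint_tower_spl_top[OF d] by blast
  finally have "cyclic_alternation (2 * n) (spl (top_coeffs p d))" .
  moreover have "\<not> cyclic_alternation (2 * n) (spl (top_coeffs p d))"
  proof (rule no_alternation_if_coeff_zero)
    show "periodic_coeffs (top_coeffs p d)" by (intro periodic_top_coeffs d)
    show "0 \<le> \<sigma> * alt k * top_coeffs p d k" for k
    proof -
      have "\<sigma> * alt k * top_coeffs p d k = (\<sigma> * \<sigma>) * (alt k * alt k) - \<sigma> * alt k * top_coeffs p c k"
        by (simp add: td algebra_simps)
      moreover have "\<sigma> * alt k * top_coeffs p c k \<le> \<bar>\<sigma> * alt k * top_coeffs p c k\<bar>" by (rule abs_ge_self)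
      moreover have "\<bar>\<sigma> * alt k * top_coeffs p c k\<bar> \<le> 1" using le[of k] by (simp add: abs_mult \<sigma> alt)
      ultimately show ?thesis by (simp add: \<sigma>2 alt(5))
    qed
    show "\<sigma> \<noteq> 0" using \<sigma> by auto
    show "top_coeffs p d k0 = 0"
      using alt(5)[of k0] by (simp add: td \<sigma>_def mult.assoc)
  qed
  ultimately show False by simp
qed

text \<open>The competitor for the lower bound: a spline vanishing at \<open>u\<close>, scaled so
  that its largest shifted coefficient has modulus 1. \<open>abs_spl\<close>,
  \<open>abs_ramp\<close> and \<open>ramp_Lipschitz\<close> then give the three bounds.\<close>

lemma vanishing_tower_exists:
  fixes u :: "real list"
  assumes u: "length u = 2 * n"
  obtains D where "smooth_tower p D" "\<And>t. \<bar>D (Suc p) t\<bar> \<le> N" "\<And>t. \<bar>D p t\<bar> \<le> H"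
    "\<And>t. t \<in> set u \<Longrightarrow> D 0 t = 0" "\<And>s. \<exists>t. \<bar>smooth_spl p alt s\<bar> \<le> \<bar>D 0 t\<bar>"
proof -
  obtain c0 \<alpha> where c0: "periodic_coeffs c0" "\<exists>k. c0 k \<noteq> 0"
      "\<And>t. t \<in> set u \<Longrightarrow> smooth_spl p c0 (t - \<alpha>) = 0"
    using spline_vanishing_exists[OF u] by blast
  have "u \<noteq> []" using u n by auto
  then have "u ! 0 \<in> set u" by simp
  then obtain j where j: "top_coeffs p c0 j \<noteq> 0"
    using top_coeffs_nonzero[OF c0(1)] c0(2,3) by metis
  obtain k0 where k0: "\<And>k. \<bar>top_coeffs p c0 k\<bar> \<le> \<bar>top_coeffs p c0 k0\<bar>"
    using periodic_coeffs_attains_max[OF periodic_top_coeffs[OF c0(1)]] by blast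
  define m where "m = \<bar>top_coeffs p c0 k0\<bar>"
  have m: "0 < m" using k0[of j] j by (simp add: m_def)
  \<comment> \<open>Written as a linear combination to fit \<open>top_coeffs_linear\<close> and
    \<open>smooth_spl_linear\<close>.\<close>
  define c where "c k = (1 / m) * c0 k + 0 * c0 k" for k
  have c: "periodic_coeffs c" unfolding c_def[abs_def] by (intro periodic_coeffs_linear c0)
  have tc: "top_coeffs p c k = top_coeffs p c0 k / m" for k
    unfolding c_def[abs_def] top_coeffs_linear[OF c0(1) c0(1)] by simp
  have le: "\<bar>top_coeffs p c k\<bar> \<le> 1" for k using k0[of k] m by (simp add: tc m_def)
  have eq: "\<bar>top_coeffs p c k0\<bar> = 1" using m by (simp add: tc m_def)
  have sc: "smooth_spl p c t = smooth_spl p c0 t / m" for t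
    unfolding c_def[abs_def] smooth_spl_linear[OF c0(1) c0(1)] by simp
  have G: "periodic_continuous (spl c)" by (intro periodic_continuous_spl c)
  define D where "D k t = (if k \<le> p then pint_tower p (spl c) k (t - \<alpha>) else ramp (half_diff c) (t - \<alpha>))" for k t
  have D0: "D 0 t = smooth_spl p c (t - \<alpha>)" for t by (simp add: D_def pint_tower_def smooth_spl_def)
  have hd: "\<bar>half_diff c k\<bar> \<le> 1" for k
    using abs_half_diff[of "top_coeffs p c" k] le by (simp add: half_diff_top_coeffs)
  have "smooth_tower p D"
    unfolding smooth_tower_def
  proof (intro conjI allI impI)
    fix k t assume k: "k \<le> p"
    have "(pint_tower p (spl c) k has_real_derivative D (Suc k) (x + \<alpha>)) (at x)" for x
    proof (cases "k < p")
      case True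
      then show ?thesis using DERIV_pint_tower[OF G True, of x] by (simp add: D_def)
    next
      case False
      then have "k = p" using k by simp
      have "pint_tower p (spl c) p = spl (top_coeffs p c)" using pint_tower_spl_top[OF c] by blast
      then show ?thesis
        using DERIV_spl[OF periodic_top_coeffs[OF c], of p x] \<open>k = p\<close>
        by (simp add: D_def half_diff_top_coeffs)
    qed
    note * = this[of "t - \<alpha>"]
    have "D k = (\<lambda>t. pint_tower p (spl c) k (t - \<alpha>))" using k by (simp add: D_def fun_eq_iff)
    then show "(D k has_real_derivative D (Suc k) t) (at t)"
      using DERIV_shift[of "pint_tower p (spl c) k" "D (Suc k) t" t "- \<alpha>"] * by simp
  next
    show "D 0 (t + 2 * pi) = D 0 t" for t
    proof -
      have "t + 2 * pi - \<alpha> = (t - \<alpha>) + 2 * pi" by simp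
      then show ?thesis
        using periodic_continuous_smooth_spl[OF c, of p] unfolding D0 periodic_continuous_def by metis
    qed
    show "\<bar>D (Suc p) t - D (Suc p) s\<bar> \<le> \<bar>t - s\<bar>" for s t
      using ramp_Lipschitz[of "half_diff c" 1 "t - \<alpha>" "s - \<alpha>"] hd by (simp add: D_def)
  qed
  moreover have "\<bar>D (Suc p) t\<bar> \<le> N" for t using abs_ramp[of "half_diff c"] hd by (simp add: D_def)
  moreover have "\<bar>D p t\<bar> \<le> H" for t
    using abs_spl[OF periodic_top_coeffs[OF c] le] by (simp add: D_def pint_tower_spl_top[OF c])
  moreover have "D 0 t = 0" if "t \<in> set u" for t using c0(3)[OF that] by (simp add: D0 sc)
  moreover have "\<exists>t. \<bar>smooth_spl p alt s\<bar> \<le> \<bar>D 0 t\<bar>" for s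
  proof -
    obtain t where "\<bar>smooth_spl p alt s\<bar> \<le> \<bar>smooth_spl p c t\<bar>"
      using norm_ge_if_top_coeffs_extremal[OF c le eq] by blast
    then show ?thesis by (intro exI[of _ "t + \<alpha>"]) (simp add: D0)
  qed
  ultimately show thesis by (rule that)
qed

end

section \<open>Optimality of the uniform nodes\<close>

text \<open>\<open>Q\<close> depends on \<open>N\<close> only. Half a cell is taken as
  \<open>a\<close> if \<open>M\<close> allows it; otherwise the intermediate value theorem gives a
  smaller \<open>a\<close> with \<open>Q a = M\<close>.\<close>

lemma exists_ramp_spline:
  assumes n: "1 \<le> n" and N: "0 < N" and M: "0 < M"
  shows "\<exists>a. ramp_spline n N a \<and> ramp_spline.H N a \<le> M \<and> (M = ramp_spline.H N a \<or> 2 * a = pi / real n)"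
proof -
  define b where "b = pi / real n / 2"
  have b: "0 < b" using n by (simp add: b_def)
  interpret r: ramp_spline n N b
    using n N b by unfold_locales (auto simp: b_def)
  have rs: "ramp_spline n N a" if "0 < a" "a \<le> b" for a
    using n N that by unfold_locales (auto simp: b_def)
  show ?thesis
  proof (cases "r.Q b \<le> M")
    case True
    then show ?thesis using rs[of b] b r.H_def by (intro exI[of _ b]) (auto simp: b_def)
  next
    case False
    have "continuous_on {0..b} r.Q"
      using r.DERIV_Q by (auto intro!: continuous_at_imp_continuous_on DERIV_isCont)
    then obtain a where a: "0 \<le> a" "a \<le> b" "r.Q a = M"
      using IVT'[of r.Q 0 M b] False M b r.Q_0 by auto
    then have "a \<noteq> 0" using r.Q_0 M by auto
    then have "ramp_spline n N a" using rs a by auto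
    moreover have "ramp_spline.H N a = M" using ramp_spline.H_def[OF calculation] a by simp
    ultimately show ?thesis by (intro exI[of _ a]) auto
  qed
qed

section \<open>A priori bounds for towers\<close>

lemma abs_le_if_Lipschitz_periodic_zero:
  fixes f :: "real \<Rightarrow> real"
  assumes per: "\<And>t. f (t + 2 * pi) = f t" and z: "f z = 0"
    and lip: "\<And>s t. \<bar>f s - f t\<bar> \<le> K * \<bar>s - t\<bar>" and K: "0 \<le> K"
  shows "\<bar>f t\<bar> \<le> K * (2 * pi)"
proof -
  interpret periodic_fun_simple f "2 * pi" by unfold_locales (rule per)
  define j where "j = \<lfloor>(t - z) / (2 * pi)\<rfloor>"
  have "of_int j \<le> (t - z) / (2 * pi)" "(t - z) / (2 * pi) < of_int j + 1"
    using floor_correct[of "(t - z) / (2 * pi)"] by (auto simp: j_def)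
  then have *: "\<bar>t - (z + of_int j * (2 * pi))\<bar> \<le> 2 * pi"
    by (auto simp: field_simps abs_if)
  have "f (z + of_int j * (2 * pi)) = 0" using z by (simp add: plus_of_int)
  then have "\<bar>f t\<bar> \<le> K * \<bar>t - (z + of_int j * (2 * pi))\<bar>"
    using lip[of t "z + of_int j * (2 * pi)"] by simp
  also have "\<dots> \<le> K * (2 * pi)" using * K by (intro mult_left_mono)
  finally show ?thesis .
qed

lemma Lipschitz_if_abs_deriv_le:
  fixes f :: "real \<Rightarrow> real"
  assumes D: "\<And>t. (f has_real_derivative f' t) (at t)" and le: "\<And>t. \<bar>f' t\<bar> \<le> K"
  shows "\<bar>f s - f t\<bar> \<le> K * \<bar>s - t\<bar>"
  using field_differentiable_bound[of UNIV f f' K s t] assms by (simp add: has_field_derivative_at_within)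

lemma smooth_tower_deriv_zero:
  assumes "smooth_tower p D" "k \<le> p"
  shows "\<exists>z. D (Suc k) z = 0"
proof -
  have D: "(D k has_real_derivative D (Suc k) t) (at t)" for t
    using assms by (simp add: smooth_tower_def)
  have "D k (0 + 2 * pi) = D k 0" by (rule smooth_tower_periodic[OF assms(1)]) (use assms(2) in simp)
  then have "\<exists>z. 0 < z \<and> z < 2 * pi \<and> (D k has_real_derivative 0) (at z)"
    using D by (intro Rolle) (auto simp: real_differentiable_def
        intro!: continuous_at_imp_continuous_on DERIV_isCont)
  then show ?thesis using D DERIV_unique by blast
qed

text \<open>By Rolle's theorem each derivative has a zero, and every point is within a period of
  one, so each level downwards costs a factor \<open>2 * pi\<close>. For \<open>j = 0\<close> and
  \<open>j = 1\<close> this is the origin of the values that replace missing bounds.\<close>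

lemma smooth_tower_bound:
  assumes T: "smooth_tower p D" and "j \<le> p"
  shows "\<bar>D (Suc p - j) t\<bar> \<le> (2 * pi) ^ Suc j"
  using assms(2)
proof (induction j arbitrary: t)
  case 0
  obtain z where "D (Suc p) z = 0" using smooth_tower_deriv_zero[OF T] by blast
  then have "\<bar>D (Suc p) t\<bar> \<le> 1 * (2 * pi)"
    using T by (intro abs_le_if_Lipschitz_periodic_zero[of _ z] smooth_tower_periodic[OF T]) (auto simp: smooth_tower_def)
  then show ?case by simp
next
  case (Suc j)
  define k where "k = p - Suc j"
  have k: "Suc p - Suc j = Suc k" "Suc p - j = Suc (Suc k)" "Suc k \<le> p" using Suc.prems by (auto simp: k_def)
  obtain z where z: "D (Suc k) z = 0" using smooth_tower_deriv_zero[OF T, of k] k(3) by auto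
  have "\<bar>D (Suc k) s - D (Suc k) t\<bar> \<le> (2 * pi) ^ Suc j * \<bar>s - t\<bar>" for s t
    by (rule Lipschitz_if_abs_deriv_le[of _ "D (Suc (Suc k))"])
      (use T Suc k in \<open>auto simp: smooth_tower_def\<close>)
  then have "\<bar>D (Suc k) t\<bar> \<le> (2 * pi) ^ Suc j * (2 * pi)"
    by (intro abs_le_if_Lipschitz_periodic_zero[of _ z] smooth_tower_periodic[OF T] z) (use k in auto)
  then show ?case unfolding k(1) by (simp add: mult_ac)
qed

lemma smooth_tower_Lipschitz:
  assumes T: "smooth_tower p D"
  shows "\<bar>D 0 s - D 0 t\<bar> \<le> (2 * pi) ^ Suc p * \<bar>s - t\<bar>"
  by (rule Lipschitz_if_abs_deriv_le[of _ "D 1"])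
    (use T smooth_tower_bound[OF T order_refl] in \<open>auto simp: smooth_tower_def\<close>)

text \<open>The zero of \<open>D 0\<close> matters for \<open>p = 0\<close>, where
  \<open>D p\<close> is the function itself and Rolle's theorem supplies no zero.\<close>

lemma smooth_tower_bound_if_zero:
  assumes T: "smooth_tower p D" and z: "D 0 z = 0"
  shows "\<bar>D p t\<bar> \<le> (2 * pi)\<^sup>2"
proof (cases p)
  case 0
  then have "\<bar>D 0 t\<bar> \<le> (2 * pi) ^ Suc p * (2 * pi)"
    by (intro abs_le_if_Lipschitz_periodic_zero[of _ z] smooth_tower_Lipschitz[OF T] smooth_tower_periodic[OF T] z) auto
  then show ?thesis using 0 by (simp add: power2_eq_square)
next
  case (Suc p')
  then show ?thesis using smooth_tower_bound[OF T, of 1 t] by (simp add: power2_eq_square)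
qed

lemma smooth_tower_half_diff:
  assumes D: "smooth_tower p D" and E: "smooth_tower p E"
  shows "smooth_tower p (\<lambda>k t. (D k t - E k t) / 2)"
proof -
  have "\<bar>(D (Suc p) t - E (Suc p) t) / 2 - (D (Suc p) s - E (Suc p) s) / 2\<bar> \<le> \<bar>t - s\<bar>" for s t
  proof -
    have "\<bar>D (Suc p) t - D (Suc p) s\<bar> \<le> \<bar>t - s\<bar>" "\<bar>E (Suc p) t - E (Suc p) s\<bar> \<le> \<bar>t - s\<bar>"
      using D E by (auto simp: smooth_tower_def)
    then show ?thesis by (simp add: abs_le_iff field_simps)
  qed
  moreover have "((\<lambda>t. (D k t - E k t) / 2) has_real_derivative (D (Suc k) t - E (Suc k) t) / 2) (at t)"
    if "k \<le> p" for k t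
    using D E that by (intro DERIV_cdivide DERIV_diff) (auto simp: smooth_tower_def)
  ultimately show ?thesis using D E by (simp add: smooth_tower_def)
qed

lemma smooth_tower_minus:
  assumes D: "smooth_tower p D"
  shows "smooth_tower p (\<lambda>k t. - D k t)"
proof -
  have "\<bar>- D (Suc p) t - - D (Suc p) s\<bar> \<le> \<bar>t - s\<bar>" for s t
  proof -
    have "\<bar>D (Suc p) t - D (Suc p) s\<bar> \<le> \<bar>t - s\<bar>" using D by (auto simp: smooth_tower_def)
    then show ?thesis by linarith
  qed
  then show ?thesis using D by (auto simp: smooth_tower_def intro: DERIV_minus)
qed

text \<open>The three classes of the theorem at once: a bound is imposed only if its switch, \<open>b1\<close> or \<open>b0\<close>, is on.\<close>
definition bounded_class :: "nat \<Rightarrow> bool \<Rightarrow> real \<Rightarrow> bool \<Rightarrow> real \<Rightarrow> (real \<Rightarrow> real) set" where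
  "bounded_class p b1 N b0 M = {x. smooth_tower p (\<lambda>k. (deriv ^^ k) x) \<and>
     (b1 \<longrightarrow> (\<forall>t. \<bar>(deriv ^^ Suc p) x t\<bar> \<le> N)) \<and> (b0 \<longrightarrow> (\<forall>t. \<bar>(deriv ^^ p) x t\<bar> \<le> M))}"

lemma smooth_tower_in_bounded_class:
  assumes T: "smooth_tower p D" and x: "x = D 0"
    and "b1 \<Longrightarrow> (\<And>t. \<bar>D (Suc p) t\<bar> \<le> N)" "b0 \<Longrightarrow> (\<And>t. \<bar>D p t\<bar> \<le> M)"
  shows "x \<in> bounded_class p b1 N b0 M"
proof -
  have eq: "(deriv ^^ k) x = D k" if "k \<le> Suc p" for k
    unfolding x by (rule smooth_tower_higher_deriv[OF T that])
  have "smooth_tower p (\<lambda>k. (deriv ^^ k) x)"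
    by (rule smooth_tower_cong[OF _ T]) (simp add: eq)
  then show ?thesis
    using assms(3,4) eq[of p] eq[of "Suc p"] by (simp add: bounded_class_def del: funpow.simps)
qed

lemma uniform_nodes_in_nodes:
  assumes "1 \<le> n"
  shows "uniform_nodes n \<in> nodes (2 * n)"
proof -
  have "real k * pi / real n < 2 * pi" if "k < 2 * n" for k
  proof -
    have "real k * pi < (2 * real n) * pi" using that by (intro mult_strict_right_mono) auto
    then show ?thesis using assms by (simp add: field_simps)
  qed
  then show ?thesis using assms
    by (auto simp: nodes_def uniform_nodes_def sorted_wrt_map sorted_wrt_iff_nth_less divide_strict_right_mono)
qed

text \<open>A switched-off bound gets a value that every function of the class vanishing at a node
  obeys, so the same spline is extremal. The class keeps the switch because for \<open>p = 0\<close>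
  its other members, constants for instance, may exceed that value.\<close>

lemma best_error_bounded_class:
  assumes N: "0 < N" and M: "0 < M" and n: "1 \<le> n"
    and b1: "\<not> b1 \<Longrightarrow> 2 * pi \<le> N" and b0: "\<not> b0 \<Longrightarrow> (2 * pi)\<^sup>2 \<le> M"
  shows "best_error (2 * n) (bounded_class p b1 N b0 M) Linf_norm =
    best_error_at (bounded_class p b1 N b0 M) (uniform_nodes n) Linf_norm"
proof -
  define X where "X = bounded_class p b1 N b0 M"
  obtain a where ramp: "ramp_spline n N a" and HM: "ramp_spline.H N a \<le> M"
      and full: "M = ramp_spline.H N a \<or> 2 * a = pi / real n"
    using exists_ramp_spline[OF n N M] by blast
  interpret ramp_spline n N a by (rule ramp)
  obtain t1 where t1: "\<And>s. \<bar>smooth_spl p alt s\<bar> \<le> \<bar>smooth_spl p alt t1\<bar>"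
    using periodic_continuous_attains_sup[OF periodic_continuous_smooth_spl[OF alt(1)]] by metis
  define e where "e = \<bar>smooth_spl p alt t1\<bar>"
  have T: "smooth_tower p (\<lambda>k. (deriv ^^ k) x)" if "x \<in> X" for x
    using that by (simp add: X_def bounded_class_def)
  have half: "(\<lambda>t. (x t - y t) / 2) \<in> X" if "x \<in> X" "y \<in> X" for x y
    unfolding X_def
  proof (rule smooth_tower_in_bounded_class[OF smooth_tower_half_diff[OF T[OF that(1)] T[OF that(2)]]])
    have *: "\<bar>(s - t) / 2\<bar> \<le> c" if "\<bar>s\<bar> \<le> c" "\<bar>t\<bar> \<le> c" for s t c :: real
      using that by (auto simp: abs_le_iff)
    show "\<bar>((deriv ^^ Suc p) x t - (deriv ^^ Suc p) y t) / 2\<bar> \<le> N" if "b1" for t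
      by (rule *) (use \<open>b1\<close> \<open>x \<in> X\<close> \<open>y \<in> X\<close> in \<open>unfold X_def bounded_class_def, blast\<close>)+
    show "\<bar>((deriv ^^ p) x t - (deriv ^^ p) y t) / 2\<bar> \<le> M" if "b0" for t
      by (rule *) (use \<open>b0\<close> \<open>x \<in> X\<close> \<open>y \<in> X\<close> in \<open>unfold X_def bounded_class_def, blast\<close>)+
  qed simp
  have upper: "best_error_at X (uniform_nodes n) Linf_norm \<le> ennreal e"
  proof (rule best_error_at_le[where K = "(2 * pi) ^ Suc p"])
    show "x (t + 2 * pi) = x t" if "x \<in> X" for x t
      using smooth_tower_periodic[OF T[OF that], of 0] by simp
    show "\<bar>x s - x t\<bar> \<le> (2 * pi) ^ Suc p * \<bar>s - t\<bar>" if "x \<in> X" for x s t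
      using smooth_tower_Lipschitz[OF T[OF that]] by simp
    show "(\<lambda>t. (x t - y t) / 2) \<in> X" if "x \<in> X" "y \<in> X" for x y
      using that by (rule half)
    fix x t assume x: "x \<in> X" and zero: "\<And>t. t \<in> set (uniform_nodes n) \<Longrightarrow> x t = 0"
    let ?D = "\<lambda>k. (deriv ^^ k) x"
    interpret per: periodic_fun_simple x "2 * pi"
      using smooth_tower_periodic[OF T[OF x], of 0] by unfold_locales simp
    \<comment> \<open>Periodicity reduces an arbitrary multiple of \<open>h\<close> to one of the
      \<open>2 * n\<close> listed nodes.\<close>
    have z: "?D 0 (of_int k * h) = 0" for k
    proof -
      define j where "j = nat (k mod (2 * int n))"
      have j: "j < 2 * n" "int j = k mod (2 * int n)" using n by (auto simp: j_def nat_less_iff)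
      define i where "i = k div (2 * int n)"
      have "k = int j + 2 * int n * i" unfolding j(2) i_def by simp
      then have "of_int k * h = real j * h + of_int i * (2 * real n * h)"
        by (simp add: algebra_simps)
      then have "x (of_int k * h) = x (real j * h)" unfolding h(3) by (simp add: per.plus_of_int)
      moreover have "real j * h \<in> set (uniform_nodes n)" using j(1) by (auto simp: uniform_nodes_def h_def)
      ultimately show ?thesis using zero by simp
    qed
    have "\<bar>?D 0 t\<bar> \<le> e"
    proof (rule bound_if_vanishes_at_nodes[OF T[OF x] _ _ _ z])
      show "\<bar>?D (Suc p) t\<bar> \<le> N" for t
      proof (cases b1)
        case True
        then show ?thesis using x unfolding X_def bounded_class_def by blast
      next
        case False
        then show ?thesis using smooth_tower_bound[OF T[OF x], of 0 t] b1 by simp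
      qed
      show "\<bar>?D p t\<bar> \<le> M" for t
      proof (cases b0)
        case True
        then show ?thesis using x unfolding X_def bounded_class_def by blast
      next
        case False
        have "x 0 = 0" using z[of 0] by simp
        then show ?thesis using smooth_tower_bound_if_zero[OF T[OF x], of 0 t] b0[OF False] by simp
      qed
      show "M = H \<or> 2 * a = h" using full by (simp add: h_def)
    qed (use t1 in \<open>simp add: e_def\<close>)
    then show "\<bar>x t\<bar> \<le> e" by simp
  qed (auto simp: e_def)
  have lower: "ennreal e \<le> best_error_at X u Linf_norm" if "u \<in> nodes (2 * n)" for u
  proof -
    have "length u = 2 * n" using that by (simp add: nodes_def)
    then obtain D where D: "smooth_tower p D" "\<And>t. \<bar>D (Suc p) t\<bar> \<le> N" "\<And>t. \<bar>D p t\<bar> \<le> H"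
        "\<And>t. t \<in> set u \<Longrightarrow> D 0 t = 0" "\<And>s. \<exists>t. \<bar>smooth_spl p alt s\<bar> \<le> \<bar>D 0 t\<bar>"
      using vanishing_tower_exists[of u p] by blast
    have D0: "\<bar>D p t\<bar> \<le> M" for t using D(3)[of t] HM by simp
    obtain t where t: "e \<le> \<bar>D 0 t\<bar>" using D(5)[of t1] by (auto simp: e_def)
    have "D 0 \<in> X" unfolding X_def
      by (rule smooth_tower_in_bounded_class[OF D(1)]) (use D(2) D0 in auto)
    moreover have "(\<lambda>t. - D 0 t) \<in> X" unfolding X_def
      by (rule smooth_tower_in_bounded_class[OF smooth_tower_minus[OF D(1)]]) (use D(2) D0 in auto)
    moreover have "continuous_on UNIV (D 0)" by (rule smooth_tower_continuous[OF D(1)]) simp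
    ultimately have "ennreal \<bar>D 0 t\<bar> \<le> best_error_at X u Linf_norm"
      using D(4) by (intro best_error_at_ge)
    then show ?thesis using t ennreal_leI order_trans by blast
  qed
  have "best_error (2 * n) X Linf_norm = best_error_at X (uniform_nodes n) Linf_norm"
  proof (rule antisym)
    show "best_error (2 * n) X Linf_norm \<le> best_error_at X (uniform_nodes n) Linf_norm"
      unfolding best_error_def by (rule INF_lower[OF uniform_nodes_in_nodes[OF n]])
    show "best_error_at X (uniform_nodes n) Linf_norm \<le> best_error (2 * n) X Linf_norm"
      unfolding best_error_def by (rule INF_greatest) (use upper lower order_trans in blast)
  qed
  then show ?thesis by (simp add: X_def)
qed

theorem mainTheorem3:
  fixes X :: "(real \<Rightarrow> real) set" and r n :: nat and M N :: real
  assumes "M > 0" and "N > 0" and "n \<ge> 1"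
    and "(r \<ge> 2 \<and> X = W_1 r M) \<or> (r \<ge> 3 \<and> X = W_2 r M) \<or> (r \<ge> 3 \<and> X = W_12 r M N)"
  shows "best_error (2 * n) X Linf_norm = best_error_at X (uniform_nodes n) Linf_norm"
proof -
  define p where "p = r - 2"
  have r: "r = Suc (Suc p)" using assms(4) by (auto simp: p_def)
  have M: "0 \<le> M" and N: "0 \<le> N" using assms by auto
  \<comment> \<open>An argument that follows \<open>False\<close> is the replacement for a missing
    bound, as \<open>best_error_bounded_class\<close> requires it.\<close>
  have W1: "W_1 r M = bounded_class p True M False ((2 * pi)\<^sup>2)"
    using W_1_iff[OF M] unfolding r bounded_class_def by blast
  have W2: "W_2 r M = bounded_class p False (2 * pi) True M"
    using W_2_iff[OF M] unfolding r bounded_class_def by blast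
  have W12: "W_12 r M N = bounded_class p True N True M"
    using W_12_iff[OF M N] unfolding r bounded_class_def by blast
  from assms(4) consider "X = W_1 r M" | "X = W_2 r M" | "X = W_12 r M N" by blast
  then show ?thesis
  proof cases
    case 1
    show ?thesis unfolding 1 W1 by (rule best_error_bounded_class) (use assms in auto)
  next
    case 2
    show ?thesis unfolding 2 W2 by (rule best_error_bounded_class) (use assms in auto)
  next
    case 3
    show ?thesis unfolding 3 W12 by (rule best_error_bounded_class) (use assms in auto)
  qed
qed

end
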